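(* Let $M$ be a smooth Banach manifold and let $X\in\mathfrak{X}(TM)$ be a vector field on $TM$, with iterated complete lifts $X^{c_i}\in\mathfrak{X}(T(T^iM))$, $i\in\mathbb{N}$. Then the projective limit $X^{c_\infty}=\varprojlim X^{c_i}$ exists and is a vector field on $TT^\infty M$.
   Context: All maps and manifolds are smooth; $M$ is a Banach manifold modeled on a Banach space $\mathbb{E}$ and admits smooth partitions of unity ("partitionable"). $T^0M=M$, $T^rM=T(T^{r-1}M)$, and $\pi_r:T^{r+1}M\to T^rM$ is the tangent bundle projection. $D$ denotes the tangent map, $D^2=DD$. $\mathfrak{X}(N)$ is the set of vector fields (smooth sections of $TN\to N$). Atlas: for an atlas $\{(U_\alpha,\phi_\alpha)\}$ of $M$, put $\phi_{\alpha_0}=\phi_\alpha$, $U_{\alpha_0}=U_\alpha$, $U_{\alpha_r}=\pi_{r-1}^{-1}(U_{\alpha_{r-1}})$, $\phi_{\alpha_r}=D\phi_{\alpha_{r-1}}$; these are charts of $T^rM$ with model space $\mathbb{E}_r=\mathbb{E}^{2^r}$. Canonical involution: $\kappa_1=\mathrm{id}_{TM}$, and for $r\ge 2$, $\kappa_r:T^rM\to T^rM$ is the diffeomorphism with $\partial_t\partial_s\gamma(t,s)=\kappa_r\partial_s\partial_t\gamma(t,s)$ for every smooth $\gamma:(-\epsilon,\epsilon)^2\to T^{r-2}M$; in charts $\kappa_r(x,y,X,Y)=(x,X,y,Y)$. Complete lift: for a vector field $\mathbf{A}:T^rM\to T^{r+1}M$ ($r\ge0$), $\mathbf{A}^c=D\kappa_{r+1}\circ\kappa_{r+2}\circ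 D\mathbf{A}\circ\kappa_{r+1}:T^{r+1}M\to T^{r+2}M$, a vector field on $T^{r+1}M$. For $X\in\mathfrak{X}(TM)$: $X^{c_0}=X$, $X^{c_j}=(X^{c_{j-1}})^c$, so $X^{c_j}:T(T^jM)\to T^2(T^jM)$. $T^\infty M$: the projective limit $\varprojlim T^iM$ of the system $\{T^iM\}_{i\in\mathbb{N}}$ with connecting maps $\pi_i:T^{i+1}M\to T^iM$, i.e. sequences $(x_i)$ with $\pi_i(x_{i+1})=x_i$. It is a (generalized) Fréchet manifold modeled on $\mathbb{E}_\infty=\varprojlim\mathbb{E}_i$ (connecting maps $\mathbb{E}_{i+1}=\mathbb{E}_i^2\to\mathbb{E}_i$, $(x,y)\mapsto x$), with charts $(\varprojlim U_{\alpha_i},\varprojlim\phi_{\alpha_i})$. Its tangent bundles are identified with projective limits: $TT^\infty M=\varprojlim\{T(T^iM),D\pi_i\}$ and $T^2(T^\infty M)=\varprojlim\{T^2(T^iM),D^2\pi_i\}$, with the corresponding limit charts. "$X^{c_\infty}=\varprojlim X^{c_i}$ exists" means that the maps $X^{c_i}$ are compatible with the connecting maps $D\pi_i$ and $D^2\pi_i$, so that $X^{c_\infty}:TT^\infty M\to T^2(T^\infty M)$, $(\xi_i)_i\mapsto(X^{c_i}(\xi_i))_i$, is well defined. *)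

theory Defs
  imports "HOL-Analysis.Analysis" "HOL-Library.Function_Algebras"
begin

section \<open>Smooth maps between Banach and Frechet spaces\<close>

text \<open>
  Sequence types \<^typ>\<open>nat \<Rightarrow> 'a\<close> carry the product topology of \<^theory>\<open>HOL-Analysis.Function_Topology\<close>
  and the pointwise additive structure of \<^theory>\<open>HOL-Library.Function_Algebras\<close>; the pointwise
  scalar multiplication is added here.
\<close>

instantiation "fun" :: (type, real_vector) real_vector
begin

definition scaleR_fun :: "real \<Rightarrow> ('a \<Rightarrow> 'b) \<Rightarrow> 'a \<Rightarrow> 'b" where
  "scaleR_fun c f = (\<lambda>i. c *\<^sub>R f i)"

instance
  by standard (auto simp: scaleR_fun_def fun_eq_iff scaleR_add_right scaleR_add_left)

end

definition has_dir_deriv ::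
    "('a::real_vector \<Rightarrow> 'b::{real_vector,t2_space}) \<Rightarrow> 'a \<Rightarrow> 'a \<Rightarrow> 'b \<Rightarrow> bool" where
  "has_dir_deriv f x v l \<longleftrightarrow> ((\<lambda>t::real. (f (x + t *\<^sub>R v) - f x) /\<^sub>R t) \<longlongrightarrow> l) (at 0)"

definition dir_deriv ::
    "('a::real_vector \<Rightarrow> 'b::{real_vector,t2_space}) \<Rightarrow> 'a \<Rightarrow> 'a \<Rightarrow> 'b" where
  "dir_deriv f x v = Lim (at 0) (\<lambda>t::real. (f (x + t *\<^sub>R v) - f x) /\<^sub>R t)"

text \<open>\<open>iter_deriv k f x v\<close> is \<open>d\<^sup>kf(x; v 0, \<dots>, v (k - 1))\<close>; the later entries of \<open>v\<close> are not used.\<close>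

primrec iter_deriv ::
    "nat \<Rightarrow> ('a::real_vector \<Rightarrow> 'b::{real_vector,t2_space}) \<Rightarrow> 'a \<Rightarrow> (nat \<Rightarrow> 'a) \<Rightarrow> 'b" where
  "iter_deriv 0 f x v = f x"
| "iter_deriv (Suc k) f x v = dir_deriv (\<lambda>y. iter_deriv k f y v) x (v k)"

text \<open>
  \<open>smooth_on S U f\<close>: here \<open>S\<close> is a linear subspace of the ambient type, playing the role of the
  model space, and \<open>U\<close> is a relatively open subset of \<open>S\<close>.  All iterated directional derivatives of
  \<open>f\<close> in directions of \<open>S\<close> exist on \<open>U\<close> and \<open>d\<^sup>kf : U \<times> S\<^sup>k \<rightarrow> F\<close> is jointly continuous for every \<open>k\<close>.
  This is the usual notion of a smooth map between Frechet spaces (Michal-Bastiani, Hamilton); between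
  Banach spaces it coincides with \<open>C\<^sup>\<infinity>\<close> in the sense of Frechet derivatives.
\<close>

definition smooth_on ::
    "'a::{real_vector,topological_space} set \<Rightarrow> 'a set \<Rightarrow> ('a \<Rightarrow> 'b::{real_vector,t2_space}) \<Rightarrow> bool" where
  "smooth_on S U f \<longleftrightarrow>
     (\<forall>k. (\<forall>x\<in>U. \<forall>v. range v \<subseteq> S \<longrightarrow> (\<exists>l. has_dir_deriv (\<lambda>y. iter_deriv k f y v) x (v k) l)) \<and>
          continuous_on (U \<times> {v. range v \<subseteq> S}) (\<lambda>(x, v). iter_deriv k f x v))"


section \<open>Manifolds given by an atlas\<close>

text \<open>The charts \<open>chart N \<alpha>\<close> are only meaningful on their domains \<open>cdom N \<alpha>\<close>, for \<open>\<alpha> \<in> idx N\<close>.\<close>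

record ('p, 'i, 'v) atlas =
  pts :: "'p set"
  idx :: "'i set"
  model :: "'v set"
  cdom :: "'i \<Rightarrow> 'p set"
  chart :: "'i \<Rightarrow> 'p \<Rightarrow> 'v"

definition chart_inv :: "('p, 'i, 'v) atlas \<Rightarrow> 'i \<Rightarrow> 'v \<Rightarrow> 'p" where
  "chart_inv N \<alpha> = inv_into (cdom N \<alpha>) (chart N \<alpha>)"

definition is_atlas :: "('p, 'i, 'v::{real_vector,t2_space}) atlas \<Rightarrow> bool" where
  "is_atlas N \<longleftrightarrow>
     pts N = (\<Union>\<alpha>\<in>idx N. cdom N \<alpha>) \<and>
     (\<forall>\<alpha>\<in>idx N. inj_on (chart N \<alpha>) (cdom N \<alpha>)) \<and>
     (\<forall>\<alpha>\<in>idx N. openin (top_of_set (model N)) (chart N \<alpha> ` cdom N \<alpha>)) \<and>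
     (\<forall>\<alpha>\<in>idx N. \<forall>\<beta>\<in>idx N.
        openin (top_of_set (model N)) (chart N \<alpha> ` (cdom N \<alpha> \<inter> cdom N \<beta>)) \<and>
        smooth_on (model N) (chart N \<alpha> ` (cdom N \<alpha> \<inter> cdom N \<beta>)) (chart N \<beta> \<circ> chart_inv N \<alpha>))"

definition banach_manifold :: "('m, 'i, 'e::banach) atlas \<Rightarrow> bool" where
  "banach_manifold M \<longleftrightarrow> is_atlas M \<and> model M = UNIV"

definition manifold_topology :: "('p, 'i, 'v::topological_space) atlas \<Rightarrow> 'p topology" where
  "manifold_topology N = topology (\<lambda>W. W \<subseteq> pts N \<and>
     (\<forall>\<alpha>\<in>idx N. openin (top_of_set (model N)) (chart N \<alpha> ` (W \<inter> cdom N \<alpha>))))"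

definition local_rep ::
    "('p, 'i, 'v) atlas \<Rightarrow> ('q, 'j, 'w) atlas \<Rightarrow> ('p \<Rightarrow> 'q) \<Rightarrow> 'i \<Rightarrow> 'j \<Rightarrow> 'v \<Rightarrow> 'w" where
  "local_rep N N' f \<alpha> \<beta> = chart N' \<beta> \<circ> f \<circ> chart_inv N \<alpha>"

text \<open>The openness condition expresses continuity of \<open>f\<close>.\<close>

definition smooth_map ::
    "('p, 'i, 'v::{real_vector,t2_space}) atlas \<Rightarrow> ('q, 'j, 'w::{real_vector,t2_space}) atlas \<Rightarrow>
     ('p \<Rightarrow> 'q) \<Rightarrow> bool" where
  "smooth_map N N' f \<longleftrightarrow> f ` pts N \<subseteq> pts N' \<and>
     (\<forall>\<alpha>\<in>idx N. \<forall>\<beta>\<in>idx N'. let V = chart N \<alpha> ` (cdom N \<alpha> \<inter> f -` cdom N' \<beta>) in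
        openin (top_of_set (model N)) V \<and> smooth_on (model N) V (local_rep N N' f \<alpha> \<beta>))"

definition diffeo ::
    "('p, 'i, 'v::{real_vector,t2_space}) atlas \<Rightarrow> ('q, 'j, 'w::{real_vector,t2_space}) atlas \<Rightarrow>
     ('p \<Rightarrow> 'q) \<Rightarrow> bool" where
  "diffeo N N' f \<longleftrightarrow> bij_betw f (pts N) (pts N') \<and> smooth_map N N' f \<and>
     smooth_map N' N (inv_into (pts N) f)"

definition open_submanifold :: "'v set \<Rightarrow> ('v, unit, 'v) atlas" where
  "open_submanifold U =
     \<lparr>pts = U, idx = UNIV, model = UNIV, cdom = (\<lambda>_. U), chart = (\<lambda>_ x. x)\<rparr>"

text \<open>
  Every open cover \<open>\<U>\<close> has a subordinate smooth partition of unity \<open>(\<psi> U)\<^sub>U\<^sub>\<in>\<^sub>\<U>\<close>.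
  Hausdorffness need not be required separately: applied to the covers by the complements of two
  points this condition already yields it.
\<close>

definition partitionable :: "('p, 'i, 'v::{real_vector,t2_space}) atlas \<Rightarrow> bool" where
  "partitionable M \<longleftrightarrow>
     (\<forall>\<U>. (\<forall>U\<in>\<U>. openin (manifold_topology M) U) \<and> \<Union>\<U> = pts M \<longrightarrow>
       (\<exists>\<psi> :: 'p set \<Rightarrow> 'p \<Rightarrow> real.
          (\<forall>U\<in>\<U>. smooth_map M (open_submanifold UNIV) (\<psi> U) \<and> (\<forall>p\<in>pts M. 0 \<le> \<psi> U p) \<and>
                 manifold_topology M closure_of {p \<in> pts M. \<psi> U p \<noteq> 0} \<subseteq> U) \<and>
          (\<forall>p\<in>pts M. \<exists>W. openin (manifold_topology M) W \<and> p \<in> W \<and>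
                 finite {U \<in> \<U>. \<exists>q\<in>W. \<psi> U q \<noteq> 0}) \<and>
          (\<forall>p\<in>pts M. (\<Sum>U\<in>{U \<in> \<U>. \<psi> U p \<noteq> 0}. \<psi> U p) = 1)))"


section \<open>Iterated tangent bundles\<close>

subsection \<open>Model spaces\<close>

text \<open>
  All the model spaces \<open>E\<^sub>r\<close>, the products of \<open>2\<^sup>r\<close> copies of \<open>E\<close>, are realised as subspaces of the
  single type \<^typ>\<open>nat \<Rightarrow> 'e\<close>, namely \<open>E\<^sub>r = {z. \<forall>i\<ge>2\<^sup>r. z i = 0}\<close>.  A pair is encoded by interleaving,
  which identifies \<open>E\<^sub>r \<times> E\<^sub>r\<close> with \<open>E\<^sub>r\<^sub>+\<^sub>1\<close> for every \<open>r\<close> at once, and \<open>E\<close> with \<open>E\<^sub>0\<close> via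
  \<open>emb\<close>.  The topology induced on \<open>E\<^sub>r\<close> is that of the finite product of copies of \<open>E\<close>.
\<close>

definition vpair :: "(nat \<Rightarrow> 'e) \<Rightarrow> (nat \<Rightarrow> 'e) \<Rightarrow> nat \<Rightarrow> 'e" where
  "vpair x y = (\<lambda>n. if even n then x (n div 2) else y (n div 2))"

definition vfst :: "(nat \<Rightarrow> 'e) \<Rightarrow> nat \<Rightarrow> 'e" where
  "vfst z = (\<lambda>n. z (2 * n))"

definition vsnd :: "(nat \<Rightarrow> 'e) \<Rightarrow> nat \<Rightarrow> 'e" where
  "vsnd z = (\<lambda>n. z (2 * n + 1))"

definition emb :: "'e::zero \<Rightarrow> nat \<Rightarrow> 'e" where
  "emb x = (\<lambda>n. if n = 0 then x else 0)"

definition vec_tangent :: "((nat \<Rightarrow> 'e::banach) \<Rightarrow> nat \<Rightarrow> 'e) \<Rightarrow> (nat \<Rightarrow> 'e) \<Rightarrow> nat \<Rightarrow> 'e" where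
  "vec_tangent g z = vpair (g (vfst z)) (dir_deriv g (vfst z) (vsnd z))"

subsection \<open>Points, tangent vectors and tangent maps\<close>

text \<open>
  \<open>Base m\<close> is a point of \<open>T\<^sup>0M = M\<close>.  \<open>Tvec p c\<close> is a tangent vector at \<open>p\<close>: \<open>c\<close> is an equivalence
  class of pairs \<open>(\<alpha>, v)\<close> of a chart around \<open>p\<close> and a vector of the model space, where \<open>(\<alpha>, v)\<close> and
  \<open>(\<beta>, w)\<close> are equivalent if the derivative of the coordinate change at \<open>p\<close> takes \<open>v\<close> to \<open>w\<close>.
\<close>

datatype ('m, 'i, 'e) point =
  Base 'm
| Tvec "('m, 'i, 'e) point" "('i \<times> (nat \<Rightarrow> 'e)) set"

type_synonym ('m, 'i, 'e) manifold = "(('m, 'i, 'e) point, 'i, nat \<Rightarrow> 'e) atlas"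

primrec foot :: "('m, 'i, 'e) point \<Rightarrow> ('m, 'i, 'e) point" where
  "foot (Base m) = undefined"
| "foot (Tvec p c) = p"

primrec cls :: "('m, 'i, 'e) point \<Rightarrow> ('i \<times> (nat \<Rightarrow> 'e)) set" where
  "cls (Base m) = undefined"
| "cls (Tvec p c) = c"

definition tangent_class ::
    "('m, 'i, 'e::banach) manifold \<Rightarrow> ('m, 'i, 'e) point \<Rightarrow> 'i \<Rightarrow> (nat \<Rightarrow> 'e) \<Rightarrow> ('i \<times> (nat \<Rightarrow> 'e)) set" where
  "tangent_class N p \<alpha> v =
     {(\<beta>, w). \<beta> \<in> idx N \<and> p \<in> cdom N \<beta> \<and>
              w = dir_deriv (chart N \<beta> \<circ> chart_inv N \<alpha>) (chart N \<alpha> p) v}"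

definition tangent_space ::
    "('m, 'i, 'e::banach) manifold \<Rightarrow> ('m, 'i, 'e) point \<Rightarrow> ('m, 'i, 'e) point set" where
  "tangent_space N p =
     {Tvec p (tangent_class N p \<alpha> v) | \<alpha> v. \<alpha> \<in> idx N \<and> p \<in> cdom N \<alpha> \<and> v \<in> model N}"

text \<open>The charts of \<open>TN\<close> are the tangent maps of the charts of \<open>N\<close>, defined over the same index set.\<close>

definition tangent_bundle :: "('m, 'i, 'e::banach) manifold \<Rightarrow> ('m, 'i, 'e) manifold" where
  "tangent_bundle N =
     \<lparr>pts = (\<Union>p\<in>pts N. tangent_space N p),
      idx = idx N,
      model = {z. vfst z \<in> model N \<and> vsnd z \<in> model N},
      cdom = (\<lambda>\<alpha>. \<Union>p\<in>cdom N \<alpha>. tangent_space N p),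
      chart = (\<lambda>\<alpha> \<xi>. vpair (chart N \<alpha> (foot \<xi>)) (THE v. (\<alpha>, v) \<in> cls \<xi>))\<rparr>"

text \<open>The tangent map of \<open>f : N \<rightarrow> N'\<close>.\<close>

definition tangent_map ::
    "('m, 'i, 'e::banach) manifold \<Rightarrow> ('m, 'i, 'e) manifold \<Rightarrow>
     (('m, 'i, 'e) point \<Rightarrow> ('m, 'i, 'e) point) \<Rightarrow> ('m, 'i, 'e) point \<Rightarrow> ('m, 'i, 'e) point" where
  "tangent_map N N' f \<xi> = Tvec (f (foot \<xi>))
     {(\<beta>, w). \<beta> \<in> idx N' \<and> f (foot \<xi>) \<in> cdom N' \<beta> \<and>
        (\<exists>\<alpha> v. (\<alpha>, v) \<in> cls \<xi> \<and> w = dir_deriv (local_rep N N' f \<alpha> \<beta>) (chart N \<alpha> (foot \<xi>)) v)}"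

definition base_manifold :: "('m, 'i, 'e::banach) atlas \<Rightarrow> ('m, 'i, 'e) manifold" where
  "base_manifold M =
     \<lparr>pts = Base ` pts M,
      idx = idx M,
      model = emb ` model M,
      cdom = (\<lambda>\<alpha>. Base ` cdom M \<alpha>),
      chart = (\<lambda>\<alpha> p. case p of Base m \<Rightarrow> emb (chart M \<alpha> m) | Tvec _ _ \<Rightarrow> undefined)\<rparr>"

primrec iter_tangent :: "('m, 'i, 'e::banach) atlas \<Rightarrow> nat \<Rightarrow> ('m, 'i, 'e) manifold" where
  "iter_tangent M 0 = base_manifold M"
| "iter_tangent M (Suc r) = tangent_bundle (iter_tangent M r)"

subsection \<open>Vector fields\<close>

definition smooth_section ::
    "('q, 'j, 'w::{real_vector,t2_space}) atlas \<Rightarrow> ('p, 'i, 'v::{real_vector,t2_space}) atlas \<Rightarrow>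
     ('q \<Rightarrow> 'p) \<Rightarrow> ('p \<Rightarrow> 'q) \<Rightarrow> bool" where
  "smooth_section B N \<pi> A \<longleftrightarrow> smooth_map N B A \<and> (\<forall>p\<in>pts N. \<pi> (A p) = p)"

definition vector_fields ::
    "('m, 'i, 'e::banach) manifold \<Rightarrow> (('m, 'i, 'e) point \<Rightarrow> ('m, 'i, 'e) point) set" where
  "vector_fields N = {A. smooth_section (tangent_bundle N) N foot A}"


section \<open>Canonical involution and complete lift\<close>

definition velocity ::
    "('m, 'i, 'e::banach) manifold \<Rightarrow> (real \<Rightarrow> ('m, 'i, 'e) point) \<Rightarrow> real \<Rightarrow> ('m, 'i, 'e) point" where
  "velocity N c t = Tvec (c t)
     {(\<beta>, w). \<beta> \<in> idx N \<and> c t \<in> cdom N \<beta> \<and> w = dir_deriv (chart N \<beta> \<circ> c) t 1}"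

definition dt_ds ::
    "('m, 'i, 'e::banach) manifold \<Rightarrow> (real \<times> real \<Rightarrow> ('m, 'i, 'e) point) \<Rightarrow> real \<Rightarrow> real \<Rightarrow>
     ('m, 'i, 'e) point" where
  "dt_ds N \<gamma> t s = velocity (tangent_bundle N) (\<lambda>t'. velocity N (\<lambda>s'. \<gamma> (t', s')) s) t"

definition ds_dt ::
    "('m, 'i, 'e::banach) manifold \<Rightarrow> (real \<times> real \<Rightarrow> ('m, 'i, 'e) point) \<Rightarrow> real \<Rightarrow> real \<Rightarrow>
     ('m, 'i, 'e) point" where
  "ds_dt N \<gamma> t s = velocity (tangent_bundle N) (\<lambda>s'. velocity N (\<lambda>t'. \<gamma> (t', s')) t) s"

text \<open>
  The canonical involution of \<open>T\<^sup>2N\<close>.  Every element of \<open>T\<^sup>2N\<close> is of the form \<open>\<partial>\<^sub>s\<partial>\<^sub>t\<gamma>(0,0)\<close>, so the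
  condition on surfaces determines the map on \<open>T\<^sup>2N\<close>; \<^const>\<open>extensional\<close> fixes it elsewhere.
\<close>

definition canonical_flip ::
    "('m, 'i, 'e::banach) manifold \<Rightarrow> ('m, 'i, 'e) point \<Rightarrow> ('m, 'i, 'e) point" where
  "canonical_flip N = (THE k. let TTN = tangent_bundle (tangent_bundle N) in
     k \<in> extensional (pts TTN) \<and> diffeo TTN TTN k \<and>
     (\<forall>\<epsilon>>0. \<forall>\<gamma>. smooth_map (open_submanifold ({-\<epsilon><..<\<epsilon>} \<times> {-\<epsilon><..<\<epsilon>})) N \<gamma> \<longrightarrow>
        (\<forall>t\<in>{-\<epsilon><..<\<epsilon>}. \<forall>s\<in>{-\<epsilon><..<\<epsilon>}. dt_ds N \<gamma> t s = k (ds_dt N \<gamma> t s))))"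

text \<open>\<open>kappa M r\<close> acts on \<open>T\<^sup>rM\<close> and is only used for \<open>r \<ge> 1\<close>.\<close>

definition kappa ::
    "('m, 'i, 'e::banach) atlas \<Rightarrow> nat \<Rightarrow> ('m, 'i, 'e) point \<Rightarrow> ('m, 'i, 'e) point" where
  "kappa M r = (if r < 2 then (\<lambda>\<xi>. \<xi>) else canonical_flip (iter_tangent M (r - 2)))"

text \<open>The complete lift of a vector field \<open>A : T\<^sup>rM \<rightarrow> T\<^sup>r\<^sup>+\<^sup>1M\<close>.\<close>

definition complete_lift ::
    "('m, 'i, 'e::banach) atlas \<Rightarrow> nat \<Rightarrow> (('m, 'i, 'e) point \<Rightarrow> ('m, 'i, 'e) point) \<Rightarrow>
     ('m, 'i, 'e) point \<Rightarrow> ('m, 'i, 'e) point" where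
  "complete_lift M r A =
     tangent_map (iter_tangent M (r + 1)) (iter_tangent M (r + 1)) (kappa M (r + 1)) \<circ>
     kappa M (r + 2) \<circ>
     tangent_map (iter_tangent M r) (iter_tangent M (r + 1)) A \<circ>
     kappa M (r + 1)"

text \<open>\<open>iter_lift M X j : T\<^sup>j\<^sup>+\<^sup>1M \<rightarrow> T\<^sup>j\<^sup>+\<^sup>2M\<close>, for a vector field \<open>X\<close> on \<open>TM\<close>.\<close>

primrec iter_lift ::
    "('m, 'i, 'e::banach) atlas \<Rightarrow> (('m, 'i, 'e) point \<Rightarrow> ('m, 'i, 'e) point) \<Rightarrow> nat \<Rightarrow>
     ('m, 'i, 'e) point \<Rightarrow> ('m, 'i, 'e) point" where
  "iter_lift M X 0 = X"
| "iter_lift M X (Suc j) = complete_lift M (j + 1) (iter_lift M X j)"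


section \<open>Projective limits\<close>

definition proj_lim :: "(nat \<Rightarrow> 'a set) \<Rightarrow> (nat \<Rightarrow> 'a \<Rightarrow> 'a) \<Rightarrow> (nat \<Rightarrow> 'a) set" where
  "proj_lim A f = {x. (\<forall>i. x i \<in> A i) \<and> (\<forall>i. f i (x (Suc i)) = x i)}"

text \<open>
  The limit of manifolds \<open>N i\<close> whose charts are indexed by the same set, with connecting maps
  \<open>f i : N (i + 1) \<rightarrow> N i\<close> and connecting maps \<open>g\<close> between the model spaces.  As a subset of
  \<^typ>\<open>nat \<Rightarrow> nat \<Rightarrow> 'e\<close> the limit of the model spaces carries the projective limit topology.
\<close>

definition lim_manifold ::
    "(nat \<Rightarrow> ('m, 'i, 'e::banach) manifold) \<Rightarrow>
     (nat \<Rightarrow> ('m, 'i, 'e) point \<Rightarrow> ('m, 'i, 'e) point) \<Rightarrow> ((nat \<Rightarrow> 'e) \<Rightarrow> nat \<Rightarrow> 'e) \<Rightarrow>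
     (nat \<Rightarrow> ('m, 'i, 'e) point, 'i, nat \<Rightarrow> nat \<Rightarrow> 'e) atlas" where
  "lim_manifold N f g =
     \<lparr>pts = proj_lim (\<lambda>i. pts (N i)) f,
      idx = idx (N 0),
      model = proj_lim (\<lambda>i. model (N i)) (\<lambda>_. g),
      cdom = (\<lambda>\<alpha>. proj_lim (\<lambda>i. cdom (N i) \<alpha>) f),
      chart = (\<lambda>\<alpha> x i. chart (N i) \<alpha> (x i))\<rparr>"

text \<open>\<open>D_proj M i = D\<pi>\<^sub>i : T\<^sup>i\<^sup>+\<^sup>2M \<rightarrow> T\<^sup>i\<^sup>+\<^sup>1M\<close> and \<open>D2_proj M i = D\<^sup>2\<pi>\<^sub>i : T\<^sup>i\<^sup>+\<^sup>3M \<rightarrow> T\<^sup>i\<^sup>+\<^sup>2M\<close>.\<close>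

definition D_proj :: "('m, 'i, 'e::banach) atlas \<Rightarrow> nat \<Rightarrow> ('m, 'i, 'e) point \<Rightarrow> ('m, 'i, 'e) point" where
  "D_proj M i = tangent_map (iter_tangent M (i + 1)) (iter_tangent M i) foot"

definition D2_proj :: "('m, 'i, 'e::banach) atlas \<Rightarrow> nat \<Rightarrow> ('m, 'i, 'e) point \<Rightarrow> ('m, 'i, 'e) point" where
  "D2_proj M i = tangent_map (iter_tangent M (i + 2)) (iter_tangent M (i + 1)) (D_proj M i)"

text \<open>
  \<open>TT\<^sup>\<infinity>M\<close> and \<open>T\<^sup>2T\<^sup>\<infinity>M\<close>.  The connecting maps \<open>E\<^sub>i\<^sub>+\<^sub>1 \<rightarrow> E\<^sub>i\<close> of the model spaces of \<open>T\<^sup>\<infinity>M\<close> are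
  \<^const>\<open>vfst\<close>.
\<close>

definition T_Tinf ::
    "('m, 'i, 'e::banach) atlas \<Rightarrow> (nat \<Rightarrow> ('m, 'i, 'e) point, 'i, nat \<Rightarrow> nat \<Rightarrow> 'e) atlas" where
  "T_Tinf M = lim_manifold (\<lambda>i. iter_tangent M (i + 1)) (D_proj M) (vec_tangent vfst)"

definition T2_Tinf ::
    "('m, 'i, 'e::banach) atlas \<Rightarrow> (nat \<Rightarrow> ('m, 'i, 'e) point, 'i, nat \<Rightarrow> nat \<Rightarrow> 'e) atlas" where
  "T2_Tinf M =
     lim_manifold (\<lambda>i. iter_tangent M (i + 2)) (D2_proj M) (vec_tangent (vec_tangent vfst))"

definition lim_map :: "(nat \<Rightarrow> 'a \<Rightarrow> 'b) \<Rightarrow> (nat \<Rightarrow> 'a) \<Rightarrow> nat \<Rightarrow> 'b" where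
  "lim_map F = (\<lambda>\<xi> i. F i (\<xi> i))"

text \<open>
  Vector fields on \<open>TT\<^sup>\<infinity>M\<close>, with \<open>T(TT\<^sup>\<infinity>M)\<close> identified with \<open>T\<^sup>2T\<^sup>\<infinity>M\<close>; its projection onto \<open>TT\<^sup>\<infinity>M\<close>
  is the limit of the bundle projections \<open>T(TT\<^sup>iM) \<rightarrow> TT\<^sup>iM\<close>.
\<close>

definition vector_fields_T_Tinf ::
    "('m, 'i, 'e::banach) atlas \<Rightarrow>
     ((nat \<Rightarrow> ('m, 'i, 'e) point) \<Rightarrow> nat \<Rightarrow> ('m, 'i, 'e) point) set" where
  "vector_fields_T_Tinf M =
     {A. smooth_section (T2_Tinf M) (T_Tinf M) (lim_map (\<lambda>_. foot)) A}"

end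

theory Submission
  imports Defs
begin

text \<open>
  Write \<open>\<pi>\<close> for the bundle projections and \<open>\<kappa>\<close> for the canonical involutions.  From \<open>\<pi> \<circ> \<kappa> = D\<pi>\<close> and
  \<open>D\<pi> \<circ> \<kappa> = \<pi>\<close> the compatibility of the complete lift \<open>A\<^sup>c = D\<kappa> \<circ> \<kappa> \<circ> DA \<circ> \<kappa>\<close> with the connecting maps is
  purely functorial: \<open>D\<^sup>2\<pi> \<circ> A\<^sup>c = D(D\<pi> \<circ> \<kappa>) \<circ> \<kappa> \<circ> DA \<circ> \<kappa> = D\<pi> \<circ> \<kappa> \<circ> DA \<circ> \<kappa> = \<pi> \<circ> DA \<circ> \<kappa> =
  A \<circ> \<pi> \<circ> \<kappa> = A \<circ> D\<pi>\<close>.  In the charts of the limit the map \<open>X\<^sup>c\<^sup>\<infinity>\<close> acts componentwise, and since all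
  maps preserve the base point in \<open>M\<close>, the domain of a local representative is cut out by an open
  condition on the component of index \<open>0\<close>; hence smoothness can be checked componentwise.

  The involution exists because the second tangent map of a coordinate change commutes with the
  exchange of the two middle components, by the symmetry of second derivatives.  It is unique because
  the vector \<open>(x, y, X, Y)\<close> is realised by the surface \<open>x + ty + sX + tsY\<close>.
\<close>

section \<open>Calculus\<close>

text \<open>All model spaces lie in sequence types, which carry the product topology and no norm,
  and smoothness means jointly continuous directional derivatives. Two facts make this workable.
  Joint continuity of the first derivative gives strict differentiability: base point and direction
  may vary while the step tends to 0. Additivity in the direction and the chain rule rest on this,
  with norm estimates made one coordinate at a time. And model spaces are closed linear subspaces,
  so limits of difference quotients stay inside. The involution is given by a definite description,
  so nothing can be computed with complete lifts before a concrete map, glued from a coordinate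
  formula, is shown to be its unique solution. Likewise a tangent map collects the images of all
  representatives of a vector and has a usable value only once these agree. The resulting identities
  hold at genuine points of the bundles only, so functorial computations must track membership in
  \<open>pts\<close>. The model of the limit is a Frechet space. No chain rule is developed there:
  each component of the limit map depends on one component of its argument.\<close>

lemma tendsto_fun_iff: "(f \<longlongrightarrow> l) F \<longleftrightarrow> (\<forall>i. ((\<lambda>x. f x i) \<longlongrightarrow> l i) F)"
  for f :: "'a \<Rightarrow> 'i \<Rightarrow> 'b::topological_space"
  using limitin_componentwise[of "\<lambda>_. euclidean" UNIV f l F]
  by (simp add: euclidean_product_topology)

lemma tendsto_coord: "(f \<longlongrightarrow> l) F \<Longrightarrow> ((\<lambda>x. f x i) \<longlongrightarrow> l i) F"
  for f :: "'a \<Rightarrow> 'i \<Rightarrow> 'b::topological_space"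
  by (simp only: tendsto_fun_iff)

text \<open>Sequence types carry no norm. The instances make \<open>tendsto_add\<close>,
  \<open>continuous_on_add\<close> and the like apply to sequence-valued maps; scalar multiplication
  is handled coordinatewise below.\<close>

instance "fun" :: (type, topological_monoid_add) topological_monoid_add
proof
  fix a b :: "'a \<Rightarrow> 'b"
  have "((\<lambda>x. fst x i + snd x i) \<longlongrightarrow> a i + b i) (nhds a \<times>\<^sub>F nhds b)" for i
    by (rule tendsto_add[OF tendsto_coord[OF filterlim_fst] tendsto_coord[OF filterlim_snd]])
  then show "((\<lambda>x. fst x + snd x) \<longlongrightarrow> a + b) (nhds a \<times>\<^sub>F nhds b)"
    unfolding tendsto_fun_iff plus_fun_apply by blast
qed

instance "fun" :: (type, topological_comm_monoid_add) topological_comm_monoid_add ..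

instance "fun" :: (type, topological_group_add) topological_group_add
proof
  fix a :: "'a \<Rightarrow> 'b"
  have "((\<lambda>x. - x i) \<longlongrightarrow> - a i) (nhds a)" for i
    by (rule tendsto_minus[OF tendsto_coord[OF filterlim_ident]])
  then show "(uminus \<longlongrightarrow> - a) (nhds a)"
    unfolding tendsto_fun_iff uminus_apply by blast
qed

lemma continuous_on_coord:
  "continuous_on A f \<Longrightarrow> continuous_on A (\<lambda>x. f x i)"
  by (rule continuous_on_product_then_coordinatewise)

lemma continuous_on_scaleR_fun:
  fixes g :: "'a::topological_space \<Rightarrow> 'i \<Rightarrow> 'b::real_normed_vector"
  assumes "continuous_on A c" "continuous_on A g"
  shows "continuous_on A (\<lambda>x. c x *\<^sub>R g x)"
  unfolding scaleR_fun_def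
  by (rule continuous_on_coordinatewise_then_product)
    (rule continuous_on_scaleR[OF assms(1) continuous_on_coord[OF assms(2)]])

lemma tendsto_scaleR_fun:
  fixes g :: "'a \<Rightarrow> 'i \<Rightarrow> 'b::real_normed_vector"
  assumes "(c \<longlongrightarrow> a) F" "(g \<longlongrightarrow> l) F"
  shows "((\<lambda>x. c x *\<^sub>R g x) \<longlongrightarrow> a *\<^sub>R l) F"
proof -
  have "((\<lambda>x. c x *\<^sub>R g x i) \<longlongrightarrow> a *\<^sub>R l i) F" for i
    by (rule tendsto_scaleR[OF assms(1) tendsto_coord[OF assms(2)]])
  then show ?thesis
    unfolding tendsto_fun_iff scaleR_fun_def by blast
qed

section \<open>Directional derivatives, iterated derivatives and criteria for smoothness\<close>

lemma has_dir_deriv_imp: "has_dir_deriv f x v l \<Longrightarrow> dir_deriv f x v = l"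
  unfolding has_dir_deriv_def dir_deriv_def by (rule tendsto_Lim[rotated]) auto

lemma dir_deriv_eq_The: "dir_deriv f x v = (THE l. has_dir_deriv f x v l)"
  by (simp add: dir_deriv_def t2_space_class.Lim_def has_dir_deriv_def)

lemma has_dir_deriv_fun_iff:
  fixes f :: "'a::real_vector \<Rightarrow> 'i::countable \<Rightarrow> 'b::{real_vector,metric_space}"
  shows "has_dir_deriv f x v l \<longleftrightarrow> (\<forall>i. has_dir_deriv (\<lambda>y. f y i) x v (l i))"
  by (simp add: has_dir_deriv_def tendsto_fun_iff scaleR_fun_def)

text \<open>The filter \<open>at 0\<close> leaves out t = 0, so agreement of the subtracted values
  at \<open>x\<close> itself is a separate premise.\<close>

lemma has_dir_deriv_transform:
  assumes "has_dir_deriv f x v l" "\<forall>\<^sub>F t in at 0. f (x + t *\<^sub>R v) = g (x + t *\<^sub>R v)" "f x = g x"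
  shows "has_dir_deriv g x v l"
  using assms unfolding has_dir_deriv_def
  by (elim Lim_transform_eventually) (auto elim: eventually_mono)

lemma has_dir_deriv_const: "has_dir_deriv (\<lambda>_. c) x v 0"
  by (simp add: has_dir_deriv_def)

lemma has_dir_deriv_add:
  fixes f :: "'a::real_vector \<Rightarrow> nat \<Rightarrow> 'b::real_normed_vector"
  assumes "has_dir_deriv f x v l" "has_dir_deriv g x v m"
  shows "has_dir_deriv (\<lambda>y. f y + g y) x v (l + m)"
  using tendsto_add[OF assms[unfolded has_dir_deriv_def]]
  by (simp add: has_dir_deriv_def algebra_simps)

lemma has_dir_deriv_scaleR:
  fixes f :: "'a::real_vector \<Rightarrow> nat \<Rightarrow> 'b::real_normed_vector"
  assumes "has_dir_deriv f x v l"
  shows "has_dir_deriv (\<lambda>y. c *\<^sub>R f y) x v (c *\<^sub>R l)"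
  using tendsto_scaleR_fun[OF tendsto_const assms[unfolded has_dir_deriv_def], of c]
  by (simp add: has_dir_deriv_def algebra_simps)

lemma has_dir_deriv_sum:
  fixes f :: "'c \<Rightarrow> 'a::real_vector \<Rightarrow> nat \<Rightarrow> 'b::real_normed_vector"
  assumes "\<And>i. i \<in> I \<Longrightarrow> has_dir_deriv (f i) x v (l i)"
  shows "has_dir_deriv (\<lambda>y. \<Sum>i\<in>I. f i y) x v (\<Sum>i\<in>I. l i)"
  using assms
  by (induction I rule: infinite_finite_induct) (auto intro: has_dir_deriv_add has_dir_deriv_const)

text \<open>Openness along lines is all that is needed to localise directional derivatives, and it makes
  sense in every model space, including that of the limit.\<close>

definition radially_open :: "'a::real_vector set \<Rightarrow> 'a set \<Rightarrow> bool" where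
  "radially_open S U \<longleftrightarrow> (\<forall>x\<in>U. \<forall>v\<in>S. \<forall>\<^sub>F t in at 0. x + t *\<^sub>R v \<in> U)"

lemma has_dir_deriv_cong:
  assumes "radially_open S U" "x \<in> U" "v \<in> S" "\<And>y. y \<in> U \<Longrightarrow> f y = g y"
  shows "has_dir_deriv f x v = has_dir_deriv g x v"
proof -
  have ev: "\<forall>\<^sub>F t in at 0. f (x + t *\<^sub>R v) = g (x + t *\<^sub>R v)"
  proof (rule eventually_mono)
    show "\<forall>\<^sub>F t in at 0. x + t *\<^sub>R v \<in> U"
      using assms(1-3) by (auto simp: radially_open_def)
  qed (rule assms(4))
  show ?thesis
  proof (rule ext, rule iffI)
    fix l
    show "has_dir_deriv g x v l" if "has_dir_deriv f x v l"
      using that ev assms(4)[OF assms(2)] by (rule has_dir_deriv_transform)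
    have "\<forall>\<^sub>F t in at 0. g (x + t *\<^sub>R v) = f (x + t *\<^sub>R v)"
      using ev by (rule eventually_mono) simp
    then show "has_dir_deriv f x v l" if "has_dir_deriv g x v l"
      using that assms(4)[OF assms(2)] by (auto intro: has_dir_deriv_transform)
  qed
qed

lemma dir_deriv_cong:
  assumes "radially_open S U" "x \<in> U" "v \<in> S" "\<And>y. y \<in> U \<Longrightarrow> f y = g y"
  shows "dir_deriv f x v = dir_deriv g x v"
  using has_dir_deriv_cong[OF assms] by (simp add: dir_deriv_eq_The)

lemma iter_deriv_cong:
  assumes "radially_open S U" "x \<in> U" "range v \<subseteq> S" "\<And>y. y \<in> U \<Longrightarrow> f y = g y"
  shows "iter_deriv k f x v = iter_deriv k g x v"
  using assms(2)
proof (induction k arbitrary: x)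
  case (Suc k)
  then show ?case
    using assms(1,3) by (auto intro!: dir_deriv_cong[of S U])
qed (use assms in auto)

lemma iter_deriv_dep:
  assumes "\<And>i. i < k \<Longrightarrow> v i = w i"
  shows "iter_deriv k f x v = iter_deriv k f x w"
  using assms by (induction k arbitrary: x) auto

text \<open>\<open>iter_deriv\<close> adds the newest direction outermost. Peeling the oldest one
  from inside turns a derivative of order k + 1 into one of order k of \<open>df\<close>, the form
  needed whenever an argument passes from \<open>f\<close> to its first derivative.\<close>

lemma iter_deriv_Suc_left:
  "iter_deriv (Suc k) f x v = iter_deriv k (\<lambda>y. dir_deriv f y (v 0)) x (\<lambda>i. v (Suc i))"
proof (induction k arbitrary: x)
  case (Suc k)
  then have "(\<lambda>y. iter_deriv (Suc k) f y v) =
      (\<lambda>y. iter_deriv k (\<lambda>y. dir_deriv f y (v 0)) y (\<lambda>i. v (Suc i)))"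
    by (rule ext)
  then show ?case
    by (simp only: iter_deriv.simps(2))
qed simp

lemma smooth_on_has_dir_deriv:
  assumes "smooth_on S U f" "x \<in> U" "range v \<subseteq> S"
  shows "has_dir_deriv (\<lambda>y. iter_deriv k f y v) x (v k) (iter_deriv (Suc k) f x v)"
proof -
  obtain l where "has_dir_deriv (\<lambda>y. iter_deriv k f y v) x (v k) l"
    using assms unfolding smooth_on_def by meson
  then show ?thesis
    using has_dir_deriv_imp by fastforce
qed

lemma smooth_on_dir_deriv1:
  assumes "smooth_on S U f" "x \<in> U" "v \<in> S"
  shows "has_dir_deriv f x v (dir_deriv f x v)"
  using smooth_on_has_dir_deriv[OF assms(1,2), of "\<lambda>_. v" 0] assms(3) by auto

lemma smooth_on_continuous:
  assumes "smooth_on S U f"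
  shows "continuous_on (U \<times> {v. range v \<subseteq> S}) (\<lambda>(x, v). iter_deriv k f x v)"
  using assms unfolding smooth_on_def by blast

text \<open>The family \<open>e\<close> is a guess for all iterated derivatives, of which only the
  one-step recursion has to be verified. The second conclusion confirms the guess; sums and
  multiples of iterated derivatives are computed in this way.\<close>

lemma smooth_onI:
  assumes "radially_open S U"
    and "\<And>x v. x \<in> U \<Longrightarrow> range v \<subseteq> S \<Longrightarrow> f x = e 0 x v"
    and "\<And>k x v. x \<in> U \<Longrightarrow> range v \<subseteq> S \<Longrightarrow> has_dir_deriv (\<lambda>y. e k y v) x (v k) (e (Suc k) x v)"
    and "\<And>k. continuous_on (U \<times> {v. range v \<subseteq> S}) (\<lambda>(x, v). e k x v)"
  shows "smooth_on S U f"
    and "\<And>k x v. x \<in> U \<Longrightarrow> range v \<subseteq> S \<Longrightarrow> iter_deriv k f x v = e k x v"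
proof -
  show it: "iter_deriv k f x v = e k x v" if "x \<in> U" "range v \<subseteq> S" for k x v
    using that(1)
  proof (induction k arbitrary: x)
    case (Suc k)
    have "dir_deriv (\<lambda>y. iter_deriv k f y v) x (v k) = dir_deriv (\<lambda>y. e k y v) x (v k)"
      using Suc that(2) by (intro dir_deriv_cong[OF assms(1)]) auto
    then show ?case
      using has_dir_deriv_imp[OF assms(3)[OF Suc.prems that(2)]] by simp
  qed (use that assms(2) in auto)
  have "has_dir_deriv (\<lambda>y. iter_deriv k f y v) x (v k) (e (Suc k) x v)"
    if "x \<in> U" "range v \<subseteq> S" for k x v
  proof -
    have "has_dir_deriv (\<lambda>y. iter_deriv k f y v) x (v k) = has_dir_deriv (\<lambda>y. e k y v) x (v k)"
      using that it by (intro has_dir_deriv_cong[OF assms(1)]) auto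
    then show ?thesis
      using assms(3)[OF that, of k] by simp
  qed
  moreover have "continuous_on (U \<times> {v. range v \<subseteq> S}) (\<lambda>(x, v). iter_deriv k f x v)" for k
    using assms(4)[of k] by (rule continuous_on_eq) (use it in auto)
  ultimately show "smooth_on S U f"
    unfolding smooth_on_def by blast
qed

lemma smooth_on_cong:
  assumes "radially_open S U" "\<And>x. x \<in> U \<Longrightarrow> f x = g x" "smooth_on S U f"
  shows "smooth_on S U g"
proof (rule smooth_onI(1)[where e = "\<lambda>k x v. iter_deriv k f x v"])
  show "has_dir_deriv (\<lambda>y. iter_deriv k f y v) x (v k) (iter_deriv (Suc k) f x v)"
    if "x \<in> U" "range v \<subseteq> S" for k x v
    by (rule smooth_on_has_dir_deriv[OF assms(3) that])
qed (use assms smooth_on_continuous in auto)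

lemma smooth_on_subset:
  assumes "smooth_on S U f" "V \<subseteq> U"
  shows "smooth_on S V f"
  unfolding smooth_on_def
proof (intro allI conjI ballI impI)
  fix k
  show "continuous_on (V \<times> {v. range v \<subseteq> S}) (\<lambda>(x, v). iter_deriv k f x v)"
    by (rule continuous_on_subset[OF smooth_on_continuous[OF assms(1)]]) (use assms(2) in auto)
  fix x and v :: "nat \<Rightarrow> 'a"
  assume "x \<in> V" "range v \<subseteq> S"
  then show "\<exists>l. has_dir_deriv (\<lambda>y. iter_deriv k f y v) x (v k) l"
    using smooth_on_has_dir_deriv[OF assms(1), of x v] assms(2) by blast
qed

text \<open>Existence of derivatives is a pointwise matter, and continuity at a pair of point and
  directions is tested on the neighbourhood \<open>T \<times> UNIV\<close>: only the base point has
  to be localised.\<close>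

lemma smooth_on_local:
  assumes "\<And>x. x \<in> U \<Longrightarrow> \<exists>W. openin (top_of_set U) W \<and> x \<in> W \<and> smooth_on S W f"
  shows "smooth_on S U f"
  unfolding smooth_on_def
proof (intro allI conjI ballI impI)
  fix k x and v :: "nat \<Rightarrow> 'a"
  assume xv: "x \<in> U" "range v \<subseteq> S"
  obtain W where W: "openin (top_of_set U) W" "x \<in> W" "smooth_on S W f"
    using assms xv by blast
  show "\<exists>l. has_dir_deriv (\<lambda>y. iter_deriv k f y v) x (v k) l"
    using smooth_on_has_dir_deriv[OF W(3,2) xv(2)] by blast
next
  fix k
  let ?V = "{v :: nat \<Rightarrow> 'a. range v \<subseteq> S}"
  show "continuous_on (U \<times> ?V) (\<lambda>(x, v). iter_deriv k f x v)"
    unfolding continuous_on_def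
  proof
    fix p assume p: "p \<in> U \<times> ?V"
    obtain W where W: "openin (top_of_set U) W" "fst p \<in> W" "smooth_on S W f"
      using assms[of "fst p"] p by auto
    obtain T where T: "open T" "W = U \<inter> T"
      using W(1) by (auto simp: openin_open)
    let ?g = "\<lambda>(x, v). iter_deriv k f x v"
    have "p \<in> W \<times> ?V"
      using W(2) p by (cases p) auto
    then have "(?g \<longlongrightarrow> ?g p) (at p within W \<times> ?V)"
      using smooth_on_continuous[OF W(3), of k] unfolding continuous_on_def by blast
    moreover have "at p within W \<times> ?V = at p within U \<times> ?V"
    proof (rule at_within_nhd)
      show "open (T \<times> (UNIV :: (nat \<Rightarrow> 'a) set))"
        using T by (simp add: open_Times)
    qed (use T W p in auto)
    ultimately show "(?g \<longlongrightarrow> ?g p) (at p within U \<times> ?V)"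
      by simp
  qed
qed

lemma continuous_on_fun_ap:
  "continuous_on A v \<Longrightarrow> continuous_on A (\<lambda>x. L (v x i))" if "continuous_on UNIV L"
  by (rule continuous_on_compose2[OF that continuous_on_coord]) auto

text \<open>The difference quotients of \<open>F \<circ> L\<close> are literally those of
  \<open>F\<close> in the direction \<open>L v\<close>. The identities \<open>hd\<close> and
  \<open>it\<close> therefore hold even where no limit exists, and no openness of \<open>U\<close>
  enters.\<close>

lemma smooth_on_precompose_linear:
  fixes L :: "'a::{real_vector,topological_space} \<Rightarrow> 'b::{real_vector,topological_space}"
  assumes "smooth_on S' U' F" "linear L" "continuous_on UNIV L" "L ` S \<subseteq> S'" "L ` U \<subseteq> U'"
  shows "smooth_on S U (\<lambda>x. F (L x))"
proof -
  have hd: "has_dir_deriv (\<lambda>y. g (L y)) x v l \<longleftrightarrow> has_dir_deriv g (L x) (L v) l" for g :: "'b \<Rightarrow> 'c" and x v l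
    by (simp add: has_dir_deriv_def linear_add[OF assms(2)] linear_scale[OF assms(2)])
  have it: "iter_deriv k (\<lambda>x. F (L x)) x v = iter_deriv k F (L x) (\<lambda>i. L (v i))" for k x v
  proof (induction k arbitrary: x)
    case (Suc k)
    have "dir_deriv (\<lambda>y. g (L y)) x v = dir_deriv g (L x) (L v)" for g :: "'b \<Rightarrow> 'c" and x v
      unfolding dir_deriv_eq_The hd ..
    then show ?case
      by (simp add: Suc)
  qed simp
  have cont: "continuous_on (U \<times> {v. range v \<subseteq> S}) (\<lambda>p. (L (fst p), \<lambda>i. L (snd p i)))"
    by (intro continuous_on_Pair continuous_on_coordinatewise_then_product
        continuous_on_fun_ap[OF assms(3)] continuous_on_compose2[OF assms(3)]
        continuous_on_fst continuous_on_snd continuous_on_id subset_UNIV)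
  show ?thesis
    unfolding smooth_on_def it
  proof (intro allI conjI ballI impI)
    fix k x and v :: "nat \<Rightarrow> 'a" assume "x \<in> U" "range v \<subseteq> S"
    then have "L x \<in> U'" "range (\<lambda>i. L (v i)) \<subseteq> S'"
      using assms(4,5) by auto
    then show "\<exists>l. has_dir_deriv (\<lambda>y. iter_deriv k F (L y) (\<lambda>i. L (v i))) x (v k) l"
      using smooth_on_has_dir_deriv[OF assms(1), of "L x" "\<lambda>i. L (v i)" k]
        hd[of "\<lambda>y. iter_deriv k F y (\<lambda>i. L (v i))" x "v k"] by blast
  next
    fix k
    show "continuous_on (U \<times> {v. range v \<subseteq> S}) (\<lambda>(x, v). iter_deriv k F (L x) (\<lambda>i. L (v i)))"
      using continuous_on_compose2[OF smooth_on_continuous[OF assms(1), of k] cont] assms(4,5)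
      by (force simp: case_prod_beta)
  qed
qed

lemma smooth_on_postcompose_linear:
  assumes "smooth_on S U f" "linear L" "continuous_on UNIV L" "radially_open S U"
  shows "smooth_on S U (\<lambda>x. L (f x))"
proof (rule smooth_onI(1)[where e = "\<lambda>k x v. L (iter_deriv k f x v)", OF assms(4)])
  fix k
  show "continuous_on (U \<times> {v. range v \<subseteq> S}) (\<lambda>(x, v). L (iter_deriv k f x v))"
    using continuous_on_compose2[OF assms(3) smooth_on_continuous[OF assms(1), of k]]
    by (simp add: case_prod_beta)
  fix x and v :: "nat \<Rightarrow> 'a" assume x: "x \<in> U" "range v \<subseteq> S"
  have "isCont L (iter_deriv (Suc k) f x v)"
    using assms(3) by (simp add: continuous_on_eq_continuous_at)
  then have "((\<lambda>t. L ((iter_deriv k f (x + t *\<^sub>R v k) v - iter_deriv k f x v) /\<^sub>R t)) \<longlongrightarrow>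
      L (iter_deriv (Suc k) f x v)) (at 0)"
    using smooth_on_has_dir_deriv[OF assms(1) x, of k] unfolding has_dir_deriv_def
    by (rule isCont_tendsto_compose)
  then show "has_dir_deriv (\<lambda>y. L (iter_deriv k f y v)) x (v k) (L (iter_deriv (Suc k) f x v))"
    by (simp add: has_dir_deriv_def linear_diff[OF assms(2)] linear_scale[OF assms(2)])
qed auto

lemma smooth_on_linear:
  fixes L :: "(nat \<Rightarrow> 'a::real_normed_vector) \<Rightarrow> nat \<Rightarrow> 'b::real_normed_vector"
  assumes "linear L" "continuous_on UNIV L" "radially_open S U"
  shows "smooth_on S U L"
proof (rule smooth_onI(1)[where e = "\<lambda>k x v. if k = 0 then L x else if k = 1 then L (v 0) else 0",
      OF assms(3)])
  fix k :: nat
  let ?V = "{v :: nat \<Rightarrow> nat \<Rightarrow> 'a. range v \<subseteq> S}"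
  have "continuous_on (U \<times> ?V) (\<lambda>p. L (fst p))"
    by (rule continuous_on_compose2[OF assms(2)]) (auto intro: continuous_on_fst continuous_on_id)
  moreover have "continuous_on (U \<times> ?V) (\<lambda>p. L (snd p 0))"
    by (rule continuous_on_compose2[OF assms(2) continuous_on_coord])
      (auto intro: continuous_on_snd continuous_on_id)
  ultimately show "continuous_on (U \<times> ?V)
      (\<lambda>(x, v). if k = 0 then L x else if k = 1 then L (v 0) else 0)"
    by (cases "k = 0"; cases "k = 1") (simp_all add: case_prod_beta)
  fix x :: "nat \<Rightarrow> 'a" and v :: "nat \<Rightarrow> nat \<Rightarrow> 'a"
  have "\<forall>\<^sub>F t in at 0. L y = (L (x + t *\<^sub>R y) - L x) /\<^sub>R t" for y
    unfolding eventually_at_filter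
    by (auto simp: linear_add[OF assms(1)] linear_scale[OF assms(1)])
  then have "has_dir_deriv L x y (L y)" for y
    unfolding has_dir_deriv_def by (rule Lim_transform_eventually[OF tendsto_const])
  then show "has_dir_deriv (\<lambda>y. if k = 0 then L y else if k = 1 then L (v 0) else 0) x (v k)
      (if Suc k = 0 then L x else if Suc k = 1 then L (v 0) else 0)"
    by (cases "k = 0"; cases "k = 1") (simp_all add: has_dir_deriv_const)
qed auto

text \<open>The setting of the finite levels. Closedness of \<open>S\<close> keeps limits of
  difference quotients in \<open>S\<close>. The model of the projective limit lives in a different
  type, and there only \<open>radially_open\<close> is used.\<close>

definition model_domain :: "(nat \<Rightarrow> 'a::real_normed_vector) set \<Rightarrow> (nat \<Rightarrow> 'a) set \<Rightarrow> bool" where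
  "model_domain S U \<longleftrightarrow> subspace S \<and> closed S \<and> openin (top_of_set S) U"

lemma continuous_on_affine:
  "continuous_on UNIV (\<lambda>(s, y, w). y + s *\<^sub>R (w :: nat \<Rightarrow> 'a::real_normed_vector))"
  unfolding case_prod_beta
  by (rule continuous_on_add[OF continuous_on_fst[OF continuous_on_snd]
        continuous_on_scaleR_fun[OF continuous_on_fst continuous_on_snd[OF continuous_on_snd]]])
    (rule continuous_on_id)+

lemma tendsto_affine:
  fixes w :: "'a \<Rightarrow> nat \<Rightarrow> 'b::real_normed_vector"
  assumes "(y \<longlongrightarrow> y0) F" "(w \<longlongrightarrow> w0) F" "(c \<longlongrightarrow> c0) F"
  shows "((\<lambda>t. y t + c t *\<^sub>R w t) \<longlongrightarrow> y0 + c0 *\<^sub>R w0) F"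
  by (rule tendsto_add[OF assms(1) tendsto_scaleR_fun[OF assms(3,2)]])

lemma model_domain_subset: "model_domain S U \<Longrightarrow> U \<subseteq> S"
  using openin_imp_subset unfolding model_domain_def by blast

lemma model_domain_open:
  assumes "model_domain S U"
  obtains A where "open A" "U = A \<inter> S"
proof -
  have "openin (top_of_set S) U"
    using assms by (simp add: model_domain_def)
  then obtain A where "open A" "U = S \<inter> A"
    by (auto simp: openin_open)
  then show thesis
    using that by (simp add: Int_commute)
qed

lemma model_domain_affine:
  assumes "model_domain S U" "x \<in> S" "v \<in> S"
  shows "x + t *\<^sub>R v \<in> S"
  using assms unfolding model_domain_def by (simp add: subspace_add subspace_scale)

lemma model_domain_eventually:
  assumes "model_domain S U" "(f \<longlongrightarrow> x) F" "x \<in> U" "\<forall>\<^sub>F t in F. f t \<in> S"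
  shows "\<forall>\<^sub>F t in F. f t \<in> U"
proof -
  obtain A where A: "open A" "U = A \<inter> S"
    using assms(1) by (rule model_domain_open)
  then have "\<forall>\<^sub>F t in F. f t \<in> A"
    using assms(2,3) by (auto simp: tendsto_def)
  then show ?thesis
    using assms(4) by eventually_elim (use A in simp)
qed

lemma model_domain_radially_open:
  assumes "model_domain S U"
  shows "radially_open S U"
  unfolding radially_open_def
proof (intro ballI)
  fix x v assume xv: "x \<in> U" "v \<in> S"
  have "((\<lambda>t. x + t *\<^sub>R v) \<longlongrightarrow> x + 0 *\<^sub>R v) (at 0)"
    by (rule tendsto_affine) (rule tendsto_const tendsto_ident_at)+
  then have "((\<lambda>t. x + t *\<^sub>R v) \<longlongrightarrow> x) (at 0)"
    by simp
  then show "\<forall>\<^sub>F t in at 0. x + t *\<^sub>R v \<in> U"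
    by (rule model_domain_eventually[OF assms])
      (use xv model_domain_affine[OF assms] model_domain_subset[OF assms] in auto)
qed

section \<open>Strict differentiability and its consequences\<close>

lemma has_vector_derivative_line:
  fixes f :: "'a::real_vector \<Rightarrow> 'b::real_normed_vector"
  assumes "has_dir_deriv f (y + s *\<^sub>R w) w l"
  shows "((\<lambda>s. f (y + s *\<^sub>R w)) has_vector_derivative l) (at s)"
proof -
  have eq: "y + s *\<^sub>R w + t *\<^sub>R w = y + (s + t) *\<^sub>R w" for t
    by (simp add: scaleR_add_left)
  have "((\<lambda>t. (f (y + (s + t) *\<^sub>R w) - f (y + s *\<^sub>R w)) /\<^sub>R t - l) \<longlongrightarrow> 0) (at 0)"
    using assms by (simp add: has_dir_deriv_def LIM_zero eq)
  then have "((\<lambda>t. norm ((f (y + (s + t) *\<^sub>R w) - f (y + s *\<^sub>R w)) /\<^sub>R t - l)) \<longlongrightarrow> 0) (at 0)"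
    by (rule tendsto_norm_zero)
  moreover have "\<forall>\<^sub>F t in at 0. norm ((f (y + (s + t) *\<^sub>R w) - f (y + s *\<^sub>R w)) /\<^sub>R t - l) =
      norm (f (y + (s + t) *\<^sub>R w) - f (y + s *\<^sub>R w) - t *\<^sub>R l) / norm t"
    unfolding eventually_at_filter
  proof (rule always_eventually, intro allI impI)
    fix t :: real assume "t \<noteq> 0"
    then have "(f (y + (s + t) *\<^sub>R w) - f (y + s *\<^sub>R w)) /\<^sub>R t - l =
        (f (y + (s + t) *\<^sub>R w) - f (y + s *\<^sub>R w) - t *\<^sub>R l) /\<^sub>R t"
      by (simp add: scaleR_diff_right)
    then show "norm ((f (y + (s + t) *\<^sub>R w) - f (y + s *\<^sub>R w)) /\<^sub>R t - l) =
        norm (f (y + (s + t) *\<^sub>R w) - f (y + s *\<^sub>R w) - t *\<^sub>R l) / norm t"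
      by (simp add: divide_inverse_commute)
  qed
  ultimately have "((\<lambda>t. norm (f (y + (s + t) *\<^sub>R w) - f (y + s *\<^sub>R w) - t *\<^sub>R l) / norm t) \<longlongrightarrow> 0) (at 0)"
    by (rule Lim_transform_eventually)
  then show ?thesis
    by (simp add: has_vector_derivative_def has_derivative_at bounded_linear_scaleR_left)
qed

text \<open>A map whose directional derivative is jointly continuous is strictly differentiable,
  by the mean value inequality.\<close>

lemma strict_dir_deriv:
  fixes f :: "(nat \<Rightarrow> 'a::real_normed_vector) \<Rightarrow> 'b::real_normed_vector"
  assumes dom: "model_domain S U"
    and D: "\<And>x v. x \<in> U \<Longrightarrow> v \<in> S \<Longrightarrow> has_dir_deriv f x v (f' x v)"
    and cont: "continuous_on (U \<times> S) (\<lambda>(x, v). f' x v)"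
    and lim: "(y \<longlongrightarrow> x) (at 0)" "(w \<longlongrightarrow> v) (at 0)"
    and ev: "\<forall>\<^sub>F t in at 0. y t \<in> S" "\<forall>\<^sub>F t in at 0. w t \<in> S"
    and xv: "x \<in> U" "v \<in> S"
  shows "((\<lambda>t::real. (f (y t + t *\<^sub>R w t) - f (y t)) /\<^sub>R t) \<longlongrightarrow> f' x v) (at 0)"
proof (rule tendstoI)
  fix e :: real assume "e > 0"
  obtain A0 where A0: "open A0" "U = A0 \<inter> S"
    using dom by (rule model_domain_open)
  \<comment> \<open>The budget is e/4 around \<open>f' x v\<close>: two derivatives on the segment
    then differ by at most e/2, which is the mean value bound, and replacing
    \<open>f' (y t) (w t)\<close> by \<open>f' x v\<close> costs another e/4.\<close>
  obtain W where W: "open W" "(x, v) \<in> W"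
    "\<And>p. p \<in> U \<times> S \<Longrightarrow> p \<in> W \<Longrightarrow> (\<lambda>(x, v). f' x v) p \<in> ball (f' x v) (e / 4)"
  proof -
    have "\<exists>W. open W \<and> (x, v) \<in> W \<and>
        (\<forall>p\<in>U \<times> S. p \<in> W \<longrightarrow> (\<lambda>(x, v). f' x v) p \<in> ball (f' x v) (e / 4))"
      by (rule cont[unfolded continuous_on_topological, rule_format]) (use xv \<open>e > 0\<close> in auto)
    then show thesis
      using that by blast
  qed
  obtain A B where "open A" "open B" "(x, v) \<in> A \<times> B" "A \<times> B \<subseteq> W"
    by (rule open_prod_elim[OF W(1,2)])
  then have AB: "open A" "open B" "x \<in> A" "v \<in> B" "A \<times> B \<subseteq> W"
    by auto
  \<comment> \<open>Openness of this preimage at (0, x, v) provides boxes for s, y and w such that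
    the whole segment from \<open>y t\<close> to \<open>y t + t *\<^sub>R w t\<close> stays in
    \<open>A \<inter> U\<close> for all small t at once.\<close>
  have op: "open ((\<lambda>(s, y, w). y + s *\<^sub>R w) -` (A0 \<inter> A))"
    by (rule open_vimage[OF open_Int[OF A0(1) AB(1)] continuous_on_affine])
  have mem: "(0, x, v) \<in> (\<lambda>(s, y, w). y + s *\<^sub>R w) -` (A0 \<inter> A)"
    using xv AB A0 by simp
  obtain T P where "open T" "open P" "(0, x, v) \<in> T \<times> P"
    "T \<times> P \<subseteq> (\<lambda>(s, y, w). y + s *\<^sub>R w) -` (A0 \<inter> A)"
    by (rule open_prod_elim[OF op mem])
  then have TP: "open T" "0 \<in> T" "open P" "(x, v) \<in> P"
    "T \<times> P \<subseteq> (\<lambda>(s, y, w). y + s *\<^sub>R w) -` (A0 \<inter> A)"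
    by auto
  obtain Y B' where "open Y" "open B'" "(x, v) \<in> Y \<times> B'" "Y \<times> B' \<subseteq> P"
    by (rule open_prod_elim[OF TP(3,4)])
  then have YB: "open Y" "open B'" "x \<in> Y" "v \<in> B'" "Y \<times> B' \<subseteq> P"
    by auto
  obtain d where d: "d > 0" "\<And>s. \<bar>s\<bar> < d \<Longrightarrow> s \<in> T"
    using TP(1,2) by (auto simp: open_dist dist_real_def)
  have "\<forall>\<^sub>F t::real in at 0. \<bar>t\<bar> < d"
    unfolding eventually_at using d(1) by (auto simp: dist_real_def)
  moreover have "\<forall>\<^sub>F t in at 0. y t \<in> Y"
    by (rule topological_tendstoD[OF lim(1) YB(1,3)])
  moreover have "\<forall>\<^sub>F t in at 0. w t \<in> B'"
    by (rule topological_tendstoD[OF lim(2) YB(2,4)])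
  moreover have "\<forall>\<^sub>F t in at 0. w t \<in> B"
    by (rule topological_tendstoD[OF lim(2) AB(2,4)])
  moreover have "\<forall>\<^sub>F t::real in at 0. t \<noteq> 0"
    by (simp add: eventually_at_filter)
  ultimately show "\<forall>\<^sub>F t in at 0. dist ((f (y t + t *\<^sub>R w t) - f (y t)) /\<^sub>R t) (f' x v) < e"
    using ev
  proof eventually_elim
    case (elim t)
    let ?I = "closed_segment 0 t"
    let ?h = "\<lambda>s. f (y t + s *\<^sub>R w t)"
    have in_A: "y t + s *\<^sub>R w t \<in> A \<inter> U" if "s \<in> ?I" for s
    proof -
      have "\<bar>s\<bar> \<le> \<bar>t\<bar>"
        using that by (auto simp: closed_segment_eq_real_ivl split: if_splits)
      then have "(s, y t, w t) \<in> T \<times> P"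
        using elim d(2)[of s] YB(5) by auto
      then have "y t + s *\<^sub>R w t \<in> A0 \<inter> A"
        using TP(5) by auto
      then show ?thesis
        using A0(2) model_domain_affine[OF dom] elim by simp
    qed
    have near: "norm (f' (y t + s *\<^sub>R w t) (w t) - f' x v) < e / 4" if "s \<in> ?I" for s
    proof -
      have "(y t + s *\<^sub>R w t, w t) \<in> W" "(y t + s *\<^sub>R w t, w t) \<in> U \<times> S"
        using in_A[OF that] elim AB(5) by auto
      then show ?thesis
        using W(3)[of "(y t + s *\<^sub>R w t, w t)"] by (simp add: dist_norm norm_minus_commute)
    qed
    have "norm (?h t - ?h 0 - (t - 0) *\<^sub>R f' (y t + 0 *\<^sub>R w t) (w t)) \<le> norm (t - 0) * (e / 2)"
    proof (rule vector_differentiable_bound_linearization[where S = ?I and ?x0.0 = 0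
          and f = ?h and f' = "\<lambda>s. f' (y t + s *\<^sub>R w t) (w t)"])
      \<comment> \<open>Along a line a directional derivative is an ordinary vector derivative of a
        curve, so the mean value inequality for real parameters applies.\<close>
      show "(?h has_vector_derivative f' (y t + s *\<^sub>R w t) (w t)) (at s within ?I)" if "s \<in> ?I" for s
        by (rule has_vector_derivative_at_within[OF has_vector_derivative_line[OF D]])
          (use in_A[OF that] elim in auto)
      show "norm (f' (y t + s *\<^sub>R w t) (w t) - f' (y t + 0 *\<^sub>R w t) (w t)) \<le> e / 2" if "s \<in> ?I" for s
        using norm_triangle_ineq4[of "f' (y t + s *\<^sub>R w t) (w t) - f' x v"
            "f' (y t + 0 *\<^sub>R w t) (w t) - f' x v"] near[OF that] near[of 0] by simp
    qed auto
    then have "norm (f (y t + t *\<^sub>R w t) - f (y t) - t *\<^sub>R f' (y t) (w t)) / \<bar>t\<bar> \<le> e / 2"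
      using elim by (simp add: divide_le_eq mult.commute)
    moreover have "norm (f (y t + t *\<^sub>R w t) - f (y t) - t *\<^sub>R f' (y t) (w t)) / \<bar>t\<bar> =
        norm ((f (y t + t *\<^sub>R w t) - f (y t)) /\<^sub>R t - f' (y t) (w t))"
    proof -
      have "(f (y t + t *\<^sub>R w t) - f (y t)) /\<^sub>R t - f' (y t) (w t) =
          (f (y t + t *\<^sub>R w t) - f (y t) - t *\<^sub>R f' (y t) (w t)) /\<^sub>R t"
        using elim by (simp add: scaleR_diff_right)
      then show ?thesis
        by (simp add: divide_inverse_commute)
    qed
    ultimately have "norm ((f (y t + t *\<^sub>R w t) - f (y t)) /\<^sub>R t - f' (y t) (w t)) \<le> e / 2"
      by simp
    then show ?case
      using near[of 0] \<open>e > 0\<close> norm_triangle_ineq[of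
          "(f (y t + t *\<^sub>R w t) - f (y t)) /\<^sub>R t - f' (y t) (w t)" "f' (y t) (w t) - f' x v"]
      by (simp add: dist_norm)
  qed
qed

lemma strict_dir_deriv_fun:
  fixes f :: "(nat \<Rightarrow> 'a::real_normed_vector) \<Rightarrow> nat \<Rightarrow> 'b::real_normed_vector"
  assumes dom: "model_domain S U"
    and D: "\<And>x v. x \<in> U \<Longrightarrow> v \<in> S \<Longrightarrow> has_dir_deriv f x v (f' x v)"
    and cont: "continuous_on (U \<times> S) (\<lambda>(x, v). f' x v)"
    and lim: "(y \<longlongrightarrow> x) (at 0)" "(w \<longlongrightarrow> v) (at 0)"
    and ev: "\<forall>\<^sub>F t in at 0. y t \<in> S" "\<forall>\<^sub>F t in at 0. w t \<in> S"
    and xv: "x \<in> U" "v \<in> S"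
  shows "((\<lambda>t::real. (f (y t + t *\<^sub>R w t) - f (y t)) /\<^sub>R t) \<longlongrightarrow> f' x v) (at 0)"
proof -
  have "((\<lambda>t::real. (f (y t + t *\<^sub>R w t) i - f (y t) i) /\<^sub>R t) \<longlongrightarrow> f' x v i) (at 0)" for i
  proof (rule strict_dir_deriv[OF dom _ _ lim ev xv, where f = "\<lambda>x. f x i" and f' = "\<lambda>x v. f' x v i"])
    show "has_dir_deriv (\<lambda>x. f x i) x v (f' x v i)" if "x \<in> U" "v \<in> S" for x v
      using D[OF that] by (simp add: has_dir_deriv_fun_iff)
    show "continuous_on (U \<times> S) (\<lambda>(x, v). f' x v i)"
      using continuous_on_coord[OF cont, of i] by (simp add: case_prod_beta)
  qed
  then show ?thesis
    by (simp add: tendsto_fun_iff scaleR_fun_def)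
qed

lemma smooth_on_continuous_dir_deriv:
  assumes "smooth_on S U f"
  shows "continuous_on (U \<times> S) (\<lambda>(x, v). dir_deriv f x v)"
proof -
  have "continuous_on (U \<times> S) (\<lambda>p. (fst p, \<lambda>_::nat. snd p))"
    by (intro continuous_on_Pair continuous_on_coordinatewise_then_product
        continuous_on_fst continuous_on_snd continuous_on_id)
  then have "continuous_on (U \<times> S)
      (\<lambda>p. (\<lambda>(x, v). iter_deriv (Suc 0) f x v) (fst p, \<lambda>_::nat. snd p))"
    by (rule continuous_on_compose2[OF smooth_on_continuous[OF assms, of "Suc 0"]]) auto
  then show ?thesis
    by (simp add: case_prod_beta)
qed

lemma smooth_on_strict:
  fixes f :: "(nat \<Rightarrow> 'a::real_normed_vector) \<Rightarrow> nat \<Rightarrow> 'b::real_normed_vector"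
  assumes "model_domain S U" "smooth_on S U f"
    and "(y \<longlongrightarrow> x) (at 0)" "(w \<longlongrightarrow> v) (at 0)"
    and "\<forall>\<^sub>F t in at 0. y t \<in> S" "\<forall>\<^sub>F t in at 0. w t \<in> S"
    and "x \<in> U" "v \<in> S"
  shows "((\<lambda>t::real. (f (y t + t *\<^sub>R w t) - f (y t)) /\<^sub>R t) \<longlongrightarrow> dir_deriv f x v) (at 0)"
  using assms smooth_on_dir_deriv1[OF assms(2)] smooth_on_continuous_dir_deriv[OF assms(2)]
  by (intro strict_dir_deriv_fun[of S U f "dir_deriv f"])

text \<open>The increment along v + w splits into one along v from x and one along w from the moving
  point x + tv; strict differentiability gives the limit of the second.\<close>

lemma dir_deriv_add:
  fixes f :: "(nat \<Rightarrow> 'a::real_normed_vector) \<Rightarrow> nat \<Rightarrow> 'b::real_normed_vector"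
  assumes "model_domain S U" "smooth_on S U f" "x \<in> U" "v \<in> S" "w \<in> S"
  shows "dir_deriv f x (v + w) = dir_deriv f x v + dir_deriv f x w"
proof (rule has_dir_deriv_imp)
  have "((\<lambda>t. x + t *\<^sub>R v) \<longlongrightarrow> x + 0 *\<^sub>R v) (at 0)"
    by (rule tendsto_affine) (rule tendsto_const tendsto_ident_at)+
  then have "((\<lambda>t. x + t *\<^sub>R v) \<longlongrightarrow> x) (at 0)"
    by simp
  then have "((\<lambda>t. (f ((x + t *\<^sub>R v) + t *\<^sub>R w) - f (x + t *\<^sub>R v)) /\<^sub>R t) \<longlongrightarrow> dir_deriv f x w) (at 0)"
    by (rule smooth_on_strict[OF assms(1,2) _ tendsto_const])
      (use assms model_domain_affine[OF assms(1)] model_domain_subset[OF assms(1)] in auto)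
  note tendsto_add[OF smooth_on_dir_deriv1[OF assms(2-4), unfolded has_dir_deriv_def] this]
  moreover have "(f (x + t *\<^sub>R v) - f x) /\<^sub>R t + (f (x + t *\<^sub>R v + t *\<^sub>R w) - f (x + t *\<^sub>R v)) /\<^sub>R t =
      (f (x + t *\<^sub>R (v + w)) - f x) /\<^sub>R t" for t
    by (simp only: scaleR_add_right[symmetric] add.assoc) simp
  ultimately show "has_dir_deriv f x (v + w) (dir_deriv f x v + dir_deriv f x w)"
    unfolding has_dir_deriv_def by simp
qed

lemma has_dir_deriv_scale_dir:
  fixes f :: "'a::real_vector \<Rightarrow> nat \<Rightarrow> 'b::real_normed_vector"
  assumes "has_dir_deriv f x v l"
  shows "has_dir_deriv f x (c *\<^sub>R v) (c *\<^sub>R l)"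
proof (cases "c = 0")
  case False
  have "filterlim (\<lambda>t. t * c) (at 0) (at 0)"
    unfolding filterlim_at using False
    by (auto simp: eventually_at_filter intro!: tendsto_eq_intros)
  from tendsto_scaleR_fun[OF tendsto_const filterlim_compose[OF assms[unfolded has_dir_deriv_def] this], of c]
  moreover have "c * (inverse t * inverse c) = inverse t" for t
    using False by simp
  ultimately show ?thesis
    by (simp add: has_dir_deriv_def)
qed (simp add: has_dir_deriv_def)

lemma dir_deriv_scaleR:
  fixes f :: "(nat \<Rightarrow> 'a::real_normed_vector) \<Rightarrow> nat \<Rightarrow> 'b::real_normed_vector"
  assumes "smooth_on S U f" "x \<in> U" "v \<in> S"
  shows "dir_deriv f x (c *\<^sub>R v) = c *\<^sub>R dir_deriv f x v"
  by (rule has_dir_deriv_imp[OF has_dir_deriv_scale_dir[OF smooth_on_dir_deriv1[OF assms]]])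

text \<open>With w t the difference quotient of f, the point f (x + tv) is f x + t (w t). So g is
  evaluated along a moving direction that tends to l, as strict differentiability permits.
  Closedness of \<open>S\<close> puts l into \<open>S\<close>; f itself needs a derivative only at
  x.\<close>

lemma has_dir_deriv_chain:
  fixes g :: "(nat \<Rightarrow> 'a::real_normed_vector) \<Rightarrow> nat \<Rightarrow> 'b::real_normed_vector"
  assumes "model_domain S U" "smooth_on S U g"
    and "has_dir_deriv f x v l" "f x \<in> U" "\<forall>\<^sub>F t in at 0. f (x + t *\<^sub>R v) \<in> S"
  shows "l \<in> S" "has_dir_deriv (\<lambda>y. g (f y)) x v (dir_deriv g (f x) l)"
proof -
  define w where "w = (\<lambda>t. (f (x + t *\<^sub>R v) - f x) /\<^sub>R t)"
  have S: "subspace S" "closed S" and fx: "f x \<in> S"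
    using assms(1,4) model_domain_subset[OF assms(1)] by (auto simp: model_domain_def)
  have w: "(w \<longlongrightarrow> l) (at 0)"
    using assms(3) by (simp add: has_dir_deriv_def w_def)
  have wS: "\<forall>\<^sub>F t in at 0. w t \<in> S"
    using assms(5) by eventually_elim (simp add: w_def subspace_scale[OF S(1)] subspace_diff[OF S(1)] fx)
  show l: "l \<in> S"
    by (rule Lim_in_closed_set[OF S(2) wS _ w]) simp
  have "((\<lambda>t. (g (f x + t *\<^sub>R w t) - g (f x)) /\<^sub>R t) \<longlongrightarrow> dir_deriv g (f x) l) (at 0)"
    by (rule smooth_on_strict[OF assms(1,2) tendsto_const w _ wS assms(4) l]) (simp add: fx)
  moreover have "\<forall>\<^sub>F t in at 0. (g (f x + t *\<^sub>R w t) - g (f x)) /\<^sub>R t =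
      (g (f (x + t *\<^sub>R v)) - g (f x)) /\<^sub>R t"
    unfolding eventually_at_filter by (rule always_eventually) (auto simp: w_def)
  ultimately show "has_dir_deriv (\<lambda>y. g (f y)) x v (dir_deriv g (f x) l)"
    unfolding has_dir_deriv_def by (rule Lim_transform_eventually)
qed

subsection \<open>Tangent maps in coordinates\<close>

lemma vfst_vpair [simp]: "vfst (vpair x y) = x"
  by (simp add: vfst_def vpair_def)

lemma vsnd_vpair [simp]: "vsnd (vpair x y) = y"
  by (simp add: vsnd_def vpair_def)

lemma vpair_surjective [simp]: "vpair (vfst z) (vsnd z) = z"
  by (auto simp: vpair_def vfst_def vsnd_def fun_eq_iff)

lemma vpair_eq_iff [simp]: "vpair a b = vpair c d \<longleftrightarrow> a = c \<and> b = d"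
  by (metis vfst_vpair vsnd_vpair)

lemma vfst_add [simp]: "vfst (a + b) = vfst a + vfst b"
  by (simp add: vfst_def fun_eq_iff)

lemma vsnd_add [simp]: "vsnd (a + b) = vsnd a + vsnd b"
  by (simp add: vsnd_def fun_eq_iff)

lemma vfst_diff [simp]: "vfst (a - b) = vfst a - vfst b"
  by (simp add: vfst_def fun_eq_iff)

lemma vsnd_diff [simp]: "vsnd (a - b) = vsnd a - vsnd b"
  by (simp add: vsnd_def fun_eq_iff)

lemma vfst_scaleR [simp]: "vfst (c *\<^sub>R a) = c *\<^sub>R vfst a"
  by (simp add: vfst_def fun_eq_iff scaleR_fun_def)

lemma vsnd_scaleR [simp]: "vsnd (c *\<^sub>R a) = c *\<^sub>R vsnd a"
  by (simp add: vsnd_def fun_eq_iff scaleR_fun_def)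

lemma vfst_zero [simp]: "vfst 0 = 0"
  by (simp add: vfst_def fun_eq_iff)

lemma vsnd_zero [simp]: "vsnd 0 = 0"
  by (simp add: vsnd_def fun_eq_iff)

lemma vpair_add: "vpair a b + vpair c d = vpair (a + c) (b + d)"
  by (simp add: vpair_def fun_eq_iff)

lemma vpair_diff: "vpair a b - vpair c d = vpair (a - c) (b - d)"
  by (simp add: vpair_def fun_eq_iff)

lemma vpair_scaleR: "c *\<^sub>R vpair a b = vpair (c *\<^sub>R a) (c *\<^sub>R b)"
  by (simp add: vpair_def fun_eq_iff scaleR_fun_def)

lemma continuous_on_vfst: "continuous_on A f \<Longrightarrow> continuous_on A (\<lambda>x. vfst (f x))"
  unfolding vfst_def by (rule continuous_on_coordinatewise_then_product) (rule continuous_on_coord)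

lemma continuous_on_vsnd: "continuous_on A f \<Longrightarrow> continuous_on A (\<lambda>x. vsnd (f x))"
  unfolding vsnd_def by (rule continuous_on_coordinatewise_then_product) (rule continuous_on_coord)

lemma continuous_on_vpair:
  assumes "continuous_on A f" "continuous_on A g"
  shows "continuous_on A (\<lambda>x. vpair (f x) (g x))"
  unfolding vpair_def
proof (rule continuous_on_coordinatewise_then_product)
  show "continuous_on A (\<lambda>x. if even n then f x (n div 2) else g x (n div 2))" for n
    by (cases "even n") (simp_all add: continuous_on_coord[OF assms(1)] continuous_on_coord[OF assms(2)])
qed

lemma tendsto_vpair:
  assumes "(f \<longlongrightarrow> a) F" "(g \<longlongrightarrow> b) F"
  shows "((\<lambda>x. vpair (f x) (g x)) \<longlongrightarrow> vpair a b) F"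
proof -
  have "((\<lambda>x. vpair (f x) (g x) n) \<longlongrightarrow> vpair a b n) F" for n
    by (cases "even n") (simp_all add: vpair_def tendsto_coord[OF assms(1)] tendsto_coord[OF assms(2)])
  then show ?thesis
    by (simp only: tendsto_fun_iff) blast
qed

lemma tendsto_vsnd:
  assumes "(f \<longlongrightarrow> a) F"
  shows "((\<lambda>x. vsnd (f x)) \<longlongrightarrow> vsnd a) F"
proof -
  have "((\<lambda>x. vsnd (f x) n) \<longlongrightarrow> vsnd a n) F" for n
    unfolding vsnd_def by (rule tendsto_coord[OF assms])
  then show ?thesis
    by (simp only: tendsto_fun_iff) blast
qed

lemma has_dir_deriv_vpair:
  fixes f g :: "'a::real_vector \<Rightarrow> nat \<Rightarrow> 'b::real_normed_vector"
  assumes "has_dir_deriv f x v l" "has_dir_deriv g x v m"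
  shows "has_dir_deriv (\<lambda>y. vpair (f y) (g y)) x v (vpair l m)"
  using tendsto_vpair[OF assms[unfolded has_dir_deriv_def]]
  by (simp add: has_dir_deriv_def vpair_diff vpair_scaleR)

lemma has_dir_deriv_vsnd:
  fixes f :: "'a::real_vector \<Rightarrow> nat \<Rightarrow> 'b::real_normed_vector"
  assumes "has_dir_deriv f x v l"
  shows "has_dir_deriv (\<lambda>y. vsnd (f y)) x v (vsnd l)"
  using tendsto_vsnd[OF assms[unfolded has_dir_deriv_def]]
  by (simp add: has_dir_deriv_def)

definition tdom :: "(nat \<Rightarrow> 'a) set \<Rightarrow> (nat \<Rightarrow> 'a) set \<Rightarrow> (nat \<Rightarrow> 'a) set" where
  "tdom U S = {z. vfst z \<in> U \<and> vsnd z \<in> S}"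

lemma mem_tdom [simp]: "z \<in> tdom U S \<longleftrightarrow> vfst z \<in> U \<and> vsnd z \<in> S"
  by (simp add: tdom_def)

lemma model_domain_self: "model_domain S U \<Longrightarrow> model_domain S S"
  by (simp add: model_domain_def)

lemma model_domain_tdom:
  assumes "model_domain S U"
  shows "model_domain (tdom S S) (tdom U S)"
proof -
  have S: "subspace S" "closed S"
    using assms by (auto simp: model_domain_def)
  obtain A where A: "open A" "U = A \<inter> S"
    using assms by (rule model_domain_open)
  have tS: "tdom S S = vfst -` S \<inter> vsnd -` S"
    by auto
  have c: "continuous_on UNIV vfst" "continuous_on UNIV vsnd"
    using continuous_on_vfst[OF continuous_on_id] continuous_on_vsnd[OF continuous_on_id] by auto
  have "closed (vfst -` S)" "closed (vsnd -` S)"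
    using S(2) c by (auto intro: closed_vimage)
  then have "closed (tdom S S)"
    unfolding tS by (rule closed_Int)
  moreover have "subspace (tdom S S)"
    using S(1) by (auto simp: subspace_def)
  moreover have "tdom U S = tdom S S \<inter> vfst -` A"
    using A(2) by auto
  then have "openin (top_of_set (tdom S S)) (tdom U S)"
    using open_vimage[OF A(1) c(1)] by (simp add: openin_open_Int)
  ultimately show ?thesis
    by (simp add: model_domain_def)
qed

section \<open>Iterated derivatives of tangent maps\<close>

lemma range_case_nat: "u \<in> S \<Longrightarrow> range h \<subseteq> S \<Longrightarrow> range (case_nat u h) \<subseteq> S"
  by (force split: nat.splits)

text \<open>By \<open>iter_deriv_Suc_left\<close> the derivatives of \<open>df(-; v)\<close> are
  those of f of one order more, with v inserted as slot 0; \<open>case_nat v\<close> performs this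
  insertion.\<close>

lemma smooth_on_dir:
  assumes "smooth_on S U f" "v \<in> S"
  shows "smooth_on S U (\<lambda>y. dir_deriv f y v)"
proof -
  have eq: "iter_deriv k (\<lambda>y. dir_deriv f y v) x w = iter_deriv (Suc k) f x (case_nat v w)" for k x w
    unfolding iter_deriv_Suc_left by simp
  have rg: "range (case_nat v w) \<subseteq> S" if "range w \<subseteq> S" for w
    using assms(2) that by (rule range_case_nat)
  show ?thesis
    unfolding smooth_on_def
  proof (intro allI conjI ballI impI)
    fix k x and w :: "nat \<Rightarrow> 'a"
    assume "x \<in> U" "range w \<subseteq> S"
    then show "\<exists>l. has_dir_deriv (\<lambda>y. iter_deriv k (\<lambda>y. dir_deriv f y v) y w) x (w k) l"
      unfolding eq using smooth_on_has_dir_deriv[OF assms(1) _ rg, of x w "Suc k"] by auto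
  next
    fix k
    let ?D = "U \<times> {w :: nat \<Rightarrow> 'a. range w \<subseteq> S}"
    have "continuous_on ?D (\<lambda>p. (fst p, case_nat v (snd p)))"
    proof (intro continuous_on_Pair continuous_on_coordinatewise_then_product)
      fix i show "continuous_on ?D (\<lambda>p. case_nat v (snd p) i)"
        by (cases i) (auto intro: continuous_on_coord[OF continuous_on_snd[OF continuous_on_id]])
    qed (rule continuous_on_fst[OF continuous_on_id])
    then have "continuous_on ?D (\<lambda>p. (\<lambda>(x, v). iter_deriv (Suc k) f x v) (fst p, case_nat v (snd p)))"
    proof (rule continuous_on_compose2[OF smooth_on_continuous[OF assms(1)]])
      show "(\<lambda>p. (fst p, case_nat v (snd p))) ` ?D \<subseteq> U \<times> {w. range w \<subseteq> S}"
      proof (rule image_subsetI)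
        fix p assume "p \<in> ?D"
        then have "fst p \<in> U" "range (snd p) \<subseteq> S"
          by auto
        then show "(fst p, case_nat v (snd p)) \<in> U \<times> {w. range w \<subseteq> S}"
          using rg[of "snd p"] by blast
      qed
    qed
    then show "continuous_on ?D (\<lambda>(x, w). iter_deriv k (\<lambda>y. dir_deriv f y v) x w)"
      unfolding eq by (simp add: case_prod_beta)
  qed
qed

lemma iter_deriv_plus:
  fixes f g :: "(nat \<Rightarrow> 'a::real_normed_vector) \<Rightarrow> nat \<Rightarrow> 'b::real_normed_vector"
  assumes "radially_open S U" "smooth_on S U f" "smooth_on S U g" "x \<in> U" "range v \<subseteq> S"
  shows "iter_deriv k (\<lambda>y. f y + g y) x v = iter_deriv k f x v + iter_deriv k g x v"
proof (rule smooth_onI(2)[where e = "\<lambda>k x v. iter_deriv k f x v + iter_deriv k g x v",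
      OF assms(1) _ _ _ assms(4,5)])
  show "continuous_on (U \<times> {v. range v \<subseteq> S}) (\<lambda>(x, v). iter_deriv k f x v + iter_deriv k g x v)" for k
    using continuous_on_add[OF smooth_on_continuous[OF assms(2)] smooth_on_continuous[OF assms(3)]]
    by (simp add: case_prod_beta)
  fix k x and v :: "nat \<Rightarrow> nat \<Rightarrow> 'a"
  assume "x \<in> U" "range v \<subseteq> S"
  then show "has_dir_deriv (\<lambda>y. iter_deriv k f y v + iter_deriv k g y v) x (v k)
      (iter_deriv (Suc k) f x v + iter_deriv (Suc k) g x v)"
    by (intro has_dir_deriv_add smooth_on_has_dir_deriv[OF assms(2)] smooth_on_has_dir_deriv[OF assms(3)])
qed auto

lemma iter_deriv_scale:
  fixes f :: "(nat \<Rightarrow> 'a::real_normed_vector) \<Rightarrow> nat \<Rightarrow> 'b::real_normed_vector"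
  assumes "radially_open S U" "smooth_on S U f" "x \<in> U" "range v \<subseteq> S"
  shows "iter_deriv k (\<lambda>y. c *\<^sub>R f y) x v = c *\<^sub>R iter_deriv k f x v"
proof (rule smooth_onI(2)[where e = "\<lambda>k x v. c *\<^sub>R iter_deriv k f x v", OF assms(1) _ _ _ assms(3,4)])
  show "continuous_on (U \<times> {v. range v \<subseteq> S}) (\<lambda>(x, v). c *\<^sub>R iter_deriv k f x v)" for k
    using continuous_on_scaleR_fun[OF continuous_on_const smooth_on_continuous[OF assms(2)]]
    by (simp add: case_prod_beta)
  fix k x and v :: "nat \<Rightarrow> nat \<Rightarrow> 'a"
  assume "x \<in> U" "range v \<subseteq> S"
  then show "has_dir_deriv (\<lambda>y. c *\<^sub>R iter_deriv k f y v) x (v k) (c *\<^sub>R iter_deriv (Suc k) f x v)"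
    by (intro has_dir_deriv_scaleR smooth_on_has_dir_deriv[OF assms(2)])
qed auto

text \<open>Slot 0 is the innermost direction. There \<open>df\<close> is additive and homogeneous
  at every point of \<open>U\<close>, and the k outer derivatives respect sums and multiples of
  functions.\<close>

lemma iter_deriv_slot:
  fixes f :: "(nat \<Rightarrow> 'a::real_normed_vector) \<Rightarrow> nat \<Rightarrow> 'b::real_normed_vector"
  assumes "model_domain S U" "smooth_on S U f" "x \<in> U" "u \<in> S" "v \<in> S" "range h \<subseteq> S"
  shows "iter_deriv (Suc k) f x (case_nat (u + c *\<^sub>R v) h) =
      iter_deriv (Suc k) f x (case_nat u h) + c *\<^sub>R iter_deriv (Suc k) f x (case_nat v h)"
proof -
  have S: "c *\<^sub>R v \<in> S"
    using assms(1,5) by (simp add: model_domain_def subspace_scale)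
  note ro = model_domain_radially_open[OF assms(1)]
  have "dir_deriv f y (u + c *\<^sub>R v) = dir_deriv f y u + c *\<^sub>R dir_deriv f y v" if "y \<in> U" for y
    using that by (simp add: dir_deriv_add[OF assms(1,2) _ assms(4) S] dir_deriv_scaleR[OF assms(2) _ assms(5)])
  then have "iter_deriv k (\<lambda>y. dir_deriv f y (u + c *\<^sub>R v)) x h =
      iter_deriv k (\<lambda>y. dir_deriv f y u + c *\<^sub>R dir_deriv f y v) x h"
    by (intro iter_deriv_cong[OF ro assms(3,6)])
  also have "smooth_on S U (\<lambda>y. c *\<^sub>R dir_deriv f y v)"
    by (rule smooth_on_postcompose_linear[OF smooth_on_dir[OF assms(2,5)] _ _ ro])
      (auto intro!: continuous_on_scaleR_fun continuous_on_const continuous_on_id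
        simp: linear_iff scaleR_add_right)
  then have "iter_deriv k (\<lambda>y. dir_deriv f y u + c *\<^sub>R dir_deriv f y v) x h =
      iter_deriv k (\<lambda>y. dir_deriv f y u) x h + iter_deriv k (\<lambda>y. c *\<^sub>R dir_deriv f y v) x h"
    by (rule iter_deriv_plus[OF ro smooth_on_dir[OF assms(2,4)] _ assms(3,6)])
  also have "iter_deriv k (\<lambda>y. c *\<^sub>R dir_deriv f y v) x h = c *\<^sub>R iter_deriv k (\<lambda>y. dir_deriv f y v) x h"
    by (rule iter_deriv_scale[OF ro smooth_on_dir[OF assms(2,5)] assms(3,6)])
  finally show ?thesis
    by (simp only: iter_deriv_Suc_left nat.case)
qed

lemma has_dir_deriv_iter_base:
  fixes f :: "(nat \<Rightarrow> 'a::real_normed_vector) \<Rightarrow> nat \<Rightarrow> 'b::real_normed_vector"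
  assumes "smooth_on S U f" "vfst z \<in> U" "range h \<subseteq> S" "h k = vfst w"
  shows "has_dir_deriv (\<lambda>z. iter_deriv k f (vfst z) h) z w (iter_deriv (Suc k) f (vfst z) h)"
  using smooth_on_has_dir_deriv[OF assms(1-3), of k] assms(4) by (simp add: has_dir_deriv_def)

text \<open>A product rule: base point and slot 0 move together. Exact linearity in the slot splits
  the quotient into one with fixed slot plus the value at slot \<open>vsnd w\<close> and moving base
  point, and the latter converges by continuity. The premise \<open>h k = vfst w\<close> stores the
  direction of the base point as the next entry of the list.\<close>

lemma has_dir_deriv_iter_slot:
  fixes f :: "(nat \<Rightarrow> 'a::real_normed_vector) \<Rightarrow> nat \<Rightarrow> 'b::real_normed_vector"
  assumes dom: "model_domain S U" and sm: "smooth_on S U f"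
    and z: "z \<in> tdom U S" and w: "w \<in> tdom S S" and h: "range h \<subseteq> S" "h k = vfst w"
  shows "has_dir_deriv (\<lambda>z. iter_deriv (Suc k) f (vfst z) (case_nat (vsnd z) h)) z w
    (iter_deriv (Suc (Suc k)) f (vfst z) (case_nat (vsnd z) h) +
     iter_deriv (Suc k) f (vfst z) (case_nat (vsnd w) h))"
proof -
  let ?F = "\<lambda>y u. iter_deriv (Suc k) f y (case_nat u h)"
  let ?x = "\<lambda>t. vfst z + t *\<^sub>R vfst w"
  have rg: "range (case_nat u h) \<subseteq> S" if "u \<in> S" for u
    using that h(1) by (rule range_case_nat)
  have "((\<lambda>t. (?F (?x t) (vsnd z) - ?F (vfst z) (vsnd z)) /\<^sub>R t) \<longlongrightarrow>
      iter_deriv (Suc (Suc k)) f (vfst z) (case_nat (vsnd z) h)) (at 0)"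
    using smooth_on_has_dir_deriv[OF sm _ rg, of "vfst z" "vsnd z" "Suc k"] z h(2)
    by (simp add: has_dir_deriv_def)
  moreover have ev: "\<forall>\<^sub>F t in at 0. ?x t \<in> U"
    using model_domain_radially_open[OF dom] z w by (auto simp: radially_open_def)
  moreover have "((\<lambda>t. ?F (?x t) (vsnd w)) \<longlongrightarrow> ?F (vfst z) (vsnd w)) (at 0)"
  proof (rule continuous_on_tendsto_compose[OF _ _ _ ev])
    have "continuous_on U (\<lambda>y. (y, case_nat (vsnd w) h))"
      by (intro continuous_on_Pair continuous_on_id continuous_on_const)
    then have "continuous_on U (\<lambda>y. (\<lambda>(x, v). iter_deriv (Suc k) f x v) (y, case_nat (vsnd w) h))"
      by (rule continuous_on_compose2[OF smooth_on_continuous[OF sm]]) (use rg[of "vsnd w"] w in auto)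
    then show "continuous_on U (\<lambda>y. ?F y (vsnd w))"
      by simp
    have "(?x \<longlongrightarrow> vfst z + 0 *\<^sub>R vfst w) (at 0)"
      by (rule tendsto_affine) (rule tendsto_const tendsto_ident_at)+
    then show "(?x \<longlongrightarrow> vfst z) (at 0)"
      by simp
  qed (use z in simp)
  ultimately have "((\<lambda>t. (?F (?x t) (vsnd z) - ?F (vfst z) (vsnd z)) /\<^sub>R t + ?F (?x t) (vsnd w)) \<longlongrightarrow>
      iter_deriv (Suc (Suc k)) f (vfst z) (case_nat (vsnd z) h) + ?F (vfst z) (vsnd w)) (at 0)"
    by (intro tendsto_add)
  moreover have "\<forall>\<^sub>F t in at 0. (?F (?x t) (vsnd z) - ?F (vfst z) (vsnd z)) /\<^sub>R t + ?F (?x t) (vsnd w) =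
      (?F (vfst (z + t *\<^sub>R w)) (vsnd (z + t *\<^sub>R w)) - ?F (vfst z) (vsnd z)) /\<^sub>R t"
  proof -
    have "\<forall>\<^sub>F t::real in at 0. t \<noteq> 0"
      by (simp add: eventually_at_filter)
    then show ?thesis
      using ev
    proof eventually_elim
      case (elim t)
      have "?F (?x t) (vsnd z + t *\<^sub>R vsnd w) = ?F (?x t) (vsnd z) + t *\<^sub>R ?F (?x t) (vsnd w)"
        by (rule iter_deriv_slot[OF dom sm elim(2) _ _ h(1)]) (use z w in auto)
      then have "(?F (?x t) (vsnd z + t *\<^sub>R vsnd w) - ?F (vfst z) (vsnd z)) /\<^sub>R t =
          (?F (?x t) (vsnd z) - ?F (vfst z) (vsnd z)) /\<^sub>R t + (t *\<^sub>R ?F (?x t) (vsnd w)) /\<^sub>R t"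
        by (simp only: scaleR_add_right[symmetric]) (simp add: algebra_simps)
      then show ?case
        using elim(1) by (simp del: iter_deriv.simps)
    qed
  qed
  ultimately show ?thesis
    unfolding has_dir_deriv_def by (rule Lim_transform_eventually)
qed

text \<open>The formula of \<open>vec_tangent\<close> for arbitrary normed coordinate spaces,
  possibly different for source and target, so that the chain rule can be stated for three
  spaces.\<close>

definition tfun ::
    "((nat \<Rightarrow> 'a::real_normed_vector) \<Rightarrow> nat \<Rightarrow> 'b::real_normed_vector) \<Rightarrow> (nat \<Rightarrow> 'a) \<Rightarrow> nat \<Rightarrow> 'b" where
  "tfun f z = vpair (f (vfst z)) (dir_deriv f (vfst z) (vsnd z))"

lemma vec_tangent_eq_tfun: "vec_tangent f = tfun f"
  by (simp add: fun_eq_iff vec_tangent_def tfun_def)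

text \<open>
  With \<open>h j\<close> and \<open>w j\<close> the two components of the \<open>j\<close>-th direction, the derivatives of \<open>df\<close> are
  \<open>d\<^sup>k(df)(x, v) = d\<^sup>k\<^sup>+\<^sup>1f(x; v, h 0, \<dots>, h (k - 1)) + (\<Sum>i<k. d\<^sup>kf(x; w i, skip i h))\<close>.
\<close>

definition skip :: "nat \<Rightarrow> (nat \<Rightarrow> 'a) \<Rightarrow> nat \<Rightarrow> 'a" where
  "skip i h j = (if j < i then h j else h (Suc j))"

lemma smooth_on_tfun:
  fixes f :: "(nat \<Rightarrow> 'a::real_normed_vector) \<Rightarrow> nat \<Rightarrow> 'b::real_normed_vector"
  assumes dom: "model_domain S U" and sm: "smooth_on S U f"
  shows "smooth_on (tdom S S) (tdom U S) (tfun f)"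
proof -
  let ?D = "tdom U S \<times> {ws :: nat \<Rightarrow> nat \<Rightarrow> 'a. range ws \<subseteq> tdom S S}"
  let ?h = "\<lambda>ws i. vfst (ws i :: nat \<Rightarrow> 'a)"
  let ?a = "\<lambda>k z ws. iter_deriv k f (vfst z) (?h ws)"
  let ?b = "\<lambda>k z ws. iter_deriv (Suc k) f (vfst z) (case_nat (vsnd z) (?h ws))"
  let ?c = "\<lambda>k i z ws. iter_deriv k f (vfst z) (case_nat (vsnd (ws i)) (skip i (?h ws)))"
  let ?e = "\<lambda>k z ws. vpair (?a k z ws) (?b k z ws + (\<Sum>i<k. ?c k i z ws))"
  have cont: "continuous_on ?D (\<lambda>p. iter_deriv k f (vfst (fst p)) (g p))"
    if "continuous_on ?D g" "\<And>p. p \<in> ?D \<Longrightarrow> range (g p) \<subseteq> S" for k and g :: "_ \<Rightarrow> nat \<Rightarrow> nat \<Rightarrow> 'a"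
  proof -
    have "continuous_on ?D (\<lambda>p. (vfst (fst p), g p))"
      by (intro continuous_on_Pair that(1) continuous_on_vfst continuous_on_fst continuous_on_id)
    then have "continuous_on ?D (\<lambda>p. (\<lambda>(x, v). iter_deriv k f x v) (vfst (fst p), g p))"
      by (rule continuous_on_compose2[OF smooth_on_continuous[OF sm]]) (use that(2) in auto)
    then show ?thesis
      by simp
  qed
  have c1: "continuous_on ?D (\<lambda>p. vsnd (snd p i))" "continuous_on ?D (\<lambda>p. vfst (snd p i))" for i
    by (rule continuous_on_vsnd continuous_on_vfst,
        rule continuous_on_coord[OF continuous_on_snd[OF continuous_on_id]])+
  have c2: "continuous_on ?D (\<lambda>p. vsnd (fst p))"
    by (rule continuous_on_vsnd[OF continuous_on_fst[OF continuous_on_id]])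
  have cnat: "continuous_on ?D (\<lambda>p. case_nat (u p) (g p))"
    if "continuous_on ?D u" "\<And>i. continuous_on ?D (\<lambda>p. g p i)"
    for u :: "_ \<Rightarrow> nat \<Rightarrow> 'a" and g :: "_ \<Rightarrow> nat \<Rightarrow> nat \<Rightarrow> 'a"
  proof (rule continuous_on_coordinatewise_then_product)
    fix i show "continuous_on ?D (\<lambda>p. case_nat (u p) (g p) i)"
      by (cases i) (simp_all add: that)
  qed
  have rg: "range (case_nat u g) \<subseteq> S" if "u \<in> S" "range g \<subseteq> S" for u g
    using that by (rule range_case_nat)
  have wsD: "vfst (ws i) \<in> S" "vsnd (ws i) \<in> S"
    if "range ws \<subseteq> tdom S S" for ws :: "nat \<Rightarrow> nat \<Rightarrow> 'a" and i
    using subsetD[OF that rangeI, of i] by simp_all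
  show ?thesis
  proof (rule smooth_onI(1)[where e = ?e, OF model_domain_radially_open[OF model_domain_tdom[OF dom]]])
    show "continuous_on ?D (\<lambda>(z, ws). ?e k z ws)" for k
      unfolding case_prod_beta
    proof (intro continuous_on_vpair continuous_on_add continuous_on_sum cont cnat c1 c2
        continuous_on_coordinatewise_then_product[where f = "\<lambda>p. ?h (snd p)"] rg)
      show "continuous_on ?D (\<lambda>p. skip i (?h (snd p)) j)" for i j
        unfolding skip_def using c1(2) by (cases "j < i") simp_all
    qed (auto simp: skip_def wsD)
    fix k z and ws :: "nat \<Rightarrow> nat \<Rightarrow> 'a"
    assume z: "z \<in> tdom U S" and ws: "range ws \<subseteq> tdom S S"
    show "tfun f z = ?e 0 z ws"
      by (simp add: tfun_def)
    have wsk: "vfst (ws i) \<in> S" "vsnd (ws i) \<in> S" "ws i \<in> tdom S S" for i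
      using wsD[OF ws] by simp_all
    have h: "range (?h ws) \<subseteq> S"
      using wsk by auto
    have "has_dir_deriv (\<lambda>z. ?a k z ws) z (ws k) (?a (Suc k) z ws)"
      by (rule has_dir_deriv_iter_base[OF sm]) (use z h in auto)
    moreover have "has_dir_deriv (\<lambda>z. ?b k z ws) z (ws k)
        (?b (Suc k) z ws + iter_deriv (Suc k) f (vfst z) (case_nat (vsnd (ws k)) (?h ws)))"
      by (rule has_dir_deriv_iter_slot[OF dom sm z wsk(3) h]) simp
    \<comment> \<open>The slot derivative produces the new summand i = k. A derivative of order k +
      1 reads only \<open>h 0\<close>, ..., \<open>h (k - 1)\<close> after slot 0, and there
      \<open>skip k\<close> changes nothing.\<close>
    moreover have "iter_deriv (Suc k) f (vfst z) (case_nat (vsnd (ws k)) (?h ws)) = ?c (Suc k) k z ws"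
      by (rule iter_deriv_dep) (auto simp: skip_def split: nat.splits)
    \<comment> \<open>For i < k the entry at position k of the direction list is
      \<open>skip i h (k - 1)\<close>, which is \<open>h k\<close>: after the omission the next
      direction is already in place.\<close>
    moreover have "has_dir_deriv (\<lambda>z. \<Sum>i<k. ?c k i z ws) z (ws k) (\<Sum>i<k. ?c (Suc k) i z ws)"
    proof (rule has_dir_deriv_sum)
      fix i assume "i \<in> {..<k}"
      then show "has_dir_deriv (\<lambda>z. ?c k i z ws) z (ws k) (?c (Suc k) i z ws)"
        by (intro has_dir_deriv_iter_base[OF sm] rg)
          (use z wsk in \<open>auto simp: skip_def split: nat.splits\<close>)
    qed
    ultimately have "has_dir_deriv (\<lambda>z. ?e k z ws) z (ws k)
        (vpair (?a (Suc k) z ws) ((?b (Suc k) z ws + ?c (Suc k) k z ws) + (\<Sum>i<k. ?c (Suc k) i z ws)))"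
      by (intro has_dir_deriv_vpair has_dir_deriv_add) (simp_all del: iter_deriv.simps)
    then show "has_dir_deriv (\<lambda>z. ?e k z ws) z (ws k) (?e (Suc k) z ws)"
      by (simp add: add_ac del: iter_deriv.simps)
  qed
qed

subsection \<open>The chain rule\<close>

text \<open>Defining \<open>C\<^sup>k\<close> through iterated tangent maps reduces the smoothness of a composite to the first
  order chain rule \<open>T(g \<circ> f) = Tg \<circ> Tf\<close>.\<close>

primrec Ck ::
    "nat \<Rightarrow> (nat \<Rightarrow> 'a) set \<Rightarrow> (nat \<Rightarrow> 'a) set \<Rightarrow> ((nat \<Rightarrow> 'a::real_normed_vector) \<Rightarrow> nat \<Rightarrow> 'b::real_normed_vector) \<Rightarrow> bool" where
  "Ck 0 S U f \<longleftrightarrow> continuous_on U f"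
| "Ck (Suc k) S U f \<longleftrightarrow> continuous_on U f \<and> (\<forall>x\<in>U. \<forall>v\<in>S. \<exists>l. has_dir_deriv f x v l) \<and>
     Ck k (tdom S S) (tdom U S) (tfun f)"

lemma Ck_Suc: "Ck (Suc k) S U f \<Longrightarrow> Ck k S U f"
proof (induction k arbitrary: S U f)
  case (Suc k)
  then have "Ck k (tdom S S) (tdom U S) (tfun f)"
    using Ck.simps(2)[of "Suc k" S U f] by blast
  then show ?case
    using Suc.prems Ck.simps(2)[of "Suc k" S U f] Ck.simps(2)[of k S U f] by blast
qed simp

lemma Ck_le: "j \<le> k \<Longrightarrow> Ck k S U f \<Longrightarrow> Ck j S U f"
  by (induction rule: dec_induct) (use Ck_Suc in blast)+

lemma tfun_cong:
  assumes "model_domain S U" "\<And>x. x \<in> U \<Longrightarrow> f x = g x" "z \<in> tdom U S"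
  shows "tfun f z = tfun g z"
  using assms(2,3) dir_deriv_cong[OF model_domain_radially_open[OF assms(1)], of "vfst z" "vsnd z" f g]
  by (simp add: tfun_def)

lemma Ck_cong:
  assumes "model_domain S U" "\<And>x. x \<in> U \<Longrightarrow> f x = g x" "Ck k S U f"
  shows "Ck k S U g"
  using assms
proof (induction k arbitrary: S U f g)
  case 0
  then show ?case
    using continuous_on_cong[of U U f g] by simp
next
  case (Suc k)
  have "continuous_on U g"
    using Suc.prems continuous_on_cong[of U U f g] by simp
  moreover have "\<forall>x\<in>U. \<forall>v\<in>S. \<exists>l. has_dir_deriv g x v l"
    using Suc.prems has_dir_deriv_cong[OF model_domain_radially_open[OF Suc.prems(1)], of _ _ f g] by simp
  moreover have "Ck k (tdom S S) (tdom U S) (tfun g)"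
  proof (rule Suc.IH[OF model_domain_tdom[OF Suc.prems(1)]])
    show "tfun f z = tfun g z" if "z \<in> tdom U S" for z
      using tfun_cong[OF Suc.prems(1,2) that] .
  qed (use Suc.prems in simp)
  ultimately show ?case
    by simp
qed

lemma has_dir_deriv_slice:
  fixes G :: "(nat \<Rightarrow> 'a::real_normed_vector) \<Rightarrow> nat \<Rightarrow> 'b::real_normed_vector"
  assumes "has_dir_deriv G (vpair x u) (vpair w 0) l"
  shows "has_dir_deriv (\<lambda>y. vsnd (G (vpair y u))) x w (vsnd l)"
  using has_dir_deriv_vsnd[OF assms] by (simp add: has_dir_deriv_def vpair_add vpair_scaleR)

text \<open>Directions (w, 0) move the base point and keep the vector u fixed, so derivatives of
  \<open>df(-; u)\<close> can be read off those of \<open>tfun f\<close>. Existence is assumed at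
  each lower order because \<open>vsnd\<close> is pulled out of a derivative only through an actual
  limit.\<close>

lemma iter_deriv_slice:
  fixes f :: "(nat \<Rightarrow> 'a::real_normed_vector) \<Rightarrow> nat \<Rightarrow> 'b::real_normed_vector"
  assumes dom: "model_domain S U"
    and ex: "\<And>j z ws. j < k \<Longrightarrow> z \<in> tdom U S \<Longrightarrow> range ws \<subseteq> tdom S S \<Longrightarrow>
      \<exists>l. has_dir_deriv (\<lambda>z. iter_deriv j (tfun f) z ws) z (ws j) l"
    and u: "u \<in> S" and w: "range w \<subseteq> S" and x: "x \<in> U"
  shows "iter_deriv k (\<lambda>y. dir_deriv f y u) x w =
    vsnd (iter_deriv k (tfun f) (vpair x u) (\<lambda>i. vpair (w i) 0))"
  using ex x
proof (induction k arbitrary: x)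
  case 0
  then show ?case
    by (simp add: tfun_def)
next
  case (Suc k)
  let ?G = "\<lambda>z. iter_deriv k (tfun f) z (\<lambda>i. vpair (w i) 0)"
  have S: "0 \<in> S" "w i \<in> S" for i
    using dom w by (auto simp: model_domain_def subspace_0)
  have "\<exists>l. has_dir_deriv ?G (vpair x u) (vpair (w k) 0) l"
    by (rule Suc.prems(1)) (use S u Suc.prems(2) in auto)
  then obtain l where l: "has_dir_deriv ?G (vpair x u) (vpair (w k) 0) l"
    by blast
  have "dir_deriv (\<lambda>y. iter_deriv k (\<lambda>y. dir_deriv f y u) y w) x (w k) =
      dir_deriv (\<lambda>y. vsnd (?G (vpair y u))) x (w k)"
  proof (rule dir_deriv_cong[OF model_domain_radially_open[OF dom] Suc.prems(2) S(2)])
    show "iter_deriv k (\<lambda>y. dir_deriv f y u) y w = vsnd (?G (vpair y u))" if "y \<in> U" for y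
      by (rule Suc.IH[OF Suc.prems(1) that]) simp_all
  qed
  also have "\<dots> = vsnd l"
    by (rule has_dir_deriv_imp[OF has_dir_deriv_slice[OF l]])
  finally show ?case
    using has_dir_deriv_imp[OF l] by (simp only: iter_deriv.simps)
qed

text \<open>One order more than k is assumed because the derivative of order k must again be
  differentiable. For k = m + 1 it is a slice of the derivative of order m of \<open>tfun f\<close>;
  the slicing lemma asks for all orders below m, hence the strong induction.\<close>

lemma Ck_imp_iter_deriv:
  fixes f :: "(nat \<Rightarrow> 'a::real_normed_vector) \<Rightarrow> nat \<Rightarrow> 'b::real_normed_vector"
  assumes "model_domain S U" "Ck (Suc k) S U f"
  shows "(\<forall>x\<in>U. \<forall>v. range v \<subseteq> S \<longrightarrow> (\<exists>l. has_dir_deriv (\<lambda>y. iter_deriv k f y v) x (v k) l)) \<and>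
    continuous_on (U \<times> {v. range v \<subseteq> S}) (\<lambda>(x, v). iter_deriv k f x v)"
  using assms
proof (induction k arbitrary: S U f rule: less_induct)
  case (less k)
  let ?D = "U \<times> {v :: nat \<Rightarrow> nat \<Rightarrow> 'a. range v \<subseteq> S}"
  show ?case
  proof (cases k)
    case 0
    have "continuous_on ?D (\<lambda>p. f (fst p))"
      by (rule continuous_on_compose2[of U f]) (use less.prems in \<open>auto intro: continuous_on_fst continuous_on_id\<close>)
    then show ?thesis
      using less.prems 0 by (simp add: case_prod_beta image_subset_iff)
  next
    case (Suc m)
    let ?f = "tfun f"
    have T: "model_domain (tdom S S) (tdom U S)" "Ck (Suc m) (tdom S S) (tdom U S) ?f"
      using less.prems model_domain_tdom Suc by auto
    have IH: "(\<forall>z\<in>tdom U S. \<forall>ws. range ws \<subseteq> tdom S S \<longrightarrow>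
        (\<exists>l. has_dir_deriv (\<lambda>y. iter_deriv j ?f y ws) z (ws j) l)) \<and>
        continuous_on (tdom U S \<times> {ws. range ws \<subseteq> tdom S S}) (\<lambda>(z, ws). iter_deriv j ?f z ws)"
      if "j \<le> m" for j
      by (rule less.IH[OF _ T(1) Ck_le[OF _ T(2)]]) (use that Suc in auto)
    let ?W = "\<lambda>v i. vpair (v (Suc i)) 0 :: nat \<Rightarrow> 'a"
    have slice: "iter_deriv k f y v = vsnd (iter_deriv m ?f (vpair y (v 0)) (?W v))"
      if "y \<in> U" "range v \<subseteq> S" for y v
    proof -
      have "iter_deriv k f y v = iter_deriv m (\<lambda>y. dir_deriv f y (v 0)) y (\<lambda>i. v (Suc i))"
        unfolding Suc by (rule iter_deriv_Suc_left)
      also have "\<dots> = vsnd (iter_deriv m ?f (vpair y (v 0)) (?W v))"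
      proof (rule iter_deriv_slice[OF less.prems(1)])
        show "\<exists>l. has_dir_deriv (\<lambda>z. iter_deriv j ?f z ws) z (ws j) l"
          if "j < m" "z \<in> tdom U S" "range ws \<subseteq> tdom S S" for j z ws
          using conjunct1[OF IH[of j]] that by simp
      qed (use that in auto)
      finally show ?thesis .
    qed
    have S0: "0 \<in> S"
      using less.prems(1) by (simp add: model_domain_def subspace_0)
    have W: "range (?W v) \<subseteq> tdom S S" "v i \<in> S" if "range v \<subseteq> S" for v i
      using that S0 by (simp_all add: image_subset_iff)
    show ?thesis
    proof (intro conjI ballI allI impI)
      fix x and v :: "nat \<Rightarrow> nat \<Rightarrow> 'a"
      assume xv: "x \<in> U" "range v \<subseteq> S"
      have "vpair x (v 0) \<in> tdom U S"
        using xv(1) W(2)[OF xv(2)] by simp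
      then obtain l where l: "has_dir_deriv (\<lambda>z. iter_deriv m ?f z (?W v)) (vpair x (v 0)) (?W v m) l"
        using conjunct1[OF IH[OF order_refl], rule_format, OF _ W(1)[OF xv(2)]] by blast
      have "has_dir_deriv (\<lambda>y. iter_deriv k f y v) x (v k) =
          has_dir_deriv (\<lambda>y. vsnd (iter_deriv m ?f (vpair y (v 0)) (?W v))) x (v k)"
        by (rule has_dir_deriv_cong[OF model_domain_radially_open[OF less.prems(1)] xv(1) W(2)[OF xv(2)]])
          (rule slice[OF _ xv(2)])
      then have "has_dir_deriv (\<lambda>y. iter_deriv k f y v) x (v k) (vsnd l)"
        using has_dir_deriv_slice[OF l] Suc by simp
      then show "\<exists>l. has_dir_deriv (\<lambda>y. iter_deriv k f y v) x (v k) l"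
        by (rule exI[where x = "vsnd l"])
    next
      have "continuous_on ?D (\<lambda>p. (vpair (fst p) (snd p 0), ?W (snd p)))"
        by (intro continuous_on_Pair continuous_on_vpair continuous_on_fst continuous_on_id continuous_on_const
            continuous_on_coordinatewise_then_product[where f = "\<lambda>p. ?W (snd p)"]
            continuous_on_coord[OF continuous_on_snd])
      then have "continuous_on ?D
          (\<lambda>p. (\<lambda>(z, ws). iter_deriv m ?f z ws) (vpair (fst p) (snd p 0), ?W (snd p)))"
      proof (rule continuous_on_compose2[OF conjunct2[OF IH[of m]], rotated])
        show "(\<lambda>p. (vpair (fst p) (snd p 0), ?W (snd p))) ` ?D \<subseteq> tdom U S \<times> {ws. range ws \<subseteq> tdom S S}"
        proof (rule image_subsetI)
          fix p assume "p \<in> ?D"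
          then have "fst p \<in> U" "range (snd p) \<subseteq> S"
            by auto
          then show "(vpair (fst p) (snd p 0), ?W (snd p)) \<in> tdom U S \<times> {ws. range ws \<subseteq> tdom S S}"
            using W[of "snd p"] by simp
        qed
      qed simp
      then have "continuous_on ?D (\<lambda>p. vsnd (iter_deriv m ?f (vpair (fst p) (snd p 0)) (?W (snd p))))"
        by (intro continuous_on_vsnd) simp
      then show "continuous_on ?D (\<lambda>(x, v). iter_deriv k f x v)"
        by (rule continuous_on_eq) (auto simp: slice)
    qed
  qed
qed

lemma Ck_imp_smooth_on:
  assumes "model_domain S U" "\<And>k. Ck k S U f"
  shows "smooth_on S U f"
  unfolding smooth_on_def using Ck_imp_iter_deriv[OF assms(1) assms(2)] by blast

lemma smooth_on_imp_continuous_on: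
  assumes "smooth_on S U f" "0 \<in> S"
  shows "continuous_on U f"
proof -
  have "continuous_on U (\<lambda>x. (x, \<lambda>_::nat. 0))"
    by (intro continuous_on_Pair continuous_on_id continuous_on_const)
  then have "continuous_on U (\<lambda>x. (\<lambda>(x, v). iter_deriv 0 f x v) (x, \<lambda>_::nat. 0))"
    by (rule continuous_on_compose2[OF smooth_on_continuous[OF assms(1)]]) (use assms(2) in auto)
  then show ?thesis
    by simp
qed

lemma dir_deriv_chain:
  fixes f :: "(nat \<Rightarrow> 'a::real_normed_vector) \<Rightarrow> nat \<Rightarrow> 'b::real_normed_vector"
    and g :: "(nat \<Rightarrow> 'b) \<Rightarrow> nat \<Rightarrow> 'c::real_normed_vector"
  assumes "model_domain S U" "smooth_on S U f" "model_domain S' U'" "smooth_on S' U' g" "f ` U \<subseteq> U'"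
    and "x \<in> U" "v \<in> S"
  shows "dir_deriv f x v \<in> S'"
    and "has_dir_deriv (\<lambda>y. g (f y)) x v (dir_deriv g (f x) (dir_deriv f x v))"
proof -
  have "\<forall>\<^sub>F t in at 0. x + t *\<^sub>R v \<in> U"
    using model_domain_radially_open[OF assms(1)] assms(6,7) by (auto simp: radially_open_def)
  then have "\<forall>\<^sub>F t in at 0. f (x + t *\<^sub>R v) \<in> S'"
    by (rule eventually_mono) (use assms(5) model_domain_subset[OF assms(3)] in blast)
  moreover have "f x \<in> U'"
    using assms(5,6) by blast
  ultimately show "dir_deriv f x v \<in> S'"
      "has_dir_deriv (\<lambda>y. g (f y)) x v (dir_deriv g (f x) (dir_deriv f x v))"
    using has_dir_deriv_chain[OF assms(3,4) smooth_on_dir_deriv1[OF assms(2,6,7)]] by blast+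
qed

lemma tfun_comp:
  fixes f :: "(nat \<Rightarrow> 'a::real_normed_vector) \<Rightarrow> nat \<Rightarrow> 'b::real_normed_vector"
    and g :: "(nat \<Rightarrow> 'b) \<Rightarrow> nat \<Rightarrow> 'c::real_normed_vector"
  assumes "model_domain S U" "smooth_on S U f" "model_domain S' U'" "smooth_on S' U' g" "f ` U \<subseteq> U'"
    and "z \<in> tdom U S"
  shows "tfun f z \<in> tdom U' S'" "tfun (\<lambda>x. g (f x)) z = tfun g (tfun f z)"
proof -
  have z: "vfst z \<in> U" "vsnd z \<in> S"
    using assms(6) by auto
  note dir_deriv_chain[OF assms(1-5) z]
  then show "tfun f z \<in> tdom U' S'" "tfun (\<lambda>x. g (f x)) z = tfun g (tfun f z)"
    using z(1) assms(5) has_dir_deriv_imp by (auto simp: tfun_def)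
qed

text \<open>The induction proves \<open>Ck\<close> from full smoothness of f and g. Since
  \<open>smooth_on_tfun\<close> makes the tangent maps smooth again, the hypotheses reproduce
  themselves one level up while k decreases.\<close>

lemma smooth_on_compose:
  fixes f :: "(nat \<Rightarrow> 'a::real_normed_vector) \<Rightarrow> nat \<Rightarrow> 'b::real_normed_vector"
    and g :: "(nat \<Rightarrow> 'b) \<Rightarrow> nat \<Rightarrow> 'c::real_normed_vector"
  assumes "model_domain S U" "smooth_on S U f" "model_domain S' U'" "smooth_on S' U' g" "f ` U \<subseteq> U'"
  shows "smooth_on S U (\<lambda>x. g (f x))"
proof (rule Ck_imp_smooth_on[OF assms(1)])
  show "Ck k S U (\<lambda>x. g (f x))" for k
    using assms
  proof (induction k arbitrary: S U f S' U' g)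
    case 0
    have "0 \<in> S" "0 \<in> S'"
      using 0 by (auto simp: model_domain_def subspace_0)
    then have "continuous_on U f" "continuous_on U' g"
      using smooth_on_imp_continuous_on 0 by blast+
    then show ?case
      using 0(5) by (simp add: continuous_on_compose2)
  next
    case (Suc k)
    note prems = Suc.prems
    have "0 \<in> S" "0 \<in> S'"
      using prems by (auto simp: model_domain_def subspace_0)
    then have "continuous_on U f" "continuous_on U' g"
      using smooth_on_imp_continuous_on prems by blast+
    then have "continuous_on U (\<lambda>x. g (f x))"
      using prems(5) by (simp add: continuous_on_compose2)
    moreover have "\<forall>x\<in>U. \<forall>v\<in>S. \<exists>l. has_dir_deriv (\<lambda>x. g (f x)) x v l"
      using dir_deriv_chain(2)[OF prems] by blast
    moreover have "Ck k (tdom S S) (tdom U S) (tfun (\<lambda>x. g (f x)))"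
    proof (rule Ck_cong[OF model_domain_tdom[OF prems(1)]])
      show "tfun g (tfun f z) = tfun (\<lambda>x. g (f x)) z" if "z \<in> tdom U S" for z
        using tfun_comp(2)[OF prems that] by simp
      show "Ck k (tdom S S) (tdom U S) (\<lambda>z. tfun g (tfun f z))"
        by (rule Suc.IH[OF model_domain_tdom[OF prems(1)] smooth_on_tfun[OF prems(1,2)]
              model_domain_tdom[OF prems(3)] smooth_on_tfun[OF prems(3,4)]])
          (use tfun_comp(1)[OF prems] in blast)
    qed
    ultimately show ?case
      by simp
  qed
qed

subsection \<open>Symmetry of second derivatives\<close>

lemma norm_vector_derivative_bound:
  fixes f :: "real \<Rightarrow> 'b::real_normed_vector"
  assumes "0 \<le> k" "\<And>s. 0 \<le> s \<Longrightarrow> s \<le> k \<Longrightarrow> (f has_vector_derivative f' s) (at s)"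
    and "\<And>s. 0 \<le> s \<Longrightarrow> s \<le> k \<Longrightarrow> norm (f' s - c) \<le> e"
  shows "norm (f k - f 0 - k *\<^sub>R c) \<le> k * e"
proof -
  let ?g = "\<lambda>s. f s - s *\<^sub>R c"
  have "norm (?g k - ?g 0) \<le> e * norm (k - 0)"
  proof (rule differentiable_bound[where S = "{0..k}" and f' = "\<lambda>s h. h *\<^sub>R (f' s - c)"])
    show "(?g has_derivative (\<lambda>h. h *\<^sub>R (f' s - c))) (at s within {0..k})" if "s \<in> {0..k}" for s
    proof -
      have "(?g has_vector_derivative (f' s - c)) (at s)"
        using assms(2)[of s] that by (auto intro!: derivative_eq_intros)
      then show ?thesis
        using has_vector_derivative_at_within unfolding has_vector_derivative_def by blast
    qed
    show "onorm (\<lambda>h. h *\<^sub>R (f' s - c)) \<le> e" if "s \<in> {0..k}" for s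
      by (rule onorm_le) (use assms(3)[of s] that in \<open>auto simp: mult.commute[of e] intro: mult_left_mono\<close>)
  qed (use assms(1) in auto)
  then show ?thesis
    using assms(1) by (simp add: algebra_simps)
qed

text \<open>The mean value inequality is used twice: in t for the difference of the slices at s = k
  and s = 0, whose derivative \<open>a t k - a t 0\<close> is in turn compared with
  \<open>k *\<^sub>R c\<close> by the inequality in s.\<close>

lemma second_difference_bound:
  fixes \<phi> :: "real \<Rightarrow> real \<Rightarrow> 'b::real_normed_vector"
  assumes hk: "0 \<le> h" "h < \<delta>" "0 \<le> k" "k < \<delta>"
    and A: "\<And>t s. \<bar>t\<bar> < \<delta> \<Longrightarrow> \<bar>s\<bar> < \<delta> \<Longrightarrow> ((\<lambda>t. \<phi> t s) has_vector_derivative a t s) (at t)"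
    and B: "\<And>t s. \<bar>t\<bar> < \<delta> \<Longrightarrow> \<bar>s\<bar> < \<delta> \<Longrightarrow> (a t has_vector_derivative b t s) (at s)"
    and C: "\<And>t s. \<bar>t\<bar> < \<delta> \<Longrightarrow> \<bar>s\<bar> < \<delta> \<Longrightarrow> norm (b t s - c) \<le> e"
  shows "norm (\<phi> h k - \<phi> h 0 - (\<phi> 0 k - \<phi> 0 0) - h *\<^sub>R k *\<^sub>R c) \<le> h * (k * e)"
proof (rule norm_vector_derivative_bound[where f' = "\<lambda>t. a t k - a t 0", OF hk(1)])
  fix t assume t: "0 \<le> t" "t \<le> h"
  show "((\<lambda>t. \<phi> t k - \<phi> t 0) has_vector_derivative (a t k - a t 0)) (at t)"
    by (intro has_vector_derivative_diff A) (use t hk in auto)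
  show "norm (a t k - a t 0 - k *\<^sub>R c) \<le> k * e"
    by (rule norm_vector_derivative_bound[where f' = "b t", OF hk(3)]) (use t hk B C in auto)
qed

text \<open>The second difference over a square is symmetric in the two parameters, and with side h
  it approximates both h^2 c and h^2 c' with error at most h^2 e.\<close>

lemma symmetric_mixed_derivative:
  fixes \<phi> :: "real \<Rightarrow> real \<Rightarrow> 'b::real_normed_vector"
  assumes "\<And>e. e > 0 \<Longrightarrow> \<exists>\<delta>>0. \<forall>t s. \<bar>t\<bar> < \<delta> \<longrightarrow> \<bar>s\<bar> < \<delta> \<longrightarrow>
      ((\<lambda>t. \<phi> t s) has_vector_derivative a t s) (at t) \<and> (a t has_vector_derivative b t s) (at s) \<and>
      (\<phi> t has_vector_derivative a' t s) (at s) \<and> ((\<lambda>t. a' t s) has_vector_derivative b' t s) (at t) \<and>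
      norm (b t s - c) \<le> e \<and> norm (b' t s - c') \<le> e"
  shows "c = c'"
proof -
  have "norm (c - c') \<le> 2 * e" if "e > 0" for e
  proof -
    obtain \<delta> where \<delta>: "\<delta> > 0" and H: "\<And>t s. \<bar>t\<bar> < \<delta> \<Longrightarrow> \<bar>s\<bar> < \<delta> \<Longrightarrow>
      ((\<lambda>t. \<phi> t s) has_vector_derivative a t s) (at t) \<and> (a t has_vector_derivative b t s) (at s) \<and>
      (\<phi> t has_vector_derivative a' t s) (at s) \<and> ((\<lambda>t. a' t s) has_vector_derivative b' t s) (at t) \<and>
      norm (b t s - c) \<le> e \<and> norm (b' t s - c') \<le> e"
      using assms[OF \<open>e > 0\<close>] by blast
    \<comment> \<open>Any side length strictly between 0 and \<delta> would serve; its square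
      cancels below.\<close>
    let ?h = "\<delta> / 2"
    let ?d = "\<phi> ?h ?h - \<phi> ?h 0 - (\<phi> 0 ?h - \<phi> 0 0)"
    have "norm (?d - ?h *\<^sub>R ?h *\<^sub>R c) \<le> ?h * (?h * e)"
      by (rule second_difference_bound[where \<delta> = \<delta> and a = a and b = b]) (use \<delta> H in auto)
    moreover have "norm (\<phi> ?h ?h - \<phi> 0 ?h - (\<phi> ?h 0 - \<phi> 0 0) - ?h *\<^sub>R ?h *\<^sub>R c') \<le> ?h * (?h * e)"
      by (rule second_difference_bound[where \<delta> = \<delta> and \<phi> = "\<lambda>s t. \<phi> t s" and a = "\<lambda>s t. a' t s"
            and b = "\<lambda>s t. b' t s"]) (use \<delta> H in auto)
    moreover have "\<phi> ?h ?h - \<phi> 0 ?h - (\<phi> ?h 0 - \<phi> 0 0) = ?d"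
      by simp
    ultimately have "norm ((?d - ?h *\<^sub>R ?h *\<^sub>R c') - (?d - ?h *\<^sub>R ?h *\<^sub>R c)) \<le> 2 * (?h * (?h * e))"
      using norm_triangle_ineq4[of "?d - ?h *\<^sub>R ?h *\<^sub>R c'" "?d - ?h *\<^sub>R ?h *\<^sub>R c"] by simp
    then have "norm (?h *\<^sub>R ?h *\<^sub>R (c - c')) \<le> 2 * (?h * (?h * e))"
      by (simp add: scaleR_diff_right)
    then have "?h * ?h * norm (c - c') \<le> ?h * ?h * (2 * e)"
      using \<delta> by simp
    then show ?thesis
      using \<delta> by (simp add: mult_le_cancel_left_pos)
  qed
  \<comment> \<open>For this e the bound reads norm (c - c') \<le> norm (c - c') / 2.\<close>
  from this[of "norm (c - c') / 4"] show ?thesis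
    by (cases "c = c'") auto
qed

text \<open>The source type need not have continuous operations, so continuity of the parametrised
  plane is the premise \<open>line\<close>. This lets one statement serve both the model spaces and
  the parameter plane of a surface. Since the target has no norm, the argument runs in each
  coordinate i.\<close>

lemma smooth_on_symmetric:
  fixes f :: "'a::{real_vector,topological_space} \<Rightarrow> nat \<Rightarrow> 'b::real_normed_vector"
  assumes sm: "smooth_on S U f" and S: "subspace S" and U: "openin (top_of_set S) U"
    and x: "x \<in> U" and v: "v \<in> S" and w: "w \<in> S"
    and line: "continuous_on UNIV (\<lambda>(t, s). x + t *\<^sub>R v + s *\<^sub>R w)"
  shows "dir_deriv (\<lambda>y. dir_deriv f y v) x w = dir_deriv (\<lambda>y. dir_deriv f y w) x v"
proof
  fix i
  obtain A where A: "open A" "U = S \<inter> A"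
    using U by (auto simp: openin_open)
  let ?p = "\<lambda>t s. x + t *\<^sub>R v + s *\<^sub>R w"
  let ?\<Omega> = "(\<lambda>(t, s). ?p t s) -` A"
  have \<Omega>: "open ?\<Omega>" "(0, 0) \<in> ?\<Omega>"
    using open_vimage[OF A(1) line] x A(2) by auto
  have pU: "?p t s \<in> U \<longleftrightarrow> (t, s) \<in> ?\<Omega>" for t s
    using A(2) S x v w by (auto intro!: subspace_add subspace_scale)
  let ?D = "\<lambda>v w y. dir_deriv (\<lambda>y. dir_deriv f y v) y w i"
  have D1: "has_dir_deriv (\<lambda>y. f y i) y u (dir_deriv f y u i)" if "y \<in> U" "u \<in> S" for y u
    using smooth_on_dir_deriv1[OF sm that] by (simp add: has_dir_deriv_fun_iff)
  have D2: "has_dir_deriv (\<lambda>y. dir_deriv f y u i) y u' (?D u u' y)" if "y \<in> U" "u \<in> S" "u' \<in> S" for y u u'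
    using smooth_on_dir_deriv1[OF smooth_on_dir[OF sm that(2)] that(1,3)] by (simp add: has_dir_deriv_fun_iff)
  have ev: "\<forall>\<^sub>F p in nhds 0 \<times>\<^sub>F nhds 0. norm (?D u u' (?p (fst p) (snd p)) - ?D u u' x) < e"
    if "e > 0" "u \<in> S" "u' \<in> S" for e u u'
  proof -
    have "continuous_on ?\<Omega> (\<lambda>p. (?p (fst p) (snd p), u'))"
      using continuous_on_subset[OF line subset_UNIV]
      by (intro continuous_on_Pair continuous_on_const) (simp add: case_prod_beta)
    then have "continuous_on ?\<Omega> (\<lambda>p. (\<lambda>(y, u'). dir_deriv (\<lambda>y. dir_deriv f y u) y u') (?p (fst p) (snd p), u'))"
      by (rule continuous_on_compose2[OF smooth_on_continuous_dir_deriv[OF smooth_on_dir[OF sm that(2)]]])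
        (use pU that(3) in auto)
    then have "continuous_on ?\<Omega> (\<lambda>p. ?D u u' (?p (fst p) (snd p)))"
      using continuous_on_coord by simp
    then have "((\<lambda>p. ?D u u' (?p (fst p) (snd p))) \<longlongrightarrow> ?D u u' x) (nhds (0, 0))"
      using \<Omega> by (simp add: continuous_on_eq_continuous_at isCont_def tendsto_at_iff_tendsto_nhds)
        (metis (no_types, lifting) \<Omega>(2) add.right_neutral fst_conv scale_zero_left snd_conv tendsto_at_iff_tendsto_nhds)
    then show ?thesis
      using that(1) by (auto simp: tendsto_iff dist_norm nhds_prod)
  qed
  show "dir_deriv (\<lambda>y. dir_deriv f y v) x w i = dir_deriv (\<lambda>y. dir_deriv f y w) x v i"
  proof (rule symmetric_mixed_derivative[where \<phi> = "\<lambda>t s. f (?p t s) i"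
        and a = "\<lambda>t s. dir_deriv f (?p t s) v i" and b = "\<lambda>t s. ?D v w (?p t s)"
        and a' = "\<lambda>t s. dir_deriv f (?p t s) w i" and b' = "\<lambda>t s. ?D w v (?p t s)"])
    fix e :: real assume "e > 0"
    have "\<forall>\<^sub>F p in nhds 0 \<times>\<^sub>F nhds 0. p \<in> ?\<Omega>"
      using eventually_nhds_in_open[OF \<Omega>] by (simp add: nhds_prod)
    then have "\<forall>\<^sub>F p in nhds 0 \<times>\<^sub>F nhds 0. p \<in> ?\<Omega> \<and>
        norm (?D v w (?p (fst p) (snd p)) - ?D v w x) < e \<and> norm (?D w v (?p (fst p) (snd p)) - ?D w v x) < e"
      by (intro eventually_conj ev v w \<open>e > 0\<close>)
    \<comment> \<open>A single predicate for both parameters, so that one \<delta> describes a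
      square.\<close>
    then obtain Q where Q: "\<forall>\<^sub>F t in nhds 0. Q t" and QQ: "\<And>t s. Q t \<Longrightarrow> Q s \<Longrightarrow> (t, s) \<in> ?\<Omega> \<and>
        norm (?D v w (?p t s) - ?D v w x) < e \<and> norm (?D w v (?p t s) - ?D w v x) < e"
      unfolding eventually_prod_same by auto
    obtain \<delta> where \<delta>: "\<delta> > 0" "\<And>t::real. \<bar>t\<bar> < \<delta> \<Longrightarrow> Q t"
      using Q by (auto simp: eventually_nhds_metric dist_real_def)
    have swap: "?p t s = x + s *\<^sub>R w + t *\<^sub>R v" for t s
      by (simp add: add_ac)
    have lt: "((\<lambda>t. g (?p t s)) has_vector_derivative l) (at t)"
      if "has_dir_deriv g (?p t s) v l" for g :: "'a \<Rightarrow> 'b" and t s l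
      using that unfolding swap by (rule has_vector_derivative_line)
    have ls: "((\<lambda>s. g (?p t s)) has_vector_derivative l) (at s)"
      if "has_dir_deriv g (?p t s) w l" for g :: "'a \<Rightarrow> 'b" and t s l
      using that by (rule has_vector_derivative_line)
    have "((\<lambda>t. f (?p t s) i) has_vector_derivative dir_deriv f (?p t s) v i) (at t) \<and>
        ((\<lambda>s. dir_deriv f (?p t s) v i) has_vector_derivative ?D v w (?p t s)) (at s) \<and>
        ((\<lambda>s. f (?p t s) i) has_vector_derivative dir_deriv f (?p t s) w i) (at s) \<and>
        ((\<lambda>t. dir_deriv f (?p t s) w i) has_vector_derivative ?D w v (?p t s)) (at t) \<and>
        norm (?D v w (?p t s) - ?D v w x) \<le> e \<and> norm (?D w v (?p t s) - ?D w v x) \<le> e"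
      if "\<bar>t\<bar> < \<delta>" "\<bar>s\<bar> < \<delta>" for t s
    proof -
      have "?p t s \<in> U"
        using QQ \<delta>(2) that pU by blast
      then show ?thesis
        using QQ[of t s] \<delta>(2) that v w
        by (intro conjI lt ls D1 D2 less_imp_le) auto
    qed
    then show "\<exists>\<delta>>0. \<forall>t s. \<bar>t\<bar> < \<delta> \<longrightarrow> \<bar>s\<bar> < \<delta> \<longrightarrow>
        ((\<lambda>t. f (?p t s) i) has_vector_derivative dir_deriv f (?p t s) v i) (at t) \<and>
        ((\<lambda>s. dir_deriv f (?p t s) v i) has_vector_derivative ?D v w (?p t s)) (at s) \<and>
        ((\<lambda>s. f (?p t s) i) has_vector_derivative dir_deriv f (?p t s) w i) (at s) \<and>
        ((\<lambda>t. dir_deriv f (?p t s) w i) has_vector_derivative ?D w v (?p t s)) (at t) \<and>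
        norm (?D v w (?p t s) - ?D v w x) \<le> e \<and> norm (?D w v (?p t s) - ?D w v x) \<le> e"
      using \<delta>(1) by blast
  qed
qed

text \<open>On vectors ((x, y), (X, Y)) this is the chart form of the canonical involution.\<close>

definition vflip :: "(nat \<Rightarrow> 'a) \<Rightarrow> nat \<Rightarrow> 'a" where
  "vflip z = vpair (vpair (vfst (vfst z)) (vfst (vsnd z))) (vpair (vsnd (vfst z)) (vsnd (vsnd z)))"

lemma vflip_vflip [simp]: "vflip (vflip z) = z"
  by (simp add: vflip_def)

lemma smooth_on_vflip:
  fixes U :: "(nat \<Rightarrow> 'a::real_normed_vector) set"
  assumes "radially_open S U"
  shows "smooth_on S U vflip"
proof (rule smooth_on_linear[OF _ _ assms])
  show "linear (vflip :: (nat \<Rightarrow> 'a) \<Rightarrow> _)"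
    by (simp add: linear_iff vflip_def vpair_add vpair_scaleR)
  show "continuous_on UNIV (vflip :: (nat \<Rightarrow> 'a) \<Rightarrow> _)"
    unfolding vflip_def by (intro continuous_on_vpair continuous_on_vfst continuous_on_vsnd continuous_on_id)
qed

text \<open>The product rule \<open>has_dir_deriv_iter_slot\<close> at order 0: moving the base
  point by X gives the mixed second derivative, moving the vector by Y gives the linear
  term.\<close>

lemma tfun_tfun:
  fixes f :: "(nat \<Rightarrow> 'a::real_normed_vector) \<Rightarrow> nat \<Rightarrow> 'b::real_normed_vector"
  assumes "model_domain S U" "smooth_on S U f" "x \<in> U" "y \<in> S" "X \<in> S" "Y \<in> S"
  shows "tfun (tfun f) (vpair (vpair x y) (vpair X Y)) =
    vpair (vpair (f x) (dir_deriv f x y))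
      (vpair (dir_deriv f x X) (dir_deriv (\<lambda>z. dir_deriv f z y) x X + dir_deriv f x Y))"
proof -
  let ?z = "vpair x y" and ?w = "vpair X Y"
  have "has_dir_deriv (\<lambda>z. dir_deriv f (vfst z) (vsnd z)) ?z ?w
      (dir_deriv (\<lambda>z. dir_deriv f z y) x X + dir_deriv f x Y)"
    using has_dir_deriv_iter_slot[OF assms(1,2), of ?z ?w "\<lambda>_. X" 0] assms(3-6) by simp
  moreover have "has_dir_deriv (\<lambda>z. f (vfst z)) ?z ?w (dir_deriv f x X)"
    using has_dir_deriv_iter_base[OF assms(2), of ?z "\<lambda>_. X" 0 ?w] assms(3-6) by simp
  ultimately have "has_dir_deriv (tfun f) ?z ?w
      (vpair (dir_deriv f x X) (dir_deriv (\<lambda>z. dir_deriv f z y) x X + dir_deriv f x Y))"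
    unfolding tfun_def by (intro has_dir_deriv_vpair)
  then show ?thesis
    by (simp add: tfun_def[of "tfun f"] has_dir_deriv_imp) (simp add: tfun_def)
qed

text \<open>Exchanging y and X exchanges the two middle entries of the formula for the second
  tangent map; its last entry is unchanged exactly because the mixed second derivative is
  symmetric.\<close>

lemma tfun_tfun_vflip:
  fixes f :: "(nat \<Rightarrow> 'a::real_normed_vector) \<Rightarrow> nat \<Rightarrow> 'b::real_normed_vector"
  assumes "model_domain S U" "smooth_on S U f" "z \<in> tdom (tdom U S) (tdom S S)"
  shows "tfun (tfun f) (vflip z) = vflip (tfun (tfun f) z)"
proof -
  define x y X Y where "x = vfst (vfst z)" "y = vsnd (vfst z)" "X = vfst (vsnd z)" "Y = vsnd (vsnd z)"
  then have z: "z = vpair (vpair x y) (vpair X Y)" and xU: "x \<in> U" "y \<in> S" "X \<in> S" "Y \<in> S"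
    using assms(3) by auto
  have "continuous_on UNIV (\<lambda>(t, s). x + t *\<^sub>R y + s *\<^sub>R X)"
    unfolding case_prod_beta
    by (intro continuous_on_add continuous_on_scaleR_fun continuous_on_fst continuous_on_snd
        continuous_on_id continuous_on_const)
  then have "dir_deriv (\<lambda>z. dir_deriv f z y) x X = dir_deriv (\<lambda>z. dir_deriv f z X) x y"
    using assms(1) xU by (intro smooth_on_symmetric[OF assms(2)]) (auto simp: model_domain_def)
  then show ?thesis
    using tfun_tfun[OF assms(1,2) xU] tfun_tfun[OF assms(1,2) xU(1,3,2,4)]
    by (simp add: z vflip_def)
qed

section \<open>Tangent bundles\<close>

lemma model_domain_Int: "model_domain S U \<Longrightarrow> model_domain S V \<Longrightarrow> model_domain S (U \<inter> V)"
  by (simp add: model_domain_def openin_Int)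

lemma model_domain_vimage:
  fixes f :: "(nat \<Rightarrow> 'a::real_normed_vector) \<Rightarrow> nat \<Rightarrow> 'b::real_normed_vector"
  assumes "model_domain S U" "smooth_on S U f" "model_domain S' V" "f ` U \<subseteq> S'"
  shows "model_domain S (U \<inter> f -` V)"
proof -
  have "0 \<in> S"
    using assms(1) by (simp add: model_domain_def subspace_0)
  then have "continuous_on U f"
    by (rule smooth_on_imp_continuous_on[OF assms(2)])
  then have "openin (top_of_set U) (U \<inter> f -` V)"
    by (rule continuous_openin_preimage[where T = S']) (use assms(3,4) in \<open>auto simp: model_domain_def\<close>)
  then have "openin (top_of_set S) (U \<inter> f -` V)"
    using assms(1) openin_trans unfolding model_domain_def by blast
  then show ?thesis
    using assms(1) by (simp add: model_domain_def)
qed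

text \<open>The chain rule with the identity of \<open>S'\<close> as outer map; its membership
  conclusion is where closedness of \<open>S'\<close> acts.\<close>

lemma dir_deriv_in_model:
  fixes f :: "(nat \<Rightarrow> 'a::real_normed_vector) \<Rightarrow> nat \<Rightarrow> 'b::real_normed_vector"
  assumes "model_domain S U" "smooth_on S U f" "model_domain S' S'" "f ` U \<subseteq> S'" "x \<in> U" "v \<in> S"
  shows "dir_deriv f x v \<in> S'"
proof -
  have "smooth_on S' S' (\<lambda>x. x)"
    by (rule smooth_on_linear[OF _ _ model_domain_radially_open[OF assms(3)]])
      (simp_all add: linear_iff continuous_on_id)
  then show ?thesis
    by (rule dir_deriv_chain(1)[OF assms(1,2,3) _ assms(4-6)])
qed

text \<open>Closedness of the model space ensures that derivatives of maps into it stay in it.\<close>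

locale vmanifold =
  fixes N :: "('m, 'i, 'e::banach) manifold"
  assumes atlas: "is_atlas N" and subspace_model: "subspace (model N)" and closed_model: "closed (model N)"
begin

abbreviation trans :: "'i \<Rightarrow> 'i \<Rightarrow> (nat \<Rightarrow> 'e) \<Rightarrow> nat \<Rightarrow> 'e" where
  "trans \<alpha> \<beta> \<equiv> chart N \<beta> \<circ> chart_inv N \<alpha>"

abbreviation overlap :: "'i \<Rightarrow> 'i \<Rightarrow> (nat \<Rightarrow> 'e) set" where
  "overlap \<alpha> \<beta> \<equiv> chart N \<alpha> ` (cdom N \<alpha> \<inter> cdom N \<beta>)"

lemma pts_eq: "pts N = (\<Union>\<alpha>\<in>idx N. cdom N \<alpha>)"
  using atlas by (simp add: is_atlas_def)

lemma inj_chart: "\<alpha> \<in> idx N \<Longrightarrow> inj_on (chart N \<alpha>) (cdom N \<alpha>)"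
  using atlas by (simp add: is_atlas_def)

lemma model_domain_overlap: "\<alpha> \<in> idx N \<Longrightarrow> \<beta> \<in> idx N \<Longrightarrow> model_domain (model N) (overlap \<alpha> \<beta>)"
  using atlas subspace_model closed_model by (simp add: is_atlas_def model_domain_def)

lemma model_domain_chart: "\<alpha> \<in> idx N \<Longrightarrow> model_domain (model N) (chart N \<alpha> ` cdom N \<alpha>)"
  using model_domain_overlap[of \<alpha> \<alpha>] by simp

lemma smooth_trans: "\<alpha> \<in> idx N \<Longrightarrow> \<beta> \<in> idx N \<Longrightarrow> smooth_on (model N) (overlap \<alpha> \<beta>) (trans \<alpha> \<beta>)"
  using atlas by (simp add: is_atlas_def)

lemma chart_inv_chart: "\<alpha> \<in> idx N \<Longrightarrow> p \<in> cdom N \<alpha> \<Longrightarrow> chart_inv N \<alpha> (chart N \<alpha> p) = p"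
  using inj_chart by (simp add: chart_inv_def)

lemma chart_in_model: "\<alpha> \<in> idx N \<Longrightarrow> p \<in> cdom N \<alpha> \<Longrightarrow> chart N \<alpha> p \<in> model N"
  using model_domain_subset[OF model_domain_chart] by blast

lemma trans_image: "\<alpha> \<in> idx N \<Longrightarrow> \<beta> \<in> idx N \<Longrightarrow> trans \<alpha> \<beta> ` overlap \<alpha> \<beta> \<subseteq> overlap \<beta> \<alpha>"
  by (auto simp: chart_inv_chart)

lemma trans_in_model: "\<alpha> \<in> idx N \<Longrightarrow> \<beta> \<in> idx N \<Longrightarrow> trans \<alpha> \<beta> ` overlap \<alpha> \<beta> \<subseteq> model N"
  using trans_image model_domain_subset[OF model_domain_overlap] by blast

lemma dir_deriv_trans_in_model:
  assumes "\<alpha> \<in> idx N" "\<beta> \<in> idx N" "p \<in> cdom N \<alpha>" "p \<in> cdom N \<beta>" "v \<in> model N"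
  shows "dir_deriv (trans \<alpha> \<beta>) (chart N \<alpha> p) v \<in> model N"
proof (rule dir_deriv_in_model[OF model_domain_overlap[OF assms(1,2)] smooth_trans[OF assms(1,2)]])
  show "trans \<alpha> \<beta> ` overlap \<alpha> \<beta> \<subseteq> model N"
    by (rule trans_in_model[OF assms(1,2)])
qed (use assms model_domain_self[OF model_domain_overlap] in blast)+

lemma dir_deriv_trans_self:
  assumes "\<alpha> \<in> idx N" "p \<in> cdom N \<alpha>" "v \<in> model N"
  shows "dir_deriv (trans \<alpha> \<alpha>) (chart N \<alpha> p) v = v"
proof -
  have "dir_deriv (trans \<alpha> \<alpha>) (chart N \<alpha> p) v = dir_deriv (\<lambda>x. x) (chart N \<alpha> p) v"
    by (rule dir_deriv_cong[OF model_domain_radially_open[OF model_domain_chart[OF assms(1)]]])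
      (use assms in \<open>auto simp: chart_inv_chart\<close>)
  also have "has_dir_deriv (\<lambda>x. x) (chart N \<alpha> p) v v"
  proof -
    have "\<forall>\<^sub>F t::real in at 0. v = ((chart N \<alpha> p + t *\<^sub>R v) - chart N \<alpha> p) /\<^sub>R t"
      by (simp add: eventually_at_filter)
    then show ?thesis
      unfolding has_dir_deriv_def by (rule Lim_transform_eventually[OF tendsto_const])
  qed
  then have "dir_deriv (\<lambda>x. x) (chart N \<alpha> p) v = v"
    by (rule has_dir_deriv_imp)
  finally show ?thesis .
qed

lemma dir_deriv_change:
  assumes "\<alpha> \<in> idx N" "\<beta> \<in> idx N" "p \<in> cdom N \<alpha>" "p \<in> cdom N \<beta>" "v \<in> model N"
    and "model_domain (model N) V" "chart N \<beta> p \<in> V"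
    and "smooth_on (model N) V (h :: (nat \<Rightarrow> 'e) \<Rightarrow> nat \<Rightarrow> 'b::real_normed_vector)"
  shows "dir_deriv (\<lambda>z. h (trans \<alpha> \<beta> z)) (chart N \<alpha> p) v =
    dir_deriv h (chart N \<beta> p) (dir_deriv (trans \<alpha> \<beta>) (chart N \<alpha> p) v)"
proof (rule has_dir_deriv_imp)
  have x: "chart N \<alpha> p \<in> overlap \<alpha> \<beta>"
    using assms by blast
  have tp: "trans \<alpha> \<beta> (chart N \<alpha> p) = chart N \<beta> p"
    using assms by (simp add: chart_inv_chart)
  have "\<forall>\<^sub>F t in at 0. chart N \<alpha> p + t *\<^sub>R v \<in> overlap \<alpha> \<beta>"
    using model_domain_radially_open[OF model_domain_overlap[OF assms(1,2)]] x assms(5)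
    unfolding radially_open_def by blast
  then have "\<forall>\<^sub>F t in at 0. trans \<alpha> \<beta> (chart N \<alpha> p + t *\<^sub>R v) \<in> model N"
    by (rule eventually_mono) (use trans_in_model[OF assms(1,2)] in blast)
  then have "has_dir_deriv (\<lambda>z. h (trans \<alpha> \<beta> z)) (chart N \<alpha> p) v
      (dir_deriv h (trans \<alpha> \<beta> (chart N \<alpha> p)) (dir_deriv (trans \<alpha> \<beta>) (chart N \<alpha> p) v))"
    by (intro has_dir_deriv_chain(2)[OF assms(6,8) smooth_on_dir_deriv1[OF smooth_trans x assms(5)]])
      (use assms tp in simp_all)
  then show "has_dir_deriv (\<lambda>z. h (trans \<alpha> \<beta> z)) (chart N \<alpha> p) v
      (dir_deriv h (chart N \<beta> p) (dir_deriv (trans \<alpha> \<beta>) (chart N \<alpha> p) v))"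
    unfolding tp .
qed

text \<open>The cocycle identity, which makes a tangent class independent of the chart used to write
  it.\<close>

lemma dir_deriv_trans_trans:
  assumes "\<alpha> \<in> idx N" "\<beta> \<in> idx N" "\<gamma> \<in> idx N"
    and "p \<in> cdom N \<alpha>" "p \<in> cdom N \<beta>" "p \<in> cdom N \<gamma>" "v \<in> model N"
  shows "dir_deriv (trans \<beta> \<gamma>) (chart N \<beta> p) (dir_deriv (trans \<alpha> \<beta>) (chart N \<alpha> p) v) =
    dir_deriv (trans \<alpha> \<gamma>) (chart N \<alpha> p) v"
proof -
  have "dir_deriv (\<lambda>z. trans \<beta> \<gamma> (trans \<alpha> \<beta> z)) (chart N \<alpha> p) v =
      dir_deriv (trans \<beta> \<gamma>) (chart N \<beta> p) (dir_deriv (trans \<alpha> \<beta>) (chart N \<alpha> p) v)"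
    by (rule dir_deriv_change[OF assms(1,2,4,5,7) model_domain_overlap[OF assms(2,3)] _
          smooth_trans[OF assms(2,3)]]) (use assms in blast)
  moreover have "dir_deriv (\<lambda>z. trans \<beta> \<gamma> (trans \<alpha> \<beta> z)) (chart N \<alpha> p) v =
      dir_deriv (trans \<alpha> \<gamma>) (chart N \<alpha> p) v"
  proof (rule dir_deriv_cong[OF model_domain_radially_open[OF model_domain_overlap[OF assms(1,2)]]])
    show "trans \<beta> \<gamma> (trans \<alpha> \<beta> z) = trans \<alpha> \<gamma> z" if "z \<in> overlap \<alpha> \<beta>" for z
      using that assms(1,2) by (auto simp: chart_inv_chart)
  qed (use assms in auto)
  ultimately show ?thesis
    by simp
qed

text \<open>The tangent vector at p with coordinate v in the chart \<alpha>. Arguments about the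
  tangent bundle first bring its elements into this form.\<close>

definition tv :: "('m, 'i, 'e) point \<Rightarrow> 'i \<Rightarrow> (nat \<Rightarrow> 'e) \<Rightarrow> ('m, 'i, 'e) point" where
  "tv p \<alpha> v = Tvec p (tangent_class N p \<alpha> v)"

lemma foot_tv [simp]: "foot (tv p \<alpha> v) = p"
  by (simp add: tv_def)

lemma cls_tv: "(\<beta>, w) \<in> cls (tv p \<alpha> v) \<longleftrightarrow>
    \<beta> \<in> idx N \<and> p \<in> cdom N \<beta> \<and> w = dir_deriv (trans \<alpha> \<beta>) (chart N \<alpha> p) v"
  by (simp add: tv_def tangent_class_def)

lemma tv_change:
  assumes "\<alpha> \<in> idx N" "\<beta> \<in> idx N" "p \<in> cdom N \<alpha>" "p \<in> cdom N \<beta>" "v \<in> model N"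
  shows "tv p \<alpha> v = tv p \<beta> (dir_deriv (trans \<alpha> \<beta>) (chart N \<alpha> p) v)"
proof -
  have "dir_deriv (trans \<alpha> \<gamma>) (chart N \<alpha> p) v =
      dir_deriv (trans \<beta> \<gamma>) (chart N \<beta> p) (dir_deriv (trans \<alpha> \<beta>) (chart N \<alpha> p) v)"
    if "\<gamma> \<in> idx N" "p \<in> cdom N \<gamma>" for \<gamma>
    using dir_deriv_trans_trans[OF assms(1,2) that(1) assms(3,4) that(2) assms(5)] by simp
  then show ?thesis
    unfolding tv_def tangent_class_def by (intro arg_cong2[where f = Tvec] refl) auto
qed

lemma idx_T [simp]: "idx (tangent_bundle N) = idx N"
  by (simp add: tangent_bundle_def)

lemma model_T: "model (tangent_bundle N) = tdom (model N) (model N)"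
  by (auto simp: tangent_bundle_def tdom_def)

text \<open>\<open>tangent_space\<close> allows representatives from any chart around p.
  \<open>tv_change\<close> rewrites them in the chart \<alpha>, and the new coordinate stays in the
  model.\<close>

lemma cdom_T:
  assumes "\<alpha> \<in> idx N"
  shows "cdom (tangent_bundle N) \<alpha> = {tv p \<alpha> v | p v. p \<in> cdom N \<alpha> \<and> v \<in> model N}" (is "?L = ?R")
proof
  show "?R \<subseteq> ?L"
    using assms by (auto simp: tangent_bundle_def tangent_space_def tv_def)
  show "?L \<subseteq> ?R"
  proof
    fix \<xi> assume "\<xi> \<in> ?L"
    then obtain p \<beta> w where "p \<in> cdom N \<alpha>" "\<beta> \<in> idx N" "p \<in> cdom N \<beta>" "w \<in> model N" "\<xi> = tv p \<beta> w"
      by (auto simp: tangent_bundle_def tangent_space_def tv_def)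
    then show "\<xi> \<in> ?R"
      using tv_change[of \<beta> \<alpha> p w] dir_deriv_trans_in_model[of \<beta> \<alpha> p w] assms by blast
  qed
qed

lemma cdom_TE:
  assumes "\<alpha> \<in> idx N" "\<xi> \<in> cdom (tangent_bundle N) \<alpha>"
  obtains p v where "\<xi> = tv p \<alpha> v" "p \<in> cdom N \<alpha>" "v \<in> model N"
  using assms by (auto simp: cdom_T)

lemma tv_in_cdom_T: "\<alpha> \<in> idx N \<Longrightarrow> p \<in> cdom N \<alpha> \<Longrightarrow> v \<in> model N \<Longrightarrow> tv p \<alpha> v \<in> cdom (tangent_bundle N) \<alpha>"
  by (auto simp: cdom_T)

lemma pts_T: "pts (tangent_bundle N) = (\<Union>\<alpha>\<in>idx N. cdom (tangent_bundle N) \<alpha>)"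
proof -
  have "pts (tangent_bundle N) = (\<Union>p\<in>pts N. tangent_space N p)"
    by (simp add: tangent_bundle_def)
  also have "\<dots> = (\<Union>\<alpha>\<in>idx N. cdom (tangent_bundle N) \<alpha>)"
    unfolding pts_eq by (auto simp: tangent_bundle_def)
  finally show ?thesis .
qed

lemma pts_TE:
  assumes "\<xi> \<in> pts (tangent_bundle N)"
  obtains \<alpha> p v where "\<alpha> \<in> idx N" "\<xi> = tv p \<alpha> v" "p \<in> cdom N \<alpha>" "v \<in> model N"
proof -
  obtain \<alpha> where "\<alpha> \<in> idx N" "\<xi> \<in> cdom (tangent_bundle N) \<alpha>"
    using assms by (auto simp: pts_T)
  then show thesis
    using that by (metis cdom_TE)
qed

text \<open>Lying over a chart depends on the base point alone. Sections and tangent maps of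
  projections respect chart domains for this reason.\<close>

lemma cdom_T_iff: "\<alpha> \<in> idx N \<Longrightarrow> \<xi> \<in> cdom (tangent_bundle N) \<alpha> \<longleftrightarrow> \<xi> \<in> pts (tangent_bundle N) \<and> foot \<xi> \<in> cdom N \<alpha>"
proof -
  assume \<alpha>: "\<alpha> \<in> idx N"
  have "\<xi> \<in> cdom (tangent_bundle N) \<alpha>" if \<xi>: "\<xi> \<in> pts (tangent_bundle N)" "foot \<xi> \<in> cdom N \<alpha>"
  proof -
    obtain \<beta> p w where "\<beta> \<in> idx N" "\<xi> = tv p \<beta> w" "p \<in> cdom N \<beta>" "w \<in> model N"
      using \<xi>(1) by (rule pts_TE)
    then show ?thesis
      using \<xi>(2) tv_change[of \<beta> \<alpha> p w] dir_deriv_trans_in_model[of \<beta> \<alpha> p w] \<alpha> tv_in_cdom_T by simp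
  qed
  moreover have "\<xi> \<in> pts (tangent_bundle N) \<and> foot \<xi> \<in> cdom N \<alpha>" if \<xi>: "\<xi> \<in> cdom (tangent_bundle N) \<alpha>"
  proof -
    obtain p v where "\<xi> = tv p \<alpha> v" "p \<in> cdom N \<alpha>" "v \<in> model N"
      using \<alpha> \<xi> by (rule cdom_TE)
    then show ?thesis
      using \<alpha> \<xi> by (auto simp: pts_T)
  qed
  ultimately show ?thesis
    by blast
qed

lemma foot_T:
  assumes "\<xi> \<in> pts (tangent_bundle N)"
  shows "foot \<xi> \<in> pts N"
proof -
  obtain \<alpha> p v where "\<alpha> \<in> idx N" "\<xi> = tv p \<alpha> v" "p \<in> cdom N \<alpha>" "v \<in> model N"
    using assms by (rule pts_TE)
  then show ?thesis
    by (auto simp: pts_eq)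
qed

text \<open>A tangent class has exactly one entry for each chart around its base point, so the
  \<open>THE\<close> in the chart is well defined.\<close>

lemma chart_T:
  assumes "\<alpha> \<in> idx N" "\<beta> \<in> idx N" "p \<in> cdom N \<alpha>" "p \<in> cdom N \<beta>"
  shows "chart (tangent_bundle N) \<beta> (tv p \<alpha> v) =
    vpair (chart N \<beta> p) (dir_deriv (trans \<alpha> \<beta>) (chart N \<alpha> p) v)"
  using assms by (simp add: tangent_bundle_def cls_tv)

lemma chart_T_self:
  assumes "\<alpha> \<in> idx N" "p \<in> cdom N \<alpha>" "v \<in> model N"
  shows "chart (tangent_bundle N) \<alpha> (tv p \<alpha> v) = vpair (chart N \<alpha> p) v"
  using assms by (simp only: chart_T dir_deriv_trans_self)

lemma inj_chart_T: "\<alpha> \<in> idx N \<Longrightarrow> inj_on (chart (tangent_bundle N) \<alpha>) (cdom (tangent_bundle N) \<alpha>)"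
proof (rule inj_onI)
  fix \<xi> \<eta> assume \<alpha>: "\<alpha> \<in> idx N" and in_cdom: "\<xi> \<in> cdom (tangent_bundle N) \<alpha>" "\<eta> \<in> cdom (tangent_bundle N) \<alpha>"
    and eq: "chart (tangent_bundle N) \<alpha> \<xi> = chart (tangent_bundle N) \<alpha> \<eta>"
  obtain p v where p: "\<xi> = tv p \<alpha> v" "p \<in> cdom N \<alpha>" "v \<in> model N"
    using \<alpha> in_cdom(1) by (rule cdom_TE)
  obtain q w where q: "\<eta> = tv q \<alpha> w" "q \<in> cdom N \<alpha>" "w \<in> model N"
    using \<alpha> in_cdom(2) by (rule cdom_TE)
  have "chart N \<alpha> p = chart N \<alpha> q" "v = w"
    using eq p q \<alpha> by (simp_all add: chart_T_self)
  then show "\<xi> = \<eta>"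
    using inj_onD[OF inj_chart[OF \<alpha>]] p q by blast
qed

lemma chart_inv_T:
  assumes "\<alpha> \<in> idx N" "z \<in> tdom (chart N \<alpha> ` cdom N \<alpha>) (model N)"
  shows "chart_inv (tangent_bundle N) \<alpha> z = tv (chart_inv N \<alpha> (vfst z)) \<alpha> (vsnd z)"
proof -
  obtain p where p: "p \<in> cdom N \<alpha>" "vfst z = chart N \<alpha> p"
    using assms(2) by auto
  then have z: "z = chart (tangent_bundle N) \<alpha> (tv p \<alpha> (vsnd z))"
    using assms by (simp add: chart_T_self flip: p(2))
  have "tv p \<alpha> (vsnd z) \<in> cdom (tangent_bundle N) \<alpha>"
    using assms p by (intro tv_in_cdom_T) auto
  then have "chart_inv (tangent_bundle N) \<alpha> (chart (tangent_bundle N) \<alpha> (tv p \<alpha> (vsnd z))) = tv p \<alpha> (vsnd z)"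
    unfolding chart_inv_def by (rule inv_into_f_f[OF inj_chart_T[OF assms(1)]])
  then show ?thesis
    using p assms(1) by (simp add: chart_inv_chart flip: z)
qed

lemma overlap_T:
  assumes "\<alpha> \<in> idx N" "\<beta> \<in> idx N"
  shows "chart (tangent_bundle N) \<alpha> ` (cdom (tangent_bundle N) \<alpha> \<inter> cdom (tangent_bundle N) \<beta>) =
    tdom (overlap \<alpha> \<beta>) (model N)" (is "?L = ?R")
proof
  show "?L \<subseteq> ?R"
  proof (rule image_subsetI)
    fix \<xi> assume \<xi>: "\<xi> \<in> cdom (tangent_bundle N) \<alpha> \<inter> cdom (tangent_bundle N) \<beta>"
    then obtain p v where p: "\<xi> = tv p \<alpha> v" "p \<in> cdom N \<alpha>" "v \<in> model N"
      using assms(1) by (auto elim: cdom_TE)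
    then have "p \<in> cdom N \<beta>"
      using \<xi> cdom_T_iff[OF assms(2)] by simp
    then show "chart (tangent_bundle N) \<alpha> \<xi> \<in> ?R"
      using p assms(1) by (simp add: chart_T_self)
  qed
  show "?R \<subseteq> ?L"
  proof
    fix z assume "z \<in> ?R"
    then obtain p where p: "p \<in> cdom N \<alpha>" "p \<in> cdom N \<beta>" "vfst z = chart N \<alpha> p" "vsnd z \<in> model N"
      by auto
    let ?\<xi> = "tv p \<alpha> (vsnd z)"
    have "?\<xi> \<in> cdom (tangent_bundle N) \<alpha>"
      using assms p by (intro tv_in_cdom_T)
    moreover from this have "?\<xi> \<in> cdom (tangent_bundle N) \<beta>"
      using p cdom_T_iff[OF assms(1)] cdom_T_iff[OF assms(2)] by simp
    moreover have "z = chart (tangent_bundle N) \<alpha> ?\<xi>"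
      using assms p by (simp add: chart_T_self flip: p(3))
    ultimately show "z \<in> ?L"
      by blast
  qed
qed

lemma chart_T_image: "\<alpha> \<in> idx N \<Longrightarrow>
    chart (tangent_bundle N) \<alpha> ` cdom (tangent_bundle N) \<alpha> = tdom (chart N \<alpha> ` cdom N \<alpha>) (model N)"
  using overlap_T[of \<alpha> \<alpha>] by simp

text \<open>Coordinate changes of the tangent bundle are the tangent maps of those of
  \<open>N\<close>. Smoothness of its atlas thereby reduces to
  \<open>smooth_on_tfun\<close>.\<close>

lemma trans_T:
  assumes "\<alpha> \<in> idx N" "\<beta> \<in> idx N" "z \<in> tdom (overlap \<alpha> \<beta>) (model N)"
  shows "chart (tangent_bundle N) \<beta> (chart_inv (tangent_bundle N) \<alpha> z) = tfun (trans \<alpha> \<beta>) z"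
proof -
  obtain p where p: "p \<in> cdom N \<alpha>" "p \<in> cdom N \<beta>" "vfst z = chart N \<alpha> p"
    using assms(3) by auto
  have "chart_inv (tangent_bundle N) \<alpha> z = tv p \<alpha> (vsnd z)"
    using assms p chart_inv_chart by (subst chart_inv_T) auto
  then show ?thesis
    using assms p by (simp only: chart_T tfun_def) (simp add: chart_inv_chart)
qed

lemma vmanifold_T: "vmanifold (tangent_bundle N)"
proof
  have md: "model_domain (tdom (model N) (model N)) (tdom (overlap \<alpha> \<beta>) (model N))"
    if "\<alpha> \<in> idx N" "\<beta> \<in> idx N" for \<alpha> \<beta>
    by (rule model_domain_tdom[OF model_domain_overlap[OF that]])
  have sm: "smooth_on (tdom (model N) (model N)) (tdom (overlap \<alpha> \<beta>) (model N))
      (chart (tangent_bundle N) \<beta> \<circ> chart_inv (tangent_bundle N) \<alpha>)"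
    if "\<alpha> \<in> idx N" "\<beta> \<in> idx N" for \<alpha> \<beta>
    by (rule smooth_on_cong[OF model_domain_radially_open[OF md[OF that]] _
          smooth_on_tfun[OF model_domain_overlap[OF that] smooth_trans[OF that]]])
      (simp add: trans_T that)
  show "is_atlas (tangent_bundle N)"
    unfolding is_atlas_def idx_T model_T
  proof (intro conjI ballI)
    show "pts (tangent_bundle N) = (\<Union>\<alpha>\<in>idx N. cdom (tangent_bundle N) \<alpha>)"
      by (rule pts_T)
    fix \<alpha> assume \<alpha>: "\<alpha> \<in> idx N"
    then show "inj_on (chart (tangent_bundle N) \<alpha>) (cdom (tangent_bundle N) \<alpha>)"
      by (rule inj_chart_T)
    show "openin (top_of_set (tdom (model N) (model N)))
        (chart (tangent_bundle N) \<alpha> ` cdom (tangent_bundle N) \<alpha>)"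
      using md[OF \<alpha> \<alpha>] by (simp add: model_domain_def chart_T_image[OF \<alpha>])
    fix \<beta> assume \<beta>: "\<beta> \<in> idx N"
    show "openin (top_of_set (tdom (model N) (model N)))
        (chart (tangent_bundle N) \<alpha> ` (cdom (tangent_bundle N) \<alpha> \<inter> cdom (tangent_bundle N) \<beta>))"
      using md[OF \<alpha> \<beta>] by (simp add: model_domain_def overlap_T[OF \<alpha> \<beta>])
    show "smooth_on (tdom (model N) (model N))
        (chart (tangent_bundle N) \<alpha> ` (cdom (tangent_bundle N) \<alpha> \<inter> cdom (tangent_bundle N) \<beta>))
        (chart (tangent_bundle N) \<beta> \<circ> chart_inv (tangent_bundle N) \<alpha>)"
      unfolding overlap_T[OF \<alpha> \<beta>] by (rule sm[OF \<alpha> \<beta>])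
  qed
  have "model_domain (model N) (model N)"
    using subspace_model closed_model by (simp add: model_domain_def)
  then have "model_domain (tdom (model N) (model N)) (tdom (model N) (model N))"
    by (rule model_domain_tdom)
  then show "subspace (model (tangent_bundle N))" "closed (model (tangent_bundle N))"
    by (simp_all add: model_T model_domain_def)
qed

end

subsection \<open>Smooth maps and their tangent maps\<close>

abbreviation rep_dom where
  "rep_dom N N' f \<alpha> \<beta> \<equiv> chart N \<alpha> ` (cdom N \<alpha> \<inter> f -` cdom N' \<beta>)"

lemma smooth_map_pts: "smooth_map N N' f \<Longrightarrow> p \<in> pts N \<Longrightarrow> f p \<in> pts N'"
  by (auto simp: smooth_map_def)

lemma smooth_map_rep:
  assumes "vmanifold N" "smooth_map N N' f" "\<alpha> \<in> idx N" "\<beta> \<in> idx N'"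
  shows "model_domain (model N) (rep_dom N N' f \<alpha> \<beta>)"
    and "smooth_on (model N) (rep_dom N N' f \<alpha> \<beta>) (local_rep N N' f \<alpha> \<beta>)"
  using assms by (auto simp: smooth_map_def vmanifold_def model_domain_def Let_def)

lemma smooth_mapI:
  assumes "\<And>p. p \<in> pts N \<Longrightarrow> f p \<in> pts N'"
    and "\<And>\<alpha> \<beta>. \<alpha> \<in> idx N \<Longrightarrow> \<beta> \<in> idx N' \<Longrightarrow> openin (top_of_set (model N)) (rep_dom N N' f \<alpha> \<beta>)"
    and "\<And>\<alpha> \<beta>. \<alpha> \<in> idx N \<Longrightarrow> \<beta> \<in> idx N' \<Longrightarrow>
      smooth_on (model N) (rep_dom N N' f \<alpha> \<beta>) (local_rep N N' f \<alpha> \<beta>)"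
  shows "smooth_map N N' f"
  using assms by (auto simp: smooth_map_def Let_def)

lemma local_rep_chart:
  "vmanifold N \<Longrightarrow> \<alpha> \<in> idx N \<Longrightarrow> p \<in> cdom N \<alpha> \<Longrightarrow> local_rep N N' f \<alpha> \<beta> (chart N \<alpha> p) = chart N' \<beta> (f p)"
  by (simp add: local_rep_def vmanifold.chart_inv_chart)

lemma local_rep_image:
  assumes "vmanifold N" "\<alpha> \<in> idx N"
  shows "local_rep N N' f \<alpha> \<beta> ` rep_dom N N' f \<alpha> \<beta> \<subseteq> chart N' \<beta> ` cdom N' \<beta>"
  using assms by (auto simp: local_rep_chart)

lemma local_rep_in_model:
  assumes "vmanifold N" "vmanifold N'" "\<alpha> \<in> idx N" "\<beta> \<in> idx N'"
  shows "local_rep N N' f \<alpha> \<beta> ` rep_dom N N' f \<alpha> \<beta> \<subseteq> model N'"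
  using local_rep_image[OF assms(1,3)]
    model_domain_subset[OF vmanifold.model_domain_chart[OF assms(2,4)]] by (rule order_trans)

lemma dir_deriv_local_rep_in_model:
  assumes "vmanifold N" "vmanifold N'" "smooth_map N N' f" "\<alpha> \<in> idx N" "\<beta> \<in> idx N'"
    and "p \<in> cdom N \<alpha>" "f p \<in> cdom N' \<beta>" "v \<in> model N"
  shows "dir_deriv (local_rep N N' f \<alpha> \<beta>) (chart N \<alpha> p) v \<in> model N'"
proof (rule dir_deriv_in_model[OF smooth_map_rep[OF assms(1,3,4,5)]])
  show "model_domain (model N') (model N')"
    using assms(2) by (simp add: vmanifold_def model_domain_def)
  show "local_rep N N' f \<alpha> \<beta> ` rep_dom N N' f \<alpha> \<beta> \<subseteq> model N'"
    by (rule local_rep_in_model[OF assms(1,2,4,5)])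
qed (use assms in auto)

lemma rep_dom_pts_cong:
  assumes "vmanifold N" "\<And>p. p \<in> pts N \<Longrightarrow> f p = g p" "\<alpha> \<in> idx N"
  shows "rep_dom N N' f \<alpha> \<beta> = rep_dom N N' g \<alpha> \<beta>"
proof -
  have "cdom N \<alpha> \<subseteq> pts N"
    using vmanifold.pts_eq[OF assms(1)] assms(3) by blast
  then have "cdom N \<alpha> \<inter> f -` cdom N' \<beta> = cdom N \<alpha> \<inter> g -` cdom N' \<beta>"
    using assms(2) by auto
  then show ?thesis
    by simp
qed

lemma local_rep_pts_cong:
  assumes "vmanifold N" "\<And>p. p \<in> pts N \<Longrightarrow> f p = g p" "\<alpha> \<in> idx N" "z \<in> chart N \<alpha> ` cdom N \<alpha>"
  shows "local_rep N N' f \<alpha> \<beta> z = local_rep N N' g \<alpha> \<beta> z"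
proof -
  obtain p where p: "p \<in> cdom N \<alpha>" "z = chart N \<alpha> p"
    using assms(4) by blast
  then have "p \<in> pts N"
    using vmanifold.pts_eq[OF assms(1)] assms(3) by blast
  then show ?thesis
    unfolding p(2) local_rep_chart[OF assms(1,3) p(1)] using assms(2) by simp
qed

lemma smooth_map_cong:
  assumes "vmanifold N" "\<And>p. p \<in> pts N \<Longrightarrow> f p = g p" "smooth_map N N' f"
  shows "smooth_map N N' g"
proof (rule smooth_mapI)
  show "g p \<in> pts N'" if "p \<in> pts N" for p
    using smooth_map_pts[OF assms(3) that] assms(2)[OF that] by simp
  fix \<alpha> \<beta> assume ab: "\<alpha> \<in> idx N" "\<beta> \<in> idx N'"
  note rep = smooth_map_rep[OF assms(1,3) ab]
  show "openin (top_of_set (model N)) (rep_dom N N' g \<alpha> \<beta>)"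
    using rep(1) rep_dom_pts_cong[OF assms(1,2) ab(1), where N' = N' and \<beta> = \<beta>]
    by (simp add: model_domain_def)
  have "smooth_on (model N) (rep_dom N N' f \<alpha> \<beta>) (local_rep N N' g \<alpha> \<beta>)"
    by (rule smooth_on_cong[OF model_domain_radially_open[OF rep(1)] local_rep_pts_cong[OF assms(1,2) ab(1)] rep(2)])
      auto
  then show "smooth_on (model N) (rep_dom N N' g \<alpha> \<beta>) (local_rep N N' g \<alpha> \<beta>)"
    using rep_dom_pts_cong[OF assms(1,2) ab(1), where N' = N' and \<beta> = \<beta>] by simp
qed

text \<open>\<open>W\<close> is the part of the domain where the intermediate value lies in the
  chart \<beta>. It may be smaller than the domain of the composite representative, but it contains
  every point at which \<beta> is a suitable choice.\<close>

lemma local_rep_compose: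
  assumes vm: "vmanifold N" "vmanifold N'" and sm: "smooth_map N N' f" "smooth_map N' N'' g"
    and idx: "\<alpha> \<in> idx N" "\<beta> \<in> idx N'" "\<gamma> \<in> idx N''"
  defines "W \<equiv> rep_dom N N' f \<alpha> \<beta> \<inter> local_rep N N' f \<alpha> \<beta> -` rep_dom N' N'' g \<beta> \<gamma>"
  shows "model_domain (model N) W" "W \<subseteq> rep_dom N N'' (g \<circ> f) \<alpha> \<gamma>"
    and "\<And>z. z \<in> W \<Longrightarrow> local_rep N N'' (g \<circ> f) \<alpha> \<gamma> z = local_rep N' N'' g \<beta> \<gamma> (local_rep N N' f \<alpha> \<beta> z)"
    and "\<And>p. p \<in> cdom N \<alpha> \<Longrightarrow> f p \<in> cdom N' \<beta> \<Longrightarrow> g (f p) \<in> cdom N'' \<gamma> \<Longrightarrow> chart N \<alpha> p \<in> W"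
proof -
  note f = smooth_map_rep[OF vm(1) sm(1) idx(1,2)] and g = smooth_map_rep[OF vm(2) sm(2) idx(2,3)]
  show "model_domain (model N) W"
    unfolding W_def by (rule model_domain_vimage[OF f g(1) local_rep_in_model[OF vm idx(1,2)]])
  have W: "\<exists>q. z = chart N \<alpha> q \<and> q \<in> cdom N \<alpha> \<and> f q \<in> cdom N' \<beta> \<and> g (f q) \<in> cdom N'' \<gamma>" if zW: "z \<in> W" for z
  proof -
    obtain q where q: "z = chart N \<alpha> q" "q \<in> cdom N \<alpha>" "f q \<in> cdom N' \<beta>"
      using zW unfolding W_def by blast
    moreover have "local_rep N N' f \<alpha> \<beta> z \<in> rep_dom N' N'' g \<beta> \<gamma>"
      using zW unfolding W_def by blast
    ultimately obtain r where "chart N' \<beta> (f q) = chart N' \<beta> r" "r \<in> cdom N' \<beta>" "g r \<in> cdom N'' \<gamma>"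
      by (auto simp: local_rep_chart[OF vm(1) idx(1)])
    \<comment> \<open>Membership in the second domain is known only through a \<beta>-coordinate;
      injectivity of \<beta> identifies the point behind it.\<close>
    moreover from this have "f q = r"
      using inj_onD[OF vmanifold.inj_chart[OF vm(2) idx(2)]] q(3) by blast
    ultimately show ?thesis
      using q by blast
  qed
  then show "W \<subseteq> rep_dom N N'' (g \<circ> f) \<alpha> \<gamma>"
    by fastforce
  show "local_rep N N'' (g \<circ> f) \<alpha> \<gamma> z = local_rep N' N'' g \<beta> \<gamma> (local_rep N N' f \<alpha> \<beta> z)" if "z \<in> W" for z
    using W[OF that] by (auto simp: local_rep_chart[OF vm(1) idx(1)] local_rep_chart[OF vm(2) idx(2)])
  show "chart N \<alpha> p \<in> W" if "p \<in> cdom N \<alpha>" "f p \<in> cdom N' \<beta>" "g (f p) \<in> cdom N'' \<gamma>" for p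
    using that unfolding W_def by (auto simp: local_rep_chart[OF vm(1) idx(1)])
qed

text \<open>A suitable intermediate chart depends on the point, so openness and smoothness are both
  obtained locally and then glued.\<close>

lemma smooth_map_compose:
  assumes vm: "vmanifold N" "vmanifold N'" "vmanifold N''"
    and sm: "smooth_map N N' f" "smooth_map N' N'' g"
  shows "smooth_map N N'' (g \<circ> f)"
proof (rule smooth_mapI)
  show "(g \<circ> f) p \<in> pts N''" if "p \<in> pts N" for p
    using that smooth_map_pts[OF sm(1)] smooth_map_pts[OF sm(2)] by simp
  fix \<alpha> \<gamma> assume ac: "\<alpha> \<in> idx N" "\<gamma> \<in> idx N''"
  let ?V = "rep_dom N N'' (g \<circ> f) \<alpha> \<gamma>"
  have loc: "\<exists>W. openin (top_of_set (model N)) W \<and> x \<in> W \<and> W \<subseteq> ?V \<and>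
      smooth_on (model N) W (local_rep N N'' (g \<circ> f) \<alpha> \<gamma>)" if xV: "x \<in> ?V" for x
  proof -
    obtain p where p: "x = chart N \<alpha> p" "p \<in> cdom N \<alpha>" "g (f p) \<in> cdom N'' \<gamma>"
      using xV by auto
    then have "f p \<in> pts N'"
      using vmanifold.pts_eq[OF vm(1)] ac smooth_map_pts[OF sm(1)] by blast
    then obtain \<beta> where \<beta>: "\<beta> \<in> idx N'" "f p \<in> cdom N' \<beta>"
      using vmanifold.pts_eq[OF vm(2)] by blast
    let ?W = "rep_dom N N' f \<alpha> \<beta> \<inter> local_rep N N' f \<alpha> \<beta> -` rep_dom N' N'' g \<beta> \<gamma>"
    note f = smooth_map_rep[OF vm(1) sm(1) ac(1) \<beta>(1)] and g = smooth_map_rep[OF vm(2) sm(2) \<beta>(1) ac(2)]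
    note W = local_rep_compose[OF vm(1,2) sm ac(1) \<beta>(1) ac(2)]
    have "smooth_on (model N) ?W (local_rep N N' f \<alpha> \<beta>)"
      by (rule smooth_on_subset[OF f(2)]) blast
    then have "smooth_on (model N) ?W (\<lambda>z. local_rep N' N'' g \<beta> \<gamma> (local_rep N N' f \<alpha> \<beta> z))"
      by (rule smooth_on_compose[OF W(1) _ g]) blast
    then have "smooth_on (model N) ?W (local_rep N N'' (g \<circ> f) \<alpha> \<gamma>)"
      by (rule smooth_on_cong[OF model_domain_radially_open[OF W(1)], rotated]) (rule W(3)[symmetric])
    moreover have "x \<in> ?W"
      unfolding p(1) by (rule W(4)[OF p(2) \<beta>(2) p(3)])
    ultimately show ?thesis
      using W(1,2) unfolding model_domain_def by blast
  qed
  show opn: "openin (top_of_set (model N)) ?V"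
    using loc by (subst openin_subopen) blast
  show "smooth_on (model N) ?V (local_rep N N'' (g \<circ> f) \<alpha> \<gamma>)"
  proof (rule smooth_on_local)
    fix x assume "x \<in> ?V"
    then obtain W where W: "openin (top_of_set (model N)) W" "x \<in> W" "W \<subseteq> ?V"
        "smooth_on (model N) W (local_rep N N'' (g \<circ> f) \<alpha> \<gamma>)"
      using loc by blast
    then have "openin (top_of_set ?V) W"
      using openin_subset_trans openin_imp_subset[OF opn] by blast
    then show "\<exists>W. openin (top_of_set ?V) W \<and> x \<in> W \<and> smooth_on (model N) W (local_rep N N'' (g \<circ> f) \<alpha> \<gamma>)"
      using W by blast
  qed
qed

lemma foot_tangent_map [simp]: "foot (tangent_map N N' f \<xi>) = f (foot \<xi>)"
  by (simp add: tangent_map_def)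

text \<open>The transformation law under a change of both charts: two applications of the chain rule
  to the two factorisations of the representative from \<alpha> to \<beta>'. It makes
  \<open>tangent_map\<close> well defined.\<close>

lemma dir_deriv_local_rep_change:
  assumes vm: "vmanifold N" "vmanifold N'" and sm: "smooth_map N N' f"
    and idx: "\<alpha> \<in> idx N" "\<alpha>' \<in> idx N" "\<beta> \<in> idx N'" "\<beta>' \<in> idx N'"
    and p: "p \<in> cdom N \<alpha>" "p \<in> cdom N \<alpha>'" "f p \<in> cdom N' \<beta>" "f p \<in> cdom N' \<beta>'" and v: "v \<in> model N"
  shows "dir_deriv (local_rep N N' f \<alpha>' \<beta>') (chart N \<alpha>' p)
      (dir_deriv (chart N \<alpha>' \<circ> chart_inv N \<alpha>) (chart N \<alpha> p) v) =
    dir_deriv (chart N' \<beta>' \<circ> chart_inv N' \<beta>) (chart N' \<beta> (f p))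
      (dir_deriv (local_rep N N' f \<alpha> \<beta>) (chart N \<alpha> p) v)"
proof -
  interpret N: vmanifold N by fact
  interpret N': vmanifold N' by fact
  note rep = smooth_map_rep[OF vm(1) sm]
  have "dir_deriv (local_rep N N' f \<alpha>' \<beta>') (chart N \<alpha>' p) (dir_deriv (N.trans \<alpha> \<alpha>') (chart N \<alpha> p) v) =
      dir_deriv (\<lambda>z. local_rep N N' f \<alpha>' \<beta>' (N.trans \<alpha> \<alpha>' z)) (chart N \<alpha> p) v"
    by (rule N.dir_deriv_change[symmetric, OF idx(1,2) p(1,2) v rep(1)[OF idx(2,4)] _ rep(2)[OF idx(2,4)]])
      (use p in blast)
  also have "\<dots> = dir_deriv (local_rep N N' f \<alpha> \<beta>') (chart N \<alpha> p) v"
    by (rule dir_deriv_cong[OF model_domain_radially_open[OF N.model_domain_overlap[OF idx(1,2)]]])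
      (use idx p v in \<open>auto simp: local_rep_chart[OF vm(1)] N.chart_inv_chart\<close>)
  also have "\<dots> = dir_deriv (\<lambda>z. N'.trans \<beta> \<beta>' (local_rep N N' f \<alpha> \<beta> z)) (chart N \<alpha> p) v"
    by (rule dir_deriv_cong[OF model_domain_radially_open[OF rep(1)[OF idx(1,3)]]])
      (use idx p v in \<open>auto simp: local_rep_chart[OF vm(1)] N'.chart_inv_chart\<close>)
  also have "\<dots> = dir_deriv (N'.trans \<beta> \<beta>') (chart N' \<beta> (f p)) (dir_deriv (local_rep N N' f \<alpha> \<beta>) (chart N \<alpha> p) v)"
  proof (rule has_dir_deriv_imp)
    \<comment> \<open>The outer coordinate change needs arguments in the overlap of both target
      charts, so the domain is cut to where both representatives exist; injectivity of \<alpha>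
      makes the two conditions speak of one point.\<close>
    let ?W = "rep_dom N N' f \<alpha> \<beta> \<inter> rep_dom N N' f \<alpha> \<beta>'"
    have W: "model_domain (model N) ?W"
      by (rule model_domain_Int[OF rep(1)[OF idx(1,3)] rep(1)[OF idx(1,4)]])
    have fW: "smooth_on (model N) ?W (local_rep N N' f \<alpha> \<beta>)"
      by (rule smooth_on_subset[OF rep(2)[OF idx(1,3)]]) blast
    have "local_rep N N' f \<alpha> \<beta> ` ?W \<subseteq> N'.overlap \<beta> \<beta>'"
    proof (rule image_subsetI)
      fix z assume "z \<in> ?W"
      then obtain q r where "z = chart N \<alpha> q" "q \<in> cdom N \<alpha>" "f q \<in> cdom N' \<beta>"
          "z = chart N \<alpha> r" "r \<in> cdom N \<alpha>" "f r \<in> cdom N' \<beta>'"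
        by blast
      moreover from this have "q = r"
        using inj_onD[OF N.inj_chart[OF idx(1)]] by metis
      ultimately show "local_rep N N' f \<alpha> \<beta> z \<in> N'.overlap \<beta> \<beta>'"
        by (simp add: local_rep_chart[OF vm(1) idx(1)])
    qed
    then have "has_dir_deriv (\<lambda>z. N'.trans \<beta> \<beta>' (local_rep N N' f \<alpha> \<beta> z)) (chart N \<alpha> p) v
        (dir_deriv (N'.trans \<beta> \<beta>') (local_rep N N' f \<alpha> \<beta> (chart N \<alpha> p))
          (dir_deriv (local_rep N N' f \<alpha> \<beta>) (chart N \<alpha> p) v))"
      by (rule dir_deriv_chain(2)[OF W fW
            N'.model_domain_overlap[OF idx(3,4)] N'.smooth_trans[OF idx(3,4)]]) (use p v in auto)
    then show "has_dir_deriv (\<lambda>z. N'.trans \<beta> \<beta>' (local_rep N N' f \<alpha> \<beta> z)) (chart N \<alpha> p) v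
        (dir_deriv (N'.trans \<beta> \<beta>') (chart N' \<beta> (f p)) (dir_deriv (local_rep N N' f \<alpha> \<beta>) (chart N \<alpha> p) v))"
      unfolding local_rep_chart[OF vm(1) idx(1) p(1)] .
  qed
  finally show ?thesis .
qed

text \<open>The class defining \<open>tangent_map\<close> ranges over all representatives of the
  argument. By the transformation law each contributes the same vector in a given target chart, so a
  single representative computes the value.\<close>

lemma tangent_map_tv:
  assumes vm: "vmanifold N" "vmanifold N'" and sm: "smooth_map N N' f"
    and idx: "\<alpha> \<in> idx N" "\<beta> \<in> idx N'" and p: "p \<in> cdom N \<alpha>" "f p \<in> cdom N' \<beta>" and v: "v \<in> model N"
  shows "tangent_map N N' f (vmanifold.tv N p \<alpha> v) =
    vmanifold.tv N' (f p) \<beta> (dir_deriv (local_rep N N' f \<alpha> \<beta>) (chart N \<alpha> p) v)"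
proof -
  interpret N: vmanifold N by fact
  interpret N': vmanifold N' by fact
  have "(\<exists>\<alpha>' v'. (\<alpha>', v') \<in> cls (N.tv p \<alpha> v) \<and> w = dir_deriv (local_rep N N' f \<alpha>' \<beta>') (chart N \<alpha>' p) v') \<longleftrightarrow>
      w = dir_deriv (N'.trans \<beta> \<beta>') (chart N' \<beta> (f p)) (dir_deriv (local_rep N N' f \<alpha> \<beta>) (chart N \<alpha> p) v)"
    if \<beta>': "\<beta>' \<in> idx N'" "f p \<in> cdom N' \<beta>'" for \<beta>' w
  proof -
    have "dir_deriv (local_rep N N' f \<alpha>' \<beta>') (chart N \<alpha>' p) v' =
        dir_deriv (N'.trans \<beta> \<beta>') (chart N' \<beta> (f p)) (dir_deriv (local_rep N N' f \<alpha> \<beta>) (chart N \<alpha> p) v)"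
      if "(\<alpha>', v') \<in> cls (N.tv p \<alpha> v)" for \<alpha>' v'
      using that dir_deriv_local_rep_change[OF vm sm idx(1) _ idx(2) \<beta>'(1) p(1) _ p(2) \<beta>'(2) v]
      by (simp add: N.cls_tv)
    moreover have "(\<alpha>, dir_deriv (N.trans \<alpha> \<alpha>) (chart N \<alpha> p) v) \<in> cls (N.tv p \<alpha> v)"
      using idx(1) p(1) by (simp add: N.cls_tv)
    ultimately show ?thesis
      by metis
  qed
  then show ?thesis
    unfolding tangent_map_def N'.tv_def tangent_class_def N.foot_tv
    by (intro arg_cong2[where f = Tvec] refl) auto
qed

lemma tangent_map_pts:
  assumes vm: "vmanifold N" "vmanifold N'" and sm: "smooth_map N N' f" and \<xi>: "\<xi> \<in> pts (tangent_bundle N)"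
  shows "tangent_map N N' f \<xi> \<in> pts (tangent_bundle N')"
proof -
  interpret N: vmanifold N by fact
  interpret N': vmanifold N' by fact
  obtain \<alpha> p v where p: "\<alpha> \<in> idx N" "\<xi> = N.tv p \<alpha> v" "p \<in> cdom N \<alpha>" "v \<in> model N"
    using \<xi> by (rule N.pts_TE)
  have "f p \<in> pts N'"
    using smooth_map_pts[OF sm] p N.pts_eq by blast
  then obtain \<beta> where \<beta>: "\<beta> \<in> idx N'" "f p \<in> cdom N' \<beta>"
    using N'.pts_eq by blast
  have "tangent_map N N' f \<xi> = N'.tv (f p) \<beta> (dir_deriv (local_rep N N' f \<alpha> \<beta>) (chart N \<alpha> p) v)"
    unfolding p(2) by (rule tangent_map_tv[OF vm sm p(1) \<beta>(1) p(3) \<beta>(2) p(4)])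
  moreover have "\<dots> \<in> cdom (tangent_bundle N') \<beta>"
    by (rule N'.tv_in_cdom_T[OF \<beta> dir_deriv_local_rep_in_model[OF vm sm p(1) \<beta>(1) p(3) \<beta>(2) p(4)]])
  ultimately show ?thesis
    using \<beta>(1) N'.pts_T by auto
qed

lemma chart_tangent_map:
  assumes vm: "vmanifold N" "vmanifold N'" and sm: "smooth_map N N' f" and idx: "\<alpha> \<in> idx N" "\<beta> \<in> idx N'"
    and \<xi>: "\<xi> \<in> cdom (tangent_bundle N) \<alpha>" "f (foot \<xi>) \<in> cdom N' \<beta>"
  shows "chart (tangent_bundle N') \<beta> (tangent_map N N' f \<xi>) =
    tfun (local_rep N N' f \<alpha> \<beta>) (chart (tangent_bundle N) \<alpha> \<xi>)"
proof -
  interpret N: vmanifold N by fact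
  interpret N': vmanifold N' by fact
  obtain p v where p: "\<xi> = N.tv p \<alpha> v" "p \<in> cdom N \<alpha>" "v \<in> model N"
    using idx(1) \<xi>(1) by (rule N.cdom_TE)
  then have fp: "f p \<in> cdom N' \<beta>"
    using \<xi>(2) by simp
  have "chart (tangent_bundle N') \<beta> (tangent_map N N' f \<xi>) =
      vpair (chart N' \<beta> (f p)) (dir_deriv (local_rep N N' f \<alpha> \<beta>) (chart N \<alpha> p) v)"
    unfolding p(1) tangent_map_tv[OF vm sm idx p(2) fp p(3)]
    by (rule N'.chart_T_self[OF idx(2) fp dir_deriv_local_rep_in_model[OF vm sm idx p(2) fp p(3)]])
  then show ?thesis
    using p idx by (simp add: N.chart_T_self tfun_def local_rep_chart[OF vm(1)])
qed

lemma tangent_map_rep_dom: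
  assumes vm: "vmanifold N" "vmanifold N'" and sm: "smooth_map N N' f" and idx: "\<alpha> \<in> idx N" "\<beta> \<in> idx N'"
  shows "rep_dom (tangent_bundle N) (tangent_bundle N') (tangent_map N N' f) \<alpha> \<beta> =
    tdom (rep_dom N N' f \<alpha> \<beta>) (model N)" (is "?L = ?R")
proof -
  interpret N: vmanifold N by fact
  interpret N': vmanifold N' by fact
  have eq: "cdom (tangent_bundle N) \<alpha> \<inter> tangent_map N N' f -` cdom (tangent_bundle N') \<beta> =
      {N.tv p \<alpha> v | p v. p \<in> cdom N \<alpha> \<inter> f -` cdom N' \<beta> \<and> v \<in> model N}"
  proof (rule set_eqI)
    fix \<xi>
    have "tangent_map N N' f \<xi> \<in> cdom (tangent_bundle N') \<beta> \<longleftrightarrow> f (foot \<xi>) \<in> cdom N' \<beta>"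
      if "\<xi> \<in> cdom (tangent_bundle N) \<alpha>"
      using tangent_map_pts[OF vm sm] that N.cdom_T_iff[OF idx(1)] N'.cdom_T_iff[OF idx(2)] by simp
    then have "\<xi> \<in> cdom (tangent_bundle N) \<alpha> \<inter> tangent_map N N' f -` cdom (tangent_bundle N') \<beta> \<longleftrightarrow>
        \<xi> \<in> cdom (tangent_bundle N) \<alpha> \<and> f (foot \<xi>) \<in> cdom N' \<beta>"
      by blast
    also have "\<dots> \<longleftrightarrow> \<xi> \<in> {N.tv p \<alpha> v | p v. p \<in> cdom N \<alpha> \<inter> f -` cdom N' \<beta> \<and> v \<in> model N}"
      unfolding N.cdom_T[OF idx(1)] by auto blast
    finally show "\<xi> \<in> cdom (tangent_bundle N) \<alpha> \<inter> tangent_map N N' f -` cdom (tangent_bundle N') \<beta> \<longleftrightarrow>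
        \<xi> \<in> {N.tv p \<alpha> v | p v. p \<in> cdom N \<alpha> \<inter> f -` cdom N' \<beta> \<and> v \<in> model N}" .
  qed
  show ?thesis
    unfolding eq
  proof
    show "chart (tangent_bundle N) \<alpha> ` {N.tv p \<alpha> v | p v. p \<in> cdom N \<alpha> \<inter> f -` cdom N' \<beta> \<and> v \<in> model N} \<subseteq> ?R"
      using idx by (auto simp: N.chart_T_self)
    show "?R \<subseteq> chart (tangent_bundle N) \<alpha> ` {N.tv p \<alpha> v | p v. p \<in> cdom N \<alpha> \<inter> f -` cdom N' \<beta> \<and> v \<in> model N}"
    proof
      fix z assume "z \<in> ?R"
      then obtain p where p: "vfst z = chart N \<alpha> p" "p \<in> cdom N \<alpha>" "f p \<in> cdom N' \<beta>" "vsnd z \<in> model N"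
        by auto
      then have "z = chart (tangent_bundle N) \<alpha> (N.tv p \<alpha> (vsnd z))"
        using idx by (simp add: N.chart_T_self flip: p(1))
      then show "z \<in> chart (tangent_bundle N) \<alpha> ` {N.tv p \<alpha> v | p v. p \<in> cdom N \<alpha> \<inter> f -` cdom N' \<beta> \<and> v \<in> model N}"
        using p by blast
    qed
  qed
qed

lemma smooth_map_tangent_map:
  assumes vm: "vmanifold N" "vmanifold N'" and sm: "smooth_map N N' f"
  shows "smooth_map (tangent_bundle N) (tangent_bundle N') (tangent_map N N' f)"
proof (rule smooth_mapI)
  interpret N: vmanifold N by fact
  interpret N': vmanifold N' by fact
  interpret TN: vmanifold "tangent_bundle N" by (rule N.vmanifold_T)
  show "tangent_map N N' f \<xi> \<in> pts (tangent_bundle N')" if "\<xi> \<in> pts (tangent_bundle N)" for \<xi>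
    by (rule tangent_map_pts[OF vm sm that])
  fix \<alpha> \<beta> assume "\<alpha> \<in> idx (tangent_bundle N)" "\<beta> \<in> idx (tangent_bundle N')"
  then have idx: "\<alpha> \<in> idx N" "\<beta> \<in> idx N'"
    by simp_all
  note rep = smooth_map_rep[OF vm(1) sm idx]
  note md = model_domain_tdom[OF rep(1)]
  show "openin (top_of_set (model (tangent_bundle N)))
      (rep_dom (tangent_bundle N) (tangent_bundle N') (tangent_map N N' f) \<alpha> \<beta>)"
    unfolding tangent_map_rep_dom[OF vm sm idx] N.model_T using md by (simp add: model_domain_def)
  show "smooth_on (model (tangent_bundle N))
      (rep_dom (tangent_bundle N) (tangent_bundle N') (tangent_map N N' f) \<alpha> \<beta>)
      (local_rep (tangent_bundle N) (tangent_bundle N') (tangent_map N N' f) \<alpha> \<beta>)"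
    unfolding N.model_T
  proof (rule smooth_on_cong)
    show "smooth_on (tdom (model N) (model N))
        (rep_dom (tangent_bundle N) (tangent_bundle N') (tangent_map N N' f) \<alpha> \<beta>) (tfun (local_rep N N' f \<alpha> \<beta>))"
      unfolding tangent_map_rep_dom[OF vm sm idx] by (rule smooth_on_tfun[OF rep])
    show "radially_open (tdom (model N) (model N))
        (rep_dom (tangent_bundle N) (tangent_bundle N') (tangent_map N N' f) \<alpha> \<beta>)"
      unfolding tangent_map_rep_dom[OF vm sm idx] by (rule model_domain_radially_open[OF md])
    fix z assume "z \<in> rep_dom (tangent_bundle N) (tangent_bundle N') (tangent_map N N' f) \<alpha> \<beta>"
    then obtain \<xi> where \<xi>: "z = chart (tangent_bundle N) \<alpha> \<xi>" "\<xi> \<in> cdom (tangent_bundle N) \<alpha>"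
        "tangent_map N N' f \<xi> \<in> cdom (tangent_bundle N') \<beta>"
      by blast
    then have "f (foot \<xi>) \<in> cdom N' \<beta>"
      using N'.cdom_T_iff[OF idx(2)] by simp
    then show "tfun (local_rep N N' f \<alpha> \<beta>) z =
        local_rep (tangent_bundle N) (tangent_bundle N') (tangent_map N N' f) \<alpha> \<beta> z"
      using chart_tangent_map[OF vm sm idx \<xi>(2)] \<xi> idx(1)
      by (simp add: local_rep_chart[OF N.vmanifold_T])
  qed
qed

lemma tangent_eqI:
  assumes vm: "vmanifold N" and \<alpha>: "\<alpha> \<in> idx N"
    and "\<xi> \<in> cdom (tangent_bundle N) \<alpha>" "\<eta> \<in> cdom (tangent_bundle N) \<alpha>"
    and "chart (tangent_bundle N) \<alpha> \<xi> = chart (tangent_bundle N) \<alpha> \<eta>"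
  shows "\<xi> = \<eta>"
  using inj_onD[OF vmanifold.inj_chart_T[OF vm \<alpha>] assms(5,3,4)] .

lemma tangent_map_compose:
  assumes vm: "vmanifold N" "vmanifold N'" "vmanifold N''" and sm: "smooth_map N N' f" "smooth_map N' N'' g"
    and \<xi>: "\<xi> \<in> pts (tangent_bundle N)"
  shows "tangent_map N N'' (g \<circ> f) \<xi> = tangent_map N' N'' g (tangent_map N N' f \<xi>)"
proof -
  interpret N: vmanifold N by fact
  interpret N': vmanifold N' by fact
  interpret N'': vmanifold N'' by fact
  obtain \<alpha> p v where p: "\<alpha> \<in> idx N" "\<xi> = N.tv p \<alpha> v" "p \<in> cdom N \<alpha>" "v \<in> model N"
    using \<xi> by (rule N.pts_TE)
  have "f p \<in> pts N'"
    using smooth_map_pts[OF sm(1)] p N.pts_eq by blast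
  then obtain \<beta> where \<beta>: "\<beta> \<in> idx N'" "f p \<in> cdom N' \<beta>"
    using N'.pts_eq by blast
  have "g (f p) \<in> pts N''"
    using smooth_map_pts[OF sm(2)] \<open>f p \<in> pts N'\<close> .
  then obtain \<gamma> where \<gamma>: "\<gamma> \<in> idx N''" "g (f p) \<in> cdom N'' \<gamma>"
    using N''.pts_eq by blast
  note W = local_rep_compose[OF vm(1,2) sm p(1) \<beta>(1) \<gamma>(1)]
  note f = smooth_map_rep[OF vm(1) sm(1) p(1) \<beta>(1)] and g = smooth_map_rep[OF vm(2) sm(2) \<beta>(1) \<gamma>(1)]
  have x: "chart N \<alpha> p \<in> rep_dom N N' f \<alpha> \<beta> \<inter> local_rep N N' f \<alpha> \<beta> -` rep_dom N' N'' g \<beta> \<gamma>"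
    by (rule W(4)[OF p(3) \<beta>(2) \<gamma>(2)])
  have "tangent_map N N'' (g \<circ> f) \<xi> =
      N''.tv (g (f p)) \<gamma> (dir_deriv (local_rep N N'' (g \<circ> f) \<alpha> \<gamma>) (chart N \<alpha> p) v)"
    using tangent_map_tv[OF vm(1,3) smooth_map_compose[OF vm sm] p(1) \<gamma>(1) p(3) _ p(4)] \<gamma>(2) p(2) by simp
  also have "dir_deriv (local_rep N N'' (g \<circ> f) \<alpha> \<gamma>) (chart N \<alpha> p) v =
      dir_deriv (\<lambda>z. local_rep N' N'' g \<beta> \<gamma> (local_rep N N' f \<alpha> \<beta> z)) (chart N \<alpha> p) v"
    by (rule dir_deriv_cong[OF model_domain_radially_open[OF W(1)] x p(4) W(3)])
  also have "\<dots> = dir_deriv (local_rep N' N'' g \<beta> \<gamma>) (local_rep N N' f \<alpha> \<beta> (chart N \<alpha> p))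
      (dir_deriv (local_rep N N' f \<alpha> \<beta>) (chart N \<alpha> p) v)"
  proof (rule has_dir_deriv_imp, rule dir_deriv_chain(2)[OF W(1) _ g _ x p(4)])
    show "smooth_on (model N) (rep_dom N N' f \<alpha> \<beta> \<inter> local_rep N N' f \<alpha> \<beta> -` rep_dom N' N'' g \<beta> \<gamma>)
        (local_rep N N' f \<alpha> \<beta>)"
      by (rule smooth_on_subset[OF f(2)]) blast
  qed blast
  also have "N''.tv (g (f p)) \<gamma> \<dots> = tangent_map N' N'' g (tangent_map N N' f \<xi>)"
    unfolding p(2) tangent_map_tv[OF vm(1,2) sm(1) p(1) \<beta>(1) p(3) \<beta>(2) p(4)]
      tangent_map_tv[OF vm(2,3) sm(2) \<beta>(1) \<gamma>(1) \<beta>(2) \<gamma>(2)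
        dir_deriv_local_rep_in_model[OF vm(1,2) sm(1) p(1) \<beta>(1) p(3) \<beta>(2) p(4)]]
      local_rep_chart[OF vm(1) p(1,3)] ..
  finally show ?thesis .
qed

text \<open>Identities such as \<open>\<pi> \<circ> \<kappa> = D\<pi>\<close> are available on
  \<open>pts\<close> only; this lemma allows them to be differentiated all the same.\<close>

lemma tangent_map_cong:
  assumes vm: "vmanifold N" "vmanifold N'" and sm: "smooth_map N N' f"
    and eq: "\<And>p. p \<in> pts N \<Longrightarrow> f p = g p" and \<xi>: "\<xi> \<in> pts (tangent_bundle N)"
  shows "tangent_map N N' f \<xi> = tangent_map N N' g \<xi>"
proof -
  interpret N: vmanifold N by fact
  interpret N': vmanifold N' by fact
  obtain \<alpha> p v where p: "\<alpha> \<in> idx N" "\<xi> = N.tv p \<alpha> v" "p \<in> cdom N \<alpha>" "v \<in> model N"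
    using \<xi> by (rule N.pts_TE)
  have pN: "p \<in> pts N"
    using p N.pts_eq by blast
  then obtain \<beta> where \<beta>: "\<beta> \<in> idx N'" "f p \<in> cdom N' \<beta>"
    using N'.pts_eq smooth_map_pts[OF sm] by blast
  have "dir_deriv (local_rep N N' f \<alpha> \<beta>) (chart N \<alpha> p) v = dir_deriv (local_rep N N' g \<alpha> \<beta>) (chart N \<alpha> p) v"
    by (rule dir_deriv_cong[OF model_domain_radially_open[OF N.model_domain_chart[OF p(1)]] _ p(4)
          local_rep_pts_cong[OF vm(1) eq p(1)]]) (use p in auto)
  moreover have "smooth_map N N' g"
    by (rule smooth_map_cong[OF vm(1) eq sm])
  then have "tangent_map N N' g (N.tv p \<alpha> v) =
      N'.tv (g p) \<beta> (dir_deriv (local_rep N N' g \<alpha> \<beta>) (chart N \<alpha> p) v)"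
    by (rule tangent_map_tv[OF vm _ p(1) \<beta>(1) p(3) _ p(4)]) (use \<beta>(2) eq[OF pN] in simp)
  ultimately show ?thesis
    unfolding p(2) tangent_map_tv[OF vm sm p(1) \<beta>(1) p(3) \<beta>(2) p(4)]
    using eq[OF pN] by simp
qed

section \<open>The identity and the bundle projection\<close>

lemma smooth_map_ident:
  assumes "vmanifold N"
  shows "smooth_map N N (\<lambda>p. p)"
proof (rule smooth_mapI)
  interpret vmanifold N by fact
  fix \<alpha> \<beta> assume idx: "\<alpha> \<in> idx N" "\<beta> \<in> idx N"
  have eq: "rep_dom N N (\<lambda>p. p) \<alpha> \<beta> = overlap \<alpha> \<beta>"
    by auto
  have "local_rep N N (\<lambda>p. p) \<alpha> \<beta> = trans \<alpha> \<beta>"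
    by (auto simp: local_rep_def)
  then show "smooth_on (model N) (rep_dom N N (\<lambda>p. p) \<alpha> \<beta>) (local_rep N N (\<lambda>p. p) \<alpha> \<beta>)"
    unfolding eq using smooth_trans[OF idx] by simp
  show "openin (top_of_set (model N)) (rep_dom N N (\<lambda>p. p) \<alpha> \<beta>)"
    unfolding eq using model_domain_overlap[OF idx] by (simp add: model_domain_def)
qed

lemma tangent_map_ident:
  assumes vm: "vmanifold N" and \<xi>: "\<xi> \<in> pts (tangent_bundle N)"
  shows "tangent_map N N (\<lambda>p. p) \<xi> = \<xi>"
proof -
  interpret vmanifold N by fact
  obtain \<alpha> p v where p: "\<alpha> \<in> idx N" "\<xi> = tv p \<alpha> v" "p \<in> cdom N \<alpha>" "v \<in> model N"
    using \<xi> by (rule pts_TE)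
  have "local_rep N N (\<lambda>p. p) \<alpha> \<alpha> = trans \<alpha> \<alpha>"
    by (auto simp: local_rep_def)
  then show ?thesis
    unfolding p(2) tangent_map_tv[OF vm vm smooth_map_ident[OF vm] p(1,1,3,3,4)]
    using dir_deriv_trans_self[OF p(1,3,4)] by simp
qed

lemma local_rep_foot:
  assumes vm: "vmanifold N" and idx: "\<alpha> \<in> idx N" and z: "z \<in> tdom (chart N \<alpha> ` cdom N \<alpha>) (model N)"
  shows "local_rep (tangent_bundle N) N foot \<alpha> \<beta> z = chart N \<beta> (chart_inv N \<alpha> (vfst z))"
  using vmanifold.chart_inv_T[OF vm idx z] by (simp add: local_rep_def vmanifold.foot_tv[OF vm])

lemma rep_dom_foot:
  assumes vm: "vmanifold N" and idx: "\<alpha> \<in> idx N" "\<beta> \<in> idx N"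
  shows "rep_dom (tangent_bundle N) N foot \<alpha> \<beta> = tdom (chart N \<alpha> ` (cdom N \<alpha> \<inter> cdom N \<beta>)) (model N)"
proof -
  interpret vmanifold N by fact
  have "cdom (tangent_bundle N) \<alpha> \<inter> foot -` cdom N \<beta> = cdom (tangent_bundle N) \<alpha> \<inter> cdom (tangent_bundle N) \<beta>"
    using cdom_T_iff[OF idx(1)] cdom_T_iff[OF idx(2)] by blast
  then show ?thesis
    using overlap_T[OF idx] by simp
qed

lemma smooth_vfst: "radially_open S U \<Longrightarrow> smooth_on S U (vfst :: (nat \<Rightarrow> 'a::real_normed_vector) \<Rightarrow> _)"
  by (rule smooth_on_linear) (simp_all add: linear_iff continuous_on_vfst[OF continuous_on_id])

lemma smooth_map_foot:
  assumes vm: "vmanifold N"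
  shows "smooth_map (tangent_bundle N) N foot"
proof (rule smooth_mapI)
  interpret vmanifold N by fact
  show "foot \<xi> \<in> pts N" if "\<xi> \<in> pts (tangent_bundle N)" for \<xi>
    by (rule foot_T[OF that])
  fix \<alpha> \<beta> assume "\<alpha> \<in> idx (tangent_bundle N)" and b: "\<beta> \<in> idx N"
  then have a: "\<alpha> \<in> idx N"
    by simp
  note md = model_domain_tdom[OF model_domain_overlap[OF a b]]
  show "openin (top_of_set (model (tangent_bundle N))) (rep_dom (tangent_bundle N) N foot \<alpha> \<beta>)"
    unfolding rep_dom_foot[OF vm a b] model_T using md by (simp add: model_domain_def)
  have "smooth_on (tdom (model N) (model N)) (tdom (overlap \<alpha> \<beta>) (model N)) (\<lambda>z. trans \<alpha> \<beta> (vfst z))"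
    by (rule smooth_on_compose[OF md smooth_vfst[OF model_domain_radially_open[OF md]]
          model_domain_overlap[OF a b] smooth_trans[OF a b]]) auto
  then show "smooth_on (model (tangent_bundle N)) (rep_dom (tangent_bundle N) N foot \<alpha> \<beta>)
      (local_rep (tangent_bundle N) N foot \<alpha> \<beta>)"
    unfolding rep_dom_foot[OF vm a b] model_T
  proof (rule smooth_on_cong[OF model_domain_radially_open[OF md], rotated])
    fix z assume "z \<in> tdom (overlap \<alpha> \<beta>) (model N)"
    then have "z \<in> tdom (chart N \<alpha> ` cdom N \<alpha>) (model N)"
      by auto
    then show "trans \<alpha> \<beta> (vfst z) = local_rep (tangent_bundle N) N foot \<alpha> \<beta> z"
      using local_rep_foot[OF vm a] by simp
  qed
qed

lemma dir_deriv_vfst: "dir_deriv vfst x v = vfst (v :: nat \<Rightarrow> 'a::real_normed_vector)"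
proof (rule has_dir_deriv_imp)
  have "\<forall>\<^sub>F t in at 0. vfst v = (vfst (x + t *\<^sub>R v) - vfst x) /\<^sub>R t"
    by (simp add: eventually_at_filter)
  then show "has_dir_deriv vfst x v (vfst v)"
    unfolding has_dir_deriv_def by (rule Lim_transform_eventually[OF tendsto_const])
qed

lemma tfun_vfst: "tfun vfst z = vpair (vfst (vfst z)) (vfst (vsnd (z :: nat \<Rightarrow> 'a::real_normed_vector)))"
  by (simp add: tfun_def dir_deriv_vfst)

lemma local_rep_foot_eq_vfst:
  assumes vm: "vmanifold N" and a: "\<alpha> \<in> idx N" and z: "z \<in> tdom (chart N \<alpha> ` cdom N \<alpha>) (model N)"
  shows "local_rep (tangent_bundle N) N foot \<alpha> \<alpha> z = vfst z"
  using local_rep_foot[OF vm a z] z vmanifold.chart_inv_chart[OF vm a] by auto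

text \<open>With the same chart \<alpha> on both sides the projection is \<open>vfst\<close>, so its
  tangent map takes (x, y, X, Y) to (x, X). \<open>vec_tangent vfst\<close> is therefore the right
  connecting map of the limit model.\<close>

lemma chart_tangent_foot:
  assumes vm: "vmanifold N" and a: "\<alpha> \<in> idx N" and \<xi>: "\<xi> \<in> cdom (tangent_bundle (tangent_bundle N)) \<alpha>"
  shows "chart (tangent_bundle N) \<alpha> (tangent_map (tangent_bundle N) N foot \<xi>) =
    tfun vfst (chart (tangent_bundle (tangent_bundle N)) \<alpha> \<xi>)"
proof -
  interpret vmanifold N by fact
  interpret T: vmanifold "tangent_bundle N" by (rule vmanifold_T)
  have fa: "foot \<xi> \<in> cdom (tangent_bundle N) \<alpha>"
    using \<xi> T.cdom_T_iff a by simp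
  then have ffa: "foot (foot \<xi>) \<in> cdom N \<alpha>"
    using cdom_T_iff[OF a] by simp
  note md = model_domain_tdom[OF model_domain_chart[OF a]]
  have "chart (tangent_bundle N) \<alpha> (tangent_map (tangent_bundle N) N foot \<xi>) =
      tfun (local_rep (tangent_bundle N) N foot \<alpha> \<alpha>) (chart (tangent_bundle (tangent_bundle N)) \<alpha> \<xi>)"
    by (rule chart_tangent_map[OF vmanifold_T vm smooth_map_foot[OF vm] _ a \<xi> ffa]) (simp add: a)
  also have "\<dots> = tfun vfst (chart (tangent_bundle (tangent_bundle N)) \<alpha> \<xi>)"
  proof (rule tfun_cong[OF md local_rep_foot_eq_vfst[OF vm a]])
    show "chart (tangent_bundle (tangent_bundle N)) \<alpha> \<xi> \<in>
        tdom (tdom (chart N \<alpha> ` cdom N \<alpha>) (model N)) (tdom (model N) (model N))"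
      using imageI[OF \<xi>, of "chart (tangent_bundle (tangent_bundle N)) \<alpha>"] a
      by (simp only: T.chart_T_image idx_T chart_T_image model_T)
  qed
  finally show ?thesis .
qed

section \<open>The canonical involution\<close>

text \<open>For polynomial maps of degree at most two along the line the expansion is exact and the
  quotient is l + t m.\<close>

lemma has_dir_deriv_quadratic:
  fixes f :: "'a::real_vector \<Rightarrow> nat \<Rightarrow> 'b::real_normed_vector"
  assumes "\<And>t. f (x + t *\<^sub>R v) = f x + t *\<^sub>R l + (t * t) *\<^sub>R m"
  shows "has_dir_deriv f x v l"
proof -
  have "((\<lambda>t. l + t *\<^sub>R m) \<longlongrightarrow> l + 0 *\<^sub>R m) (at 0)"
    by (rule tendsto_affine) (rule tendsto_const tendsto_ident_at)+
  moreover have "\<forall>\<^sub>F t in at 0. l + t *\<^sub>R m = (f (x + t *\<^sub>R v) - f x) /\<^sub>R t"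
    unfolding eventually_at_filter
  proof (rule always_eventually, intro allI impI)
    fix t :: real assume "t \<noteq> 0"
    have "f (x + t *\<^sub>R v) - f x = t *\<^sub>R (l + t *\<^sub>R m)"
      by (simp add: assms scaleR_add_right)
    then show "l + t *\<^sub>R m = (f (x + t *\<^sub>R v) - f x) /\<^sub>R t"
      using \<open>t \<noteq> 0\<close> by simp
  qed
  ultimately show ?thesis
    unfolding has_dir_deriv_def by (simp add: Lim_transform_eventually)
qed

lemma has_dir_deriv_affine:
  fixes c d :: "nat \<Rightarrow> 'b::real_normed_vector"
  shows "has_dir_deriv (\<lambda>t::real. c + t *\<^sub>R d) s 1 d"
  by (rule has_dir_deriv_quadratic[where m = 0]) (simp add: scaleR_add_left)

lemma eventually_nhds_imp_at_shift:
  fixes t :: real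
  assumes "\<forall>\<^sub>F s in nhds t. Q s"
  shows "\<forall>\<^sub>F h in at 0. Q (t + h *\<^sub>R 1)"
proof -
  have "((\<lambda>h. t + h *\<^sub>R 1) \<longlongrightarrow> t) (at 0)"
    by (auto intro!: tendsto_eq_intros)
  then show ?thesis
    by (rule filterlim_iff[THEN iffD1, rule_format, OF _ assms])
qed

definition bilin :: "(nat \<Rightarrow> 'e::real_normed_vector) \<Rightarrow> (nat \<Rightarrow> 'e) \<Rightarrow> (nat \<Rightarrow> 'e) \<Rightarrow> (nat \<Rightarrow> 'e) \<Rightarrow>
    real \<Rightarrow> real \<Rightarrow> nat \<Rightarrow> 'e" where
  "bilin x y X Y t s = x + t *\<^sub>R y + s *\<^sub>R X + (t * s) *\<^sub>R Y"

text \<open>The two parameters are the first two entries of a real sequence, so that the calculus of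
  sequence types, in particular composition, applies. Derivatives of order above two vanish.\<close>

lemma smooth_on_bilin:
  assumes U: "radially_open UNIV U"
  shows "smooth_on UNIV U (\<lambda>z :: nat \<Rightarrow> real. bilin x y X Y (z 0) (z 1))"
proof -
  let ?e = "\<lambda>(k::nat) (z::nat \<Rightarrow> real) (w :: nat \<Rightarrow> nat \<Rightarrow> real).
    if k = 0 then bilin x y X Y (z 0) (z 1)
    else if k = 1 then w 0 0 *\<^sub>R y + w 0 1 *\<^sub>R X + (z 0 * w 0 1 + w 0 0 * z 1) *\<^sub>R Y
    else if k = 2 then (w 1 0 * w 0 1 + w 0 0 * w 1 1) *\<^sub>R Y else 0"
  have c: "continuous_on A (\<lambda>p. snd p i j)" "continuous_on A (\<lambda>p. fst p j)"
    for A :: "((nat \<Rightarrow> real) \<times> (nat \<Rightarrow> nat \<Rightarrow> real)) set" and i j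
    by (rule continuous_on_coord[OF continuous_on_coord[OF continuous_on_snd[OF continuous_on_id]]]
        continuous_on_coord[OF continuous_on_fst[OF continuous_on_id]])+
  show ?thesis
  proof (rule smooth_onI(1)[where e = ?e, OF U])
    fix k :: nat
    consider "k = 0" | "k = 1" | "k = 2" | "k > 2"
      by linarith
    then show "continuous_on (U \<times> {w. range w \<subseteq> UNIV}) (\<lambda>(z, w). ?e k z w)"
      unfolding case_prod_beta
      by cases (auto simp: bilin_def intro!: continuous_on_add continuous_on_scaleR_fun
          continuous_on_mult continuous_on_const c)
    fix z :: "nat \<Rightarrow> real" and w :: "nat \<Rightarrow> nat \<Rightarrow> real"
    have "has_dir_deriv (\<lambda>z. bilin x y X Y (z 0) (z 1)) z v
        (v 0 *\<^sub>R y + v 1 *\<^sub>R X + (z 0 * v 1 + v 0 * z 1) *\<^sub>R Y)" for v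
      by (rule has_dir_deriv_quadratic[where m = "(v 0 * v 1) *\<^sub>R Y"])
        (simp add: bilin_def fun_eq_iff scaleR_fun_def algebra_simps)
    moreover have "has_dir_deriv (\<lambda>z. w 0 0 *\<^sub>R y + w 0 1 *\<^sub>R X + (z 0 * w 0 1 + w 0 0 * z 1) *\<^sub>R Y) z v
        ((v 0 * w 0 1 + w 0 0 * v 1) *\<^sub>R Y)" for v
      by (rule has_dir_deriv_quadratic[where m = 0])
        (simp add: fun_eq_iff scaleR_fun_def algebra_simps)
    moreover have "has_dir_deriv (\<lambda>z. c) z v 0" for c :: "nat \<Rightarrow> 'a" and v
      by (rule has_dir_deriv_const)
    ultimately show "has_dir_deriv (\<lambda>z. ?e k z w) z (w k) (?e (Suc k) z w)"
      by (cases "k = 0"; cases "k = 1"; cases "k = 2") (simp_all add: numeral_2_eq_2)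
  qed simp
qed

text \<open>Composition takes place on real sequences; precomposing with the linear inclusion
  \<open>?L\<close> of the plane brings the result back to pairs of reals, the domain of
  surfaces.\<close>

lemma smooth_on_compose_bilin:
  fixes g :: "(nat \<Rightarrow> 'e::real_normed_vector) \<Rightarrow> nat \<Rightarrow> 'b::real_normed_vector"
  assumes dom: "model_domain S U" and g: "smooth_on S U g"
    and S: "x \<in> S" "y \<in> S" "X \<in> S" "Y \<in> S"
    and V: "\<And>p. p \<in> V \<Longrightarrow> bilin x y X Y (fst p) (snd p) \<in> U"
  shows "smooth_on UNIV V (\<lambda>p. g (bilin x y X Y (fst p) (snd p)))"
proof -
  let ?P = "\<lambda>z :: nat \<Rightarrow> real. bilin x y X Y (z 0) (z 1)"
  let ?L = "\<lambda>p :: real \<times> real. \<lambda>n::nat. if n = 0 then fst p else if n = 1 then snd p else 0"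
  have md: "model_domain (UNIV :: (nat \<Rightarrow> real) set) UNIV"
    by (simp add: model_domain_def)
  have P: "smooth_on UNIV UNIV ?P"
    by (rule smooth_on_bilin[OF model_domain_radially_open[OF md]])
  have sub: "subspace S"
    using dom by (simp add: model_domain_def)
  have "?P ` UNIV \<subseteq> S"
    unfolding bilin_def by (auto intro!: subspace_add[OF sub] subspace_scale[OF sub] S)
  then have md': "model_domain UNIV (UNIV \<inter> ?P -` U)"
    by (rule model_domain_vimage[OF md P dom])
  have "smooth_on UNIV (UNIV \<inter> ?P -` U) (\<lambda>z. g (?P z))"
  proof (rule smooth_on_compose[OF md' _ dom g])
    show "smooth_on UNIV (UNIV \<inter> ?P -` U) ?P"
      by (rule smooth_on_subset[OF P]) simp
  qed blast
  then have "smooth_on UNIV V (\<lambda>p. g (?P (?L p)))"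
  proof (rule smooth_on_precompose_linear)
    show "linear ?L"
      by (auto simp: linear_iff fun_eq_iff scaleR_fun_def)
    show "continuous_on UNIV ?L"
    proof (rule continuous_on_coordinatewise_then_product)
      show "continuous_on UNIV (\<lambda>p. ?L p n)" for n
        by (cases "n = 0"; cases "n = 1") (simp_all add: continuous_on_fst continuous_on_snd continuous_on_id)
    qed
    show "?L ` V \<subseteq> UNIV \<inter> ?P -` U"
      using V by auto
  qed simp
  then show ?thesis
    by simp
qed

section \<open>The involution defined through charts\<close>

context vmanifold
begin

interpretation T: vmanifold "tangent_bundle N"
  by (rule vmanifold_T)

abbreviation TT :: "('m, 'i, 'e) manifold" where
  "TT \<equiv> tangent_bundle (tangent_bundle N)"

lemma chart_TT_image:
  "\<alpha> \<in> idx N \<Longrightarrow> chart TT \<alpha> ` cdom TT \<alpha> =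
    tdom (tdom (chart N \<alpha> ` cdom N \<alpha>) (model N)) (tdom (model N) (model N))"
  using T.chart_T_image[of \<alpha>] by (simp add: chart_T_image model_T)

lemma overlap_TT:
  "\<alpha> \<in> idx N \<Longrightarrow> \<beta> \<in> idx N \<Longrightarrow> chart TT \<alpha> ` (cdom TT \<alpha> \<inter> cdom TT \<beta>) =
    tdom (tdom (overlap \<alpha> \<beta>) (model N)) (tdom (model N) (model N))"
  using T.overlap_T[of \<alpha> \<beta>] by (simp add: overlap_T model_T)

lemma trans_TT:
  assumes "\<alpha> \<in> idx N" "\<beta> \<in> idx N"
    and "z \<in> tdom (tdom (overlap \<alpha> \<beta>) (model N)) (tdom (model N) (model N))"
  shows "chart TT \<beta> (chart_inv TT \<alpha> z) = tfun (tfun (trans \<alpha> \<beta>)) z"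
proof -
  have "chart TT \<beta> (chart_inv TT \<alpha> z) = tfun (T.trans \<alpha> \<beta>) z"
    by (rule T.trans_T) (use assms in \<open>simp_all add: overlap_T model_T\<close>)
  also have "\<dots> = tfun (tfun (trans \<alpha> \<beta>)) z"
    by (rule tfun_cong[OF model_domain_tdom[OF model_domain_overlap[OF assms(1,2)]] _ assms(3)])
      (simp add: trans_T assms(1,2))
  finally show ?thesis .
qed

lemma vflip_tdom: "vflip z \<in> tdom (tdom U S) (tdom S S) \<longleftrightarrow> z \<in> tdom (tdom U S) (tdom S S)"
  by (auto simp: vflip_def)

text \<open>The coordinate formula in an arbitrarily selected chart around the point; independence
  of the selection is shown next. The restriction matches the \<open>extensional\<close> condition
  in \<open>canonical_flip\<close>.\<close>

definition flip :: "('m, 'i, 'e) point \<Rightarrow> ('m, 'i, 'e) point" where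
  "flip = restrict (\<lambda>\<xi>. let \<alpha> = SOME \<alpha>. \<alpha> \<in> idx N \<and> \<xi> \<in> cdom TT \<alpha>
     in chart_inv TT \<alpha> (vflip (chart TT \<alpha> \<xi>))) (pts TT)"

lemma cdom_TT_pts: "\<alpha> \<in> idx N \<Longrightarrow> \<xi> \<in> cdom TT \<alpha> \<Longrightarrow> \<xi> \<in> pts TT"
  using T.cdom_T_iff by simp

lemma pts_TT_E:
  assumes "\<xi> \<in> pts TT"
  obtains \<alpha> where "\<alpha> \<in> idx N" "\<xi> \<in> cdom TT \<alpha>"
  using assms T.pts_T by auto

text \<open>The selected chart \<beta> and the given \<alpha> are related by the second tangent map
  of a coordinate change, which commutes with \<open>vflip\<close>. Hence the formula computed in
  \<beta> is also valid in \<alpha>.\<close>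

lemma flip_chart:
  assumes \<alpha>: "\<alpha> \<in> idx N" "\<xi> \<in> cdom TT \<alpha>"
  shows "flip \<xi> \<in> cdom TT \<alpha>" "chart TT \<alpha> (flip \<xi>) = vflip (chart TT \<alpha> \<xi>)"
proof -
  define \<beta> where "\<beta> = (SOME \<alpha>. \<alpha> \<in> idx N \<and> \<xi> \<in> cdom TT \<alpha>)"
  have \<beta>: "\<beta> \<in> idx N" "\<xi> \<in> cdom TT \<beta>"
    using someI[of "\<lambda>\<alpha>. \<alpha> \<in> idx N \<and> \<xi> \<in> cdom TT \<alpha>" \<alpha>] \<alpha> by (simp_all add: \<beta>_def)
  let ?z = "chart TT \<beta> \<xi>"
  have eq: "flip \<xi> = chart_inv TT \<beta> (vflip ?z)"
    using cdom_TT_pts[OF \<alpha>] by (simp add: flip_def \<beta>_def Let_def)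
  have z: "?z \<in> tdom (tdom (overlap \<beta> \<alpha>) (model N)) (tdom (model N) (model N))"
    using \<alpha> \<beta> by (simp only: overlap_TT[OF \<beta>(1) \<alpha>(1), symmetric]) blast
  then have "vflip ?z \<in> chart TT \<beta> ` (cdom TT \<beta> \<inter> cdom TT \<alpha>)"
    by (simp only: overlap_TT[OF \<beta>(1) \<alpha>(1)] vflip_tdom)
  then obtain \<eta> where \<eta>: "vflip ?z = chart TT \<beta> \<eta>" "\<eta> \<in> cdom TT \<beta>" "\<eta> \<in> cdom TT \<alpha>"
    by blast
  have "\<beta> \<in> idx TT"
    using \<beta> by simp
  then have "flip \<xi> = \<eta>"
    using vmanifold.chart_inv_chart[OF T.vmanifold_T _ \<eta>(2)] by (simp add: eq \<eta>(1))
  then show "flip \<xi> \<in> cdom TT \<alpha>"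
    using \<eta> by simp
  have "chart TT \<alpha> (flip \<xi>) = tfun (tfun (trans \<beta> \<alpha>)) (vflip ?z)"
    unfolding eq by (rule trans_TT[OF \<beta>(1) \<alpha>(1)]) (use z vflip_tdom in blast)
  also have "\<dots> = vflip (tfun (tfun (trans \<beta> \<alpha>)) ?z)"
    by (rule tfun_tfun_vflip[OF model_domain_overlap[OF \<beta>(1) \<alpha>(1)] smooth_trans[OF \<beta>(1) \<alpha>(1)] z])
  also have "tfun (tfun (trans \<beta> \<alpha>)) ?z = chart TT \<alpha> (chart_inv TT \<beta> ?z)"
    by (rule trans_TT[OF \<beta>(1) \<alpha>(1) z, symmetric])
  also have "chart_inv TT \<beta> ?z = \<xi>"
    by (rule vmanifold.chart_inv_chart[OF T.vmanifold_T]) (use \<beta> in simp_all)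
  finally show "chart TT \<alpha> (flip \<xi>) = vflip (chart TT \<alpha> \<xi>)" .
qed

lemma TT_eqI:
  "\<alpha> \<in> idx N \<Longrightarrow> \<xi> \<in> cdom TT \<alpha> \<Longrightarrow> \<eta> \<in> cdom TT \<alpha> \<Longrightarrow> chart TT \<alpha> \<xi> = chart TT \<alpha> \<eta> \<Longrightarrow> \<xi> = \<eta>"
  using tangent_eqI[OF T.vmanifold_axioms] by simp

lemma flip_pts: "\<xi> \<in> pts TT \<Longrightarrow> flip \<xi> \<in> pts TT"
  using flip_chart(1) cdom_TT_pts pts_TT_E by metis

lemma flip_flip: "\<xi> \<in> pts TT \<Longrightarrow> flip (flip \<xi>) = \<xi>"
proof -
  assume "\<xi> \<in> pts TT"
  then obtain \<alpha> where \<alpha>: "\<alpha> \<in> idx N" "\<xi> \<in> cdom TT \<alpha>"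
    by (rule pts_TT_E)
  note f1 = flip_chart[OF \<alpha>]
  note f2 = flip_chart[OF \<alpha>(1) f1(1)]
  show ?thesis
    by (rule TT_eqI[OF \<alpha>(1) f2(1) \<alpha>(2)]) (simp add: f1 f2)
qed

lemma flip_cdom_iff: "\<alpha> \<in> idx N \<Longrightarrow> \<xi> \<in> pts TT \<Longrightarrow> flip \<xi> \<in> cdom TT \<alpha> \<longleftrightarrow> \<xi> \<in> cdom TT \<alpha>"
  using flip_chart(1) flip_flip by metis

lemma smooth_map_flip: "smooth_map TT TT flip"
proof (rule smooth_mapI)
  show "flip \<xi> \<in> pts TT" if "\<xi> \<in> pts TT" for \<xi>
    by (rule flip_pts[OF that])
  fix \<alpha> \<beta> assume "\<alpha> \<in> idx TT" "\<beta> \<in> idx TT"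
  then have ab: "\<alpha> \<in> idx N" "\<beta> \<in> idx N"
    by simp_all
  have "cdom TT \<alpha> \<inter> flip -` cdom TT \<beta> = cdom TT \<alpha> \<inter> cdom TT \<beta>"
    using flip_cdom_iff[OF ab(2)] cdom_TT_pts[OF ab(1)] by blast
  then have eq: "rep_dom TT TT flip \<alpha> \<beta> = tdom (tdom (overlap \<alpha> \<beta>) (model N)) (tdom (model N) (model N))"
    by (simp only: overlap_TT[OF ab])
  note md1 = model_domain_tdom[OF model_domain_overlap[OF ab]]
  note md = model_domain_tdom[OF md1]
  have model: "model TT = tdom (tdom (model N) (model N)) (tdom (model N) (model N))"
    by (simp add: T.model_T model_T)
  show "openin (top_of_set (model TT)) (rep_dom TT TT flip \<alpha> \<beta>)"
    unfolding eq model using md by (simp add: model_domain_def)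
  have "smooth_on (model TT) (rep_dom TT TT flip \<alpha> \<beta>) (\<lambda>z. tfun (tfun (trans \<alpha> \<beta>)) (vflip z))"
    unfolding eq model
    by (rule smooth_on_compose[OF md smooth_on_vflip[OF model_domain_radially_open[OF md]] md
          smooth_on_tfun[OF md1 smooth_on_tfun[OF model_domain_overlap[OF ab] smooth_trans[OF ab]]]])
      (use vflip_tdom in blast)
  then show "smooth_on (model TT) (rep_dom TT TT flip \<alpha> \<beta>) (local_rep TT TT flip \<alpha> \<beta>)"
    unfolding eq model
  proof (rule smooth_on_cong[OF model_domain_radially_open[OF md], rotated])
    fix z assume z: "z \<in> tdom (tdom (overlap \<alpha> \<beta>) (model N)) (tdom (model N) (model N))"
    then obtain \<xi> where \<xi>: "z = chart TT \<alpha> \<xi>" "\<xi> \<in> cdom TT \<alpha>" "\<xi> \<in> cdom TT \<beta>"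
      by (simp only: overlap_TT[OF ab, symmetric]) blast
    have inv: "chart_inv TT \<alpha> z = \<xi>"
      unfolding \<xi>(1) by (rule vmanifold.chart_inv_chart[OF T.vmanifold_T]) (use ab \<xi> in simp_all)
    have "local_rep TT TT flip \<alpha> \<beta> z = vflip (chart TT \<beta> \<xi>)"
      using flip_chart(2)[OF ab(2) \<xi>(3)] by (simp add: local_rep_def inv)
    also have "chart TT \<beta> \<xi> = tfun (tfun (trans \<alpha> \<beta>)) z"
      using trans_TT[OF ab z] by (simp only: inv)
    finally show "tfun (tfun (trans \<alpha> \<beta>)) (vflip z) = local_rep TT TT flip \<alpha> \<beta> z"
      using tfun_tfun_vflip[OF model_domain_overlap[OF ab] smooth_trans[OF ab] z] by simp
  qed
qed

lemma diffeo_flip: "diffeo TT TT flip"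
proof -
  have bij: "bij_betw flip (pts TT) (pts TT)"
    by (rule bij_betw_byWitness[where f' = flip]) (use flip_flip flip_pts in auto)
  have "inv_into (pts TT) flip \<xi> = flip \<xi>" if "\<xi> \<in> pts TT" for \<xi>
    using inv_into_f_f[OF bij_betw_imp_inj_on[OF bij] flip_pts[OF that]] flip_flip[OF that] by simp
  then have "smooth_map TT TT (inv_into (pts TT) flip)"
    using smooth_map_cong[OF T.vmanifold_T _ smooth_map_flip] by (metis (no_types, lifting))
  then show ?thesis
    using bij smooth_map_flip by (simp add: diffeo_def)
qed

section \<open>Velocities of curves and surfaces in charts\<close>

lemma velocity_chart:
  assumes \<alpha>: "\<alpha> \<in> idx N" and ev: "\<forall>\<^sub>F s in nhds t. c s \<in> cdom N \<alpha>"
    and l: "has_dir_deriv (\<lambda>s. chart N \<alpha> (c s)) t 1 l"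
  shows "velocity N c t = tv (c t) \<alpha> l" "velocity N c t \<in> cdom (tangent_bundle N) \<alpha>"
    "chart (tangent_bundle N) \<alpha> (velocity N c t) = vpair (chart N \<alpha> (c t)) l"
proof -
  have ct: "c t \<in> cdom N \<alpha>"
    using eventually_nhds_x_imp_x[OF ev] .
  have ev0: "\<forall>\<^sub>F h in at 0. c (t + h *\<^sub>R 1) \<in> cdom N \<alpha>"
    by (rule eventually_nhds_imp_at_shift[OF ev])
  have evS: "\<forall>\<^sub>F h in at 0. chart N \<alpha> (c (t + h *\<^sub>R 1)) \<in> model N"
    using ev0 by (rule eventually_mono) (rule chart_in_model[OF \<alpha>])
  \<comment> \<open>Membership of l in the model is a by-product of the chain rule; the case \<beta>
    = \<alpha> supplies it afterwards.\<close>
  have deriv: "l \<in> model N \<and> has_dir_deriv (chart N \<beta> \<circ> c) t 1 (dir_deriv (trans \<alpha> \<beta>) (chart N \<alpha> (c t)) l)"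
    if \<beta>: "\<beta> \<in> idx N" "c t \<in> cdom N \<beta>" for \<beta>
  proof -
    note ch = has_dir_deriv_chain[OF model_domain_overlap[OF \<alpha> \<beta>(1)] smooth_trans[OF \<alpha> \<beta>(1)] l _ evS]
    have x: "chart N \<alpha> (c t) \<in> overlap \<alpha> \<beta>"
      using ct \<beta>(2) by blast
    have "has_dir_deriv (chart N \<beta> \<circ> c) t 1 (dir_deriv (trans \<alpha> \<beta>) (chart N \<alpha> (c t)) l)"
      by (rule has_dir_deriv_transform[OF ch(2)[OF x]], rule eventually_mono[OF ev0])
        (use ct \<alpha> in \<open>simp_all add: chart_inv_chart\<close>)
    then show ?thesis
      using ch(1)[OF x] by blast
  qed
  then have l_in: "l \<in> model N"
    using \<alpha> ct by blast
  show v: "velocity N c t = tv (c t) \<alpha> l"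
    unfolding velocity_def tv_def tangent_class_def
    using deriv has_dir_deriv_imp by (intro arg_cong2[where f = Tvec] refl) fastforce
  show "velocity N c t \<in> cdom (tangent_bundle N) \<alpha>"
    unfolding v by (rule tv_in_cdom_T[OF \<alpha> ct l_in])
  show "chart (tangent_bundle N) \<alpha> (velocity N c t) = vpair (chart N \<alpha> (c t)) l"
    unfolding v by (rule chart_T_self[OF \<alpha> ct l_in])
qed

text \<open>The inner parameter a is differentiated first, giving the coordinate \<open>P b'\<close>
  for every b' near b. The outer velocity then differentiates the pair of base point and
  \<open>P\<close>, giving q and r.\<close>

lemma velocity_velocity_chart:
  assumes \<alpha>: "\<alpha> \<in> idx N"
    and ev: "\<forall>\<^sub>F b' in nhds b. \<forall>\<^sub>F a' in nhds a. \<sigma> a' b' \<in> cdom N \<alpha>"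
    and P: "\<forall>\<^sub>F b' in nhds b. has_dir_deriv (\<lambda>a'. chart N \<alpha> (\<sigma> a' b')) a 1 (P b')"
    and q: "has_dir_deriv (\<lambda>b'. chart N \<alpha> (\<sigma> a b')) b 1 q"
    and r: "has_dir_deriv P b 1 r"
  shows "velocity (tangent_bundle N) (\<lambda>b'. velocity N (\<lambda>a'. \<sigma> a' b') a) b \<in> cdom TT \<alpha>"
    and "chart TT \<alpha> (velocity (tangent_bundle N) (\<lambda>b'. velocity N (\<lambda>a'. \<sigma> a' b') a) b) =
      vpair (vpair (chart N \<alpha> (\<sigma> a b)) (P b)) (vpair q r)"
proof -
  let ?c = "\<lambda>b'. velocity N (\<lambda>a'. \<sigma> a' b') a"
  have ev': "\<forall>\<^sub>F b' in nhds b. ?c b' \<in> cdom (tangent_bundle N) \<alpha> \<and>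
      chart (tangent_bundle N) \<alpha> (?c b') = vpair (chart N \<alpha> (\<sigma> a b')) (P b')"
    using ev P
  proof eventually_elim
    case (elim b')
    then show ?case
      using velocity_chart(2,3)[OF \<alpha>, of "\<lambda>a'. \<sigma> a' b'" a "P b'"] by simp
  qed
  then have ev1: "\<forall>\<^sub>F b' in nhds b. ?c b' \<in> cdom (tangent_bundle N) \<alpha>"
    by (rule eventually_mono) blast
  have ev2: "\<forall>\<^sub>F h in at 0. vpair (chart N \<alpha> (\<sigma> a (b + h *\<^sub>R 1))) (P (b + h *\<^sub>R 1)) =
      chart (tangent_bundle N) \<alpha> (?c (b + h *\<^sub>R 1))"
    by (rule eventually_mono[OF eventually_nhds_imp_at_shift[OF ev']]) simp
  have eq: "chart (tangent_bundle N) \<alpha> (?c b) = vpair (chart N \<alpha> (\<sigma> a b)) (P b)"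
    using eventually_nhds_x_imp_x[OF ev'] by blast
  have "has_dir_deriv (\<lambda>b'. chart (tangent_bundle N) \<alpha> (?c b')) b 1 (vpair q r)"
    by (rule has_dir_deriv_transform[OF has_dir_deriv_vpair[OF q r] ev2 eq[symmetric]])
  note v = vmanifold.velocity_chart[OF T.vmanifold_axioms _ ev1 this]
  show "velocity (tangent_bundle N) ?c b \<in> cdom TT \<alpha>"
    by (rule v(2)) (simp add: \<alpha>)
  show "chart TT \<alpha> (velocity (tangent_bundle N) ?c b) = vpair (vpair (chart N \<alpha> (\<sigma> a b)) (P b)) (vpair q r)"
    using v(3) \<alpha> eq by simp
qed

lemma radially_open_open:
  fixes V :: "'a::real_normed_vector set"
  assumes "open V"
  shows "radially_open S V"
  unfolding radially_open_def
proof (intro ballI)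
  fix x v assume "x \<in> V"
  have "((\<lambda>t. x + t *\<^sub>R v) \<longlongrightarrow> x) (at 0)"
    by (auto intro!: tendsto_eq_intros)
  then show "\<forall>\<^sub>F t in at 0. x + t *\<^sub>R v \<in> V"
    using assms \<open>x \<in> V\<close> by (rule topological_tendstoD)
qed

lemma open_submanifold_simps [simp]:
  "pts (open_submanifold Q) = Q" "idx (open_submanifold Q) = UNIV" "model (open_submanifold Q) = UNIV"
  "cdom (open_submanifold Q) i = Q" "chart (open_submanifold Q) i x = x"
  by (simp_all add: open_submanifold_def)

lemma local_rep_open_submanifold:
  assumes "x \<in> Q"
  shows "local_rep (open_submanifold Q) N' f i \<beta> x = chart N' \<beta> (f x)"
proof -
  have "inv_into Q (\<lambda>x. x) x = x"
    using inv_into_f_f[of "\<lambda>x. x" Q x] assms by (simp add: inj_on_def)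
  then show ?thesis
    by (simp add: local_rep_def chart_inv_def open_submanifold_def)
qed

lemma ds_dt_chart:
  assumes \<alpha>: "\<alpha> \<in> idx N" and V: "open V" "(t, s) \<in> V" "\<And>p. p \<in> V \<Longrightarrow> \<gamma> p \<in> cdom N \<alpha>"
    and g: "smooth_on UNIV V (\<lambda>p. chart N \<alpha> (\<gamma> p))"
  defines "D \<equiv> \<lambda>u p. dir_deriv (\<lambda>p. chart N \<alpha> (\<gamma> p)) p u"
  shows "ds_dt N \<gamma> t s \<in> cdom TT \<alpha>"
    and "chart TT \<alpha> (ds_dt N \<gamma> t s) =
      vpair (vpair (chart N \<alpha> (\<gamma> (t, s))) (D (1, 0) (t, s)))
        (vpair (D (0, 1) (t, s)) (dir_deriv (D (1, 0)) (t, s) (0, 1)))"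
    and "dt_ds N \<gamma> t s \<in> cdom TT \<alpha>"
    and "chart TT \<alpha> (dt_ds N \<gamma> t s) =
      vpair (vpair (chart N \<alpha> (\<gamma> (t, s))) (D (0, 1) (t, s)))
        (vpair (D (1, 0) (t, s)) (dir_deriv (D (0, 1)) (t, s) (1, 0)))"
proof -
  let ?g = "\<lambda>p. chart N \<alpha> (\<gamma> p)"
  obtain A B where "open A" "open B" "(t, s) \<in> A \<times> B" "A \<times> B \<subseteq> V"
    by (rule open_prod_elim[OF V(1,2)])
  then have AB: "open A" "open B" "t \<in> A" "s \<in> B" "A \<times> B \<subseteq> V"
    by auto
  have evA: "\<forall>\<^sub>F a in nhds t. a \<in> A" and evB: "\<forall>\<^sub>F b in nhds s. b \<in> B"
    by (rule eventually_nhds_in_open; fact)+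
  have slice1: "has_dir_deriv (\<lambda>a. h (a, b)) a 1 l \<longleftrightarrow> has_dir_deriv h (a, b) (1, 0) l"
    and slice2: "has_dir_deriv (\<lambda>b. h (a, b)) b 1 l \<longleftrightarrow> has_dir_deriv h (a, b) (0, 1) l"
    for h :: "real \<times> real \<Rightarrow> nat \<Rightarrow> 'e" and a b l
    by (simp_all add: has_dir_deriv_def)
  have D1: "has_dir_deriv ?g p u (D u p)" if "p \<in> V" for p u
    unfolding D_def by (rule smooth_on_dir_deriv1[OF g that]) simp
  have D2: "has_dir_deriv (D u) p w (dir_deriv (D u) p w)" if "p \<in> V" for p u w
    unfolding D_def by (rule smooth_on_dir_deriv1[OF smooth_on_dir[OF g] that]) simp_all
  have ev1: "\<forall>\<^sub>F b in nhds s. \<forall>\<^sub>F a in nhds t. \<gamma> (a, b) \<in> cdom N \<alpha>"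
    by (rule eventually_mono[OF evB], rule eventually_mono[OF evA]) (use AB V(3) in blast)
  have ev2: "\<forall>\<^sub>F a in nhds t. \<forall>\<^sub>F b in nhds s. \<gamma> (a, b) \<in> cdom N \<alpha>"
    by (rule eventually_mono[OF evA], rule eventually_mono[OF evB]) (use AB V(3) in blast)
  have "\<forall>\<^sub>F b in nhds s. has_dir_deriv (\<lambda>a. ?g (a, b)) t 1 (D (1, 0) (t, b))"
    by (rule eventually_mono[OF evB], subst slice1, rule D1) (use AB in blast)
  from velocity_velocity_chart[where \<sigma> = "\<lambda>a b. \<gamma> (a, b)", OF \<alpha> ev1 this
      slice2[THEN iffD2, OF D1[OF V(2)]] slice2[THEN iffD2, OF D2[OF V(2)]]]
  show "ds_dt N \<gamma> t s \<in> cdom TT \<alpha>"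
    and "chart TT \<alpha> (ds_dt N \<gamma> t s) =
      vpair (vpair (chart N \<alpha> (\<gamma> (t, s))) (D (1, 0) (t, s)))
        (vpair (D (0, 1) (t, s)) (dir_deriv (D (1, 0)) (t, s) (0, 1)))"
    unfolding ds_dt_def .
  have "\<forall>\<^sub>F a in nhds t. has_dir_deriv (\<lambda>b. ?g (a, b)) s 1 (D (0, 1) (a, s))"
    by (rule eventually_mono[OF evA], subst slice2, rule D1) (use AB in blast)
  from velocity_velocity_chart[where \<sigma> = "\<lambda>b a. \<gamma> (a, b)", OF \<alpha> ev2 this
      slice1[THEN iffD2, OF D1[OF V(2)]] slice1[THEN iffD2, OF D2[OF V(2)]]]
  show "dt_ds N \<gamma> t s \<in> cdom TT \<alpha>"
    and "chart TT \<alpha> (dt_ds N \<gamma> t s) =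
      vpair (vpair (chart N \<alpha> (\<gamma> (t, s))) (D (0, 1) (t, s)))
        (vpair (D (1, 0) (t, s)) (dir_deriv (D (0, 1)) (t, s) (1, 0)))"
    unfolding dt_ds_def .
qed

text \<open>With g the surface in a chart, the two velocities are (g, g_t, g_s, g_ts) and (g, g_s,
  g_t, g_st). Symmetry of second derivatives, now in the parameter plane, makes the second the
  \<open>vflip\<close> of the first.\<close>

lemma dt_ds_eq_flip:
  assumes sm: "smooth_map (open_submanifold Q) N \<gamma>" and ts: "(t, s) \<in> Q"
  shows "ds_dt N \<gamma> t s \<in> pts TT" "dt_ds N \<gamma> t s = flip (ds_dt N \<gamma> t s)"
proof -
  have "\<gamma> (t, s) \<in> pts N"
    using smooth_map_pts[OF sm] ts by simp
  then obtain \<alpha> where \<alpha>: "\<alpha> \<in> idx N" "\<gamma> (t, s) \<in> cdom N \<alpha>"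
    using pts_eq by blast
  define V where "V = Q \<inter> \<gamma> -` cdom N \<alpha>"
  have V: "open V" and smV: "smooth_on UNIV V (local_rep (open_submanifold Q) N \<gamma> () \<alpha>)"
    using sm \<alpha>(1) by (simp_all add: smooth_map_def Let_def V_def)
  have g: "smooth_on UNIV V (\<lambda>p. chart N \<alpha> (\<gamma> p))"
    by (rule smooth_on_cong[OF radially_open_open[OF V] _ smV])
      (simp add: V_def local_rep_open_submanifold)
  have tsV: "(t, s) \<in> V"
    using ts \<alpha> by (simp add: V_def)
  note ch = ds_dt_chart[OF \<alpha>(1) V tsV _ g]
  have in_cdom: "\<gamma> p \<in> cdom N \<alpha>" if "p \<in> V" for p
    using that by (simp add: V_def)
  show "ds_dt N \<gamma> t s \<in> pts TT"
    using ch(1)[OF in_cdom] by (rule cdom_TT_pts[OF \<alpha>(1)])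
  have line: "continuous_on UNIV (\<lambda>(a, b). (t, s) + a *\<^sub>R (1 :: real, 0 :: real) + b *\<^sub>R (0, 1))"
    by (auto simp: case_prod_beta intro!: continuous_intros)
  have "dir_deriv (\<lambda>p. dir_deriv (\<lambda>p. chart N \<alpha> (\<gamma> p)) p (1, 0)) (t, s) (0, 1) =
      dir_deriv (\<lambda>p. dir_deriv (\<lambda>p. chart N \<alpha> (\<gamma> p)) p (0, 1)) (t, s) (1, 0)"
    by (rule smooth_on_symmetric[OF g _ _ tsV _ _ line]) (use V in simp_all)
  then have "chart TT \<alpha> (dt_ds N \<gamma> t s) = vflip (chart TT \<alpha> (ds_dt N \<gamma> t s))"
    by (simp add: ch(2)[OF in_cdom] ch(4)[OF in_cdom] vflip_def)
  then show "dt_ds N \<gamma> t s = flip (ds_dt N \<gamma> t s)"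
    using TT_eqI[OF \<alpha>(1) ch(3)[OF in_cdom] flip_chart(1)[OF \<alpha>(1) ch(1)[OF in_cdom]]]
      flip_chart(2)[OF \<alpha>(1) ch(1)[OF in_cdom]] by simp
qed

text \<open>The polynomial surface lives in the image of one chart only for small parameters, so it
  is restricted to a square that it maps into the open chart image and is pulled back by the inverse
  chart.\<close>

lemma surface_exists:
  assumes "\<xi> \<in> pts TT"
  obtains \<epsilon> \<gamma> where "\<epsilon> > 0" "smooth_map (open_submanifold ({-\<epsilon><..<\<epsilon>} \<times> {-\<epsilon><..<\<epsilon>})) N \<gamma>" "ds_dt N \<gamma> 0 0 = \<xi>"
proof -
  obtain \<alpha> where \<alpha>: "\<alpha> \<in> idx N" "\<xi> \<in> cdom TT \<alpha>"
    using assms by (rule pts_TT_E)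
  define x y X Y where "x = vfst (vfst (chart TT \<alpha> \<xi>))" "y = vsnd (vfst (chart TT \<alpha> \<xi>))"
    "X = vfst (vsnd (chart TT \<alpha> \<xi>))" "Y = vsnd (vsnd (chart TT \<alpha> \<xi>))"
  then have z: "chart TT \<alpha> \<xi> = vpair (vpair x y) (vpair X Y)"
    by simp
  have "chart TT \<alpha> \<xi> \<in> tdom (tdom (chart N \<alpha> ` cdom N \<alpha>) (model N)) (tdom (model N) (model N))"
    using chart_TT_image[OF \<alpha>(1)] \<alpha>(2) by blast
  then have mem: "x \<in> chart N \<alpha> ` cdom N \<alpha>" "y \<in> model N" "X \<in> model N" "Y \<in> model N"
    by (simp_all add: z)
  let ?U = "chart N \<alpha> ` cdom N \<alpha>"
  note md = model_domain_chart[OF \<alpha>(1)]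
  have xS: "x \<in> model N"
    using mem(1) model_domain_subset[OF md] by blast
  let ?P = "\<lambda>p. bilin x y X Y (fst p) (snd p)"
  have PS: "?P p \<in> model N" for p
    unfolding bilin_def using xS mem by (intro subspace_add[OF subspace_model] subspace_scale[OF subspace_model])
  have contP: "continuous_on UNIV ?P"
    unfolding bilin_def
    by (intro continuous_on_add continuous_on_scaleR_fun continuous_on_mult continuous_on_fst
        continuous_on_snd continuous_on_id continuous_on_const)
  have openP: "open (?P -` W)" if W: "model_domain (model N) W" for W
  proof -
    obtain A where A: "open A" "W = A \<inter> model N"
      using W by (rule model_domain_open)
    then have "?P -` W = ?P -` A"
      using PS by auto
    then show ?thesis
      using open_vimage[OF A(1) contP] by simp
  qed
  have "(0, 0) \<in> ?P -` ?U"
    using mem by (simp add: bilin_def)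
  then have "\<forall>\<^sub>F p in nhds 0 \<times>\<^sub>F nhds 0. p \<in> ?P -` ?U"
    unfolding nhds_prod[symmetric] by (rule eventually_nhds_in_open[OF openP[OF md]])
  then obtain R where R: "\<forall>\<^sub>F t in nhds (0::real). R t" "\<And>t s. R t \<Longrightarrow> R s \<Longrightarrow> (t, s) \<in> ?P -` ?U"
    unfolding eventually_prod_same by auto
  obtain \<epsilon> where \<epsilon>: "\<epsilon> > 0" "\<And>t. \<bar>t\<bar> < \<epsilon> \<Longrightarrow> R t"
    using R(1) by (auto simp: eventually_nhds_metric dist_real_def)
  define Q where "Q = {-\<epsilon><..<\<epsilon>} \<times> {-\<epsilon><..<\<epsilon>}"
  have Q: "open Q" "(0, 0) \<in> Q"
    using \<epsilon>(1) by (simp_all add: Q_def open_Times)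
  have QU: "?P p \<in> ?U" if "p \<in> Q" for p
  proof -
    have "\<bar>fst p\<bar> < \<epsilon>" "\<bar>snd p\<bar> < \<epsilon>"
      using that by (auto simp: Q_def)
    then show ?thesis
      using R(2)[of "fst p" "snd p"] \<epsilon>(2) by simp
  qed
  define \<gamma> where "\<gamma> p = chart_inv N \<alpha> (?P p)" for p
  have \<gamma>: "\<gamma> p \<in> cdom N \<alpha>" "chart N \<alpha> (\<gamma> p) = ?P p" if "p \<in> Q" for p
    using QU[OF that] \<alpha>(1) by (auto simp: \<gamma>_def chart_inv_chart)
  have sm: "smooth_map (open_submanifold Q) N \<gamma>"
  proof (rule smooth_mapI)
    show "\<gamma> p \<in> pts N" if "p \<in> pts (open_submanifold Q)" for p
      unfolding pts_eq by (rule UN_I[OF \<alpha>(1)], rule \<gamma>(1)) (use that in simp)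
    fix i \<beta> assume \<beta>: "\<beta> \<in> idx N"
    let ?V = "rep_dom (open_submanifold Q) N \<gamma> i \<beta>"
    \<comment> \<open>Injectivity of the chart \<alpha> turns the condition on the point \<gamma> p
      into one on its coordinate, whose preimage is open by \<open>openP\<close>.\<close>
    have V: "?V = Q \<inter> ?P -` overlap \<alpha> \<beta>"
    proof -
      have "\<gamma> p \<in> cdom N \<beta> \<longleftrightarrow> ?P p \<in> overlap \<alpha> \<beta>" if p: "p \<in> Q" for p
      proof
        assume "\<gamma> p \<in> cdom N \<beta>"
        then show "?P p \<in> overlap \<alpha> \<beta>"
          using \<gamma>[OF p] by (intro image_eqI[of _ _ "\<gamma> p"]) simp_all
      next
        assume "?P p \<in> overlap \<alpha> \<beta>"
        then obtain q where q: "?P p = chart N \<alpha> q" "q \<in> cdom N \<alpha>" "q \<in> cdom N \<beta>"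
          by blast
        have "\<gamma> p = q"
          by (rule inj_onD[OF inj_chart[OF \<alpha>(1)] _ \<gamma>(1)[OF p] q(2)]) (simp add: \<gamma>(2)[OF p] q(1))
        then show "\<gamma> p \<in> cdom N \<beta>"
          using q(3) by simp
      qed
      then show ?thesis
        by auto
    qed
    have opV: "open ?V"
      unfolding V by (rule open_Int[OF Q(1) openP[OF model_domain_overlap[OF \<alpha>(1) \<beta>]]])
    then show "openin (top_of_set (model (open_submanifold Q))) ?V"
      by simp
    have "smooth_on UNIV ?V (\<lambda>p. trans \<alpha> \<beta> (?P p))"
      by (rule smooth_on_compose_bilin[OF model_domain_overlap[OF \<alpha>(1) \<beta>] smooth_trans[OF \<alpha>(1) \<beta>] xS mem(2-4)])
        (simp only: V Int_iff vimage_eq)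
    then show "smooth_on (model (open_submanifold Q)) ?V (local_rep (open_submanifold Q) N \<gamma> i \<beta>)"
      unfolding open_submanifold_simps(3)
    proof (rule smooth_on_cong[OF radially_open_open[OF opV], rotated])
      fix p assume "p \<in> ?V"
      then have "p \<in> Q"
        by simp
      then show "trans \<alpha> \<beta> (?P p) = local_rep (open_submanifold Q) N \<gamma> i \<beta> p"
        by (simp add: local_rep_open_submanifold \<gamma>_def)
    qed
  qed
  have evQ: "\<forall>\<^sub>F a in nhds (0::real). \<bar>a\<bar> < \<epsilon>"
    using \<epsilon>(1) by (auto simp: eventually_nhds_metric dist_real_def)
  have inQ: "(a, b) \<in> Q \<longleftrightarrow> \<bar>a\<bar> < \<epsilon> \<and> \<bar>b\<bar> < \<epsilon>" for a b
    by (auto simp: Q_def)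
  have ev: "\<forall>\<^sub>F b in nhds 0. \<forall>\<^sub>F a in nhds 0. \<gamma> (a, b) \<in> cdom N \<alpha>"
    by (rule eventually_mono[OF evQ], rule eventually_mono[OF evQ]) (simp add: \<gamma>(1) inQ)
  \<comment> \<open>The coordinate of the surface equals the polynomial on \<open>Q\<close> alone,
    so derivatives at 0 are transferred through a neighbourhood of 0.\<close>
  have transform: "has_dir_deriv (\<lambda>a. chart N \<alpha> (\<gamma> (c a))) 0 1 l"
    if "has_dir_deriv (\<lambda>a. ?P (c a)) 0 1 l" "\<And>a. \<bar>a\<bar> < \<epsilon> \<Longrightarrow> c a \<in> Q" for c :: "real \<Rightarrow> real \<times> real" and l
  proof (rule has_dir_deriv_transform[OF that(1)])
    show "\<forall>\<^sub>F t in at 0. ?P (c (0 + t *\<^sub>R 1)) = chart N \<alpha> (\<gamma> (c (0 + t *\<^sub>R 1)))"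
      by (rule eventually_mono[OF eventually_nhds_imp_at_shift[OF evQ]]) (simp add: \<gamma>(2) that(2))
  qed (simp add: \<gamma>(2) that(2) \<epsilon>(1))
  have P: "\<forall>\<^sub>F b in nhds 0. has_dir_deriv (\<lambda>a. chart N \<alpha> (\<gamma> (a, b))) 0 1 (y + b *\<^sub>R Y)"
  proof (rule eventually_mono[OF evQ])
    fix b assume "\<bar>b\<bar> < \<epsilon>"
    moreover have "(\<lambda>a. ?P (a, b)) = (\<lambda>a. (x + b *\<^sub>R X) + a *\<^sub>R (y + b *\<^sub>R Y))"
      by (simp add: bilin_def fun_eq_iff scaleR_fun_def algebra_simps)
    then have "has_dir_deriv (\<lambda>a. ?P (a, b)) 0 1 (y + b *\<^sub>R Y)"
      by (simp only: has_dir_deriv_affine)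
    ultimately show "has_dir_deriv (\<lambda>a. chart N \<alpha> (\<gamma> (a, b))) 0 1 (y + b *\<^sub>R Y)"
      by (intro transform) (simp_all add: inQ)
  qed
  have "(\<lambda>b. ?P (0, b)) = (\<lambda>b. x + b *\<^sub>R X)"
    by (simp add: bilin_def)
  then have "has_dir_deriv (\<lambda>b. ?P (0, b)) 0 1 X"
    by (simp only: has_dir_deriv_affine)
  then have q: "has_dir_deriv (\<lambda>b. chart N \<alpha> (\<gamma> (0, b))) 0 1 X"
    by (rule transform) (simp add: inQ \<epsilon>(1))
  note ch = velocity_velocity_chart[where \<sigma> = "\<lambda>a b. \<gamma> (a, b)", OF \<alpha>(1) ev P q has_dir_deriv_affine]
  have "chart TT \<alpha> (ds_dt N \<gamma> 0 0) = chart TT \<alpha> \<xi>"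
    unfolding ds_dt_def ch(2) z using \<gamma>(2)[OF Q(2)] by (simp add: bilin_def)
  then have "ds_dt N \<gamma> 0 0 = \<xi>"
    using ch(1) \<alpha> by (intro TT_eqI[OF \<alpha>(1)]) (simp_all add: ds_dt_def)
  then show thesis
    using that[OF \<epsilon>(1), of \<gamma>] sm by (simp add: Q_def)
qed

text \<open>For uniqueness one pair of parameters suffices: every point of the second tangent bundle
  is \<open>ds_dt\<close> of some surface at (0, 0), so the condition prescribes k on all of
  \<open>pts\<close>, and extensionality determines the rest.\<close>

lemma canonical_flip_eq: "canonical_flip N = flip"
  unfolding canonical_flip_def Let_def
proof (rule the_equality)
  show "flip \<in> extensional (pts TT) \<and> diffeo TT TT flip \<and>
    (\<forall>\<epsilon>>0. \<forall>\<gamma>. smooth_map (open_submanifold ({-\<epsilon><..<\<epsilon>} \<times> {-\<epsilon><..<\<epsilon>})) N \<gamma> \<longrightarrow>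
      (\<forall>t\<in>{-\<epsilon><..<\<epsilon>}. \<forall>s\<in>{-\<epsilon><..<\<epsilon>}. dt_ds N \<gamma> t s = flip (ds_dt N \<gamma> t s)))"
  proof (intro conjI allI impI ballI)
    show "flip \<in> extensional (pts TT)"
      unfolding flip_def by (rule restrict_extensional)
    show "diffeo TT TT flip"
      by (rule diffeo_flip)
  qed (rule dt_ds_eq_flip(2), assumption, simp)
next
  fix k assume k: "k \<in> extensional (pts TT) \<and> diffeo TT TT k \<and>
    (\<forall>\<epsilon>>0. \<forall>\<gamma>. smooth_map (open_submanifold ({-\<epsilon><..<\<epsilon>} \<times> {-\<epsilon><..<\<epsilon>})) N \<gamma> \<longrightarrow>
      (\<forall>t\<in>{-\<epsilon><..<\<epsilon>}. \<forall>s\<in>{-\<epsilon><..<\<epsilon>}. dt_ds N \<gamma> t s = k (ds_dt N \<gamma> t s)))"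
  have "k \<xi> = flip \<xi>" if \<xi>: "\<xi> \<in> pts TT" for \<xi>
  proof -
    obtain \<epsilon> \<gamma> where g: "\<epsilon> > 0" "smooth_map (open_submanifold ({-\<epsilon><..<\<epsilon>} \<times> {-\<epsilon><..<\<epsilon>})) N \<gamma>" "ds_dt N \<gamma> 0 0 = \<xi>"
      using \<xi> by (rule surface_exists)
    have "dt_ds N \<gamma> 0 0 = k (ds_dt N \<gamma> 0 0)"
      using k g(1,2) by simp
    moreover have "dt_ds N \<gamma> 0 0 = flip (ds_dt N \<gamma> 0 0)"
      by (rule dt_ds_eq_flip(2)[OF g(2)]) (use g(1) in simp)
    ultimately show ?thesis
      using g(3) by simp
  qed
  moreover have "flip \<in> extensional (pts TT)"
    unfolding flip_def by (rule restrict_extensional)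
  ultimately show "k = flip"
    using k by (intro extensionalityI[of k "pts TT" flip]) auto
qed

section \<open>The involution and the two projections of the second tangent bundle\<close>

lemma foot_in_cdom_T: "\<alpha> \<in> idx N \<Longrightarrow> \<xi> \<in> cdom TT \<alpha> \<Longrightarrow> foot \<xi> \<in> cdom (tangent_bundle N) \<alpha>"
  using T.cdom_T_iff by simp

lemma chart_foot: "\<alpha> \<in> idx N \<Longrightarrow> \<xi> \<in> cdom TT \<alpha> \<Longrightarrow> chart (tangent_bundle N) \<alpha> (foot \<xi>) = vfst (chart TT \<alpha> \<xi>)"
  using T.cdom_TE[of \<alpha> \<xi>] T.chart_T_self by (metis T.foot_tv idx_T vfst_vpair)

lemma tangent_foot_pts:
  "\<xi> \<in> pts TT \<Longrightarrow> tangent_map (tangent_bundle N) N foot \<xi> \<in> pts (tangent_bundle N)"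
  by (rule tangent_map_pts[OF vmanifold_T vmanifold_axioms smooth_map_foot[OF vmanifold_axioms]])

lemma tangent_foot_cdom:
  assumes "\<alpha> \<in> idx N" "\<xi> \<in> cdom TT \<alpha>"
  shows "tangent_map (tangent_bundle N) N foot \<xi> \<in> cdom (tangent_bundle N) \<alpha>"
  using assms tangent_foot_pts[OF cdom_TT_pts[OF assms]] foot_in_cdom_T[OF assms] by (simp add: cdom_T_iff)

text \<open>Both sides have the coordinates (x, X) in a common chart.\<close>

lemma foot_flip:
  assumes "\<xi> \<in> pts TT"
  shows "foot (flip \<xi>) = tangent_map (tangent_bundle N) N foot \<xi>"
proof -
  obtain \<alpha> where \<alpha>: "\<alpha> \<in> idx N" "\<xi> \<in> cdom TT \<alpha>"
    using assms by (rule pts_TT_E)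
  note f = flip_chart[OF \<alpha>]
  show ?thesis
  proof (rule tangent_eqI[OF vmanifold_axioms \<alpha>(1) foot_in_cdom_T[OF \<alpha>(1) f(1)] tangent_foot_cdom[OF \<alpha>]])
    show "chart (tangent_bundle N) \<alpha> (foot (flip \<xi>)) =
        chart (tangent_bundle N) \<alpha> (tangent_map (tangent_bundle N) N foot \<xi>)"
      unfolding chart_foot[OF \<alpha>(1) f(1)] f(2) chart_tangent_foot[OF vmanifold_axioms \<alpha>] tfun_vfst
      by (simp add: vflip_def)
  qed
qed

text \<open>The previous identity applied to \<open>flip \<xi>\<close>, since \<open>flip\<close> is
  an involution.\<close>

lemma tangent_foot_flip:
  assumes "\<xi> \<in> pts TT"
  shows "tangent_map (tangent_bundle N) N foot (flip \<xi>) = foot \<xi>"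
  using foot_flip[OF flip_pts[OF assms]] flip_flip[OF assms] by simp

end

section \<open>Complete lifts\<close>

lemma (in vmanifold) vmanifold_TT: "vmanifold TT"
  by (rule vmanifold.vmanifold_T[OF vmanifold_T])

text \<open>The complete lift with the definite descriptions replaced by the concrete
  \<open>flip\<close>, on \<open>N\<close> and on its tangent bundle. The field A lives on the
  tangent bundle of \<open>N\<close>.\<close>

definition (in vmanifold) lift :: "(('m, 'i, 'e) point \<Rightarrow> ('m, 'i, 'e) point) \<Rightarrow> ('m, 'i, 'e) point \<Rightarrow> ('m, 'i, 'e) point" where
  "lift A = tangent_map TT TT flip \<circ> vmanifold.flip (tangent_bundle N) \<circ>
     tangent_map (tangent_bundle N) TT A \<circ> flip"

context vmanifold
begin

interpretation T: vmanifold "tangent_bundle N"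
  by (rule vmanifold_T)

interpretation TT: vmanifold TT
  by (rule vmanifold_TT)

lemma vector_field_smooth: "A \<in> vector_fields N \<Longrightarrow> smooth_map N (tangent_bundle N) A"
  by (simp add: vector_fields_def smooth_section_def)

lemma vector_field_foot: "A \<in> vector_fields N \<Longrightarrow> p \<in> pts N \<Longrightarrow> foot (A p) = p"
  by (simp add: vector_fields_def smooth_section_def)

text \<open>Differentiate the section property:
  \<open>D\<pi> \<circ> DA = D(\<pi> \<circ> A) = D id\<close>. Equality with the identity holds on
  \<open>pts\<close> only, hence the congruence step.\<close>

lemma tangent_foot_section:
  assumes A: "A \<in> vector_fields N" and \<xi>: "\<xi> \<in> pts (tangent_bundle N)"
  shows "tangent_map (tangent_bundle N) N foot (tangent_map N (tangent_bundle N) A \<xi>) = \<xi>"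
proof -
  note sA = vector_field_smooth[OF A] and sf = smooth_map_foot[OF vmanifold_axioms]
  have "tangent_map (tangent_bundle N) N foot (tangent_map N (tangent_bundle N) A \<xi>) =
      tangent_map N N (foot \<circ> A) \<xi>"
    by (rule tangent_map_compose[OF vmanifold_axioms vmanifold_T vmanifold_axioms sA sf \<xi>, symmetric])
  also have "\<dots> = tangent_map N N (\<lambda>p. p) \<xi>"
    by (rule tangent_map_cong[OF vmanifold_axioms vmanifold_axioms
          smooth_map_compose[OF vmanifold_axioms vmanifold_T vmanifold_axioms sA sf] _ \<xi>])
      (simp add: vector_field_foot[OF A])
  also have "\<dots> = \<xi>"
    by (rule tangent_map_ident[OF vmanifold_axioms \<xi>])
  finally show ?thesis .
qed

end

context vmanifold
begin

interpretation T: vmanifold "tangent_bundle N"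
  by (rule vmanifold_T)

text \<open>The first two claims keep the intermediate values at genuine points, where the
  identities for the involution are valid. The third is \<open>\<pi> \<circ> \<kappa> \<circ> DA
  \<circ> \<kappa> = D\<pi> \<circ> DA \<circ> \<kappa> = \<kappa>\<close>.\<close>

lemma lift_steps:
  assumes A: "A \<in> vector_fields (tangent_bundle N)" and \<xi>: "\<xi> \<in> pts TT"
  shows "tangent_map (tangent_bundle N) TT A (flip \<xi>) \<in> pts (tangent_bundle TT)"
    and "T.flip (tangent_map (tangent_bundle N) TT A (flip \<xi>)) \<in> pts (tangent_bundle TT)"
    and "foot (T.flip (tangent_map (tangent_bundle N) TT A (flip \<xi>))) = flip \<xi>"
proof -
  note f = flip_pts[OF \<xi>]
  show DA: "tangent_map (tangent_bundle N) TT A (flip \<xi>) \<in> pts (tangent_bundle TT)"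
    by (rule tangent_map_pts[OF vmanifold_T vmanifold_TT T.vector_field_smooth[OF A] f])
  then show "T.flip (tangent_map (tangent_bundle N) TT A (flip \<xi>)) \<in> pts (tangent_bundle TT)"
    by (rule T.flip_pts)
  show "foot (T.flip (tangent_map (tangent_bundle N) TT A (flip \<xi>))) = flip \<xi>"
    using T.foot_flip[OF DA] T.tangent_foot_section[OF A f] by simp
qed

text \<open>The base point of the lift is \<open>\<kappa>\<close> of the base point before the last
  factor \<open>D\<kappa>\<close>, and that was \<open>flip \<xi>\<close>; the two flips cancel. The
  factor \<open>D\<kappa>\<close> in the definition is there for this purpose.\<close>

lemma lift_vector_field:
  assumes A: "A \<in> vector_fields (tangent_bundle N)"
  shows "lift A \<in> vector_fields TT"
proof -
  note TTT = vmanifold.vmanifold_T[OF vmanifold_TT]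
  have "smooth_map TT (tangent_bundle TT) (tangent_map (tangent_bundle N) TT A \<circ> flip)"
    by (rule smooth_map_compose[OF vmanifold_TT vmanifold_TT TTT smooth_map_flip
          smooth_map_tangent_map[OF vmanifold_T vmanifold_TT T.vector_field_smooth[OF A]]])
  then have "smooth_map TT (tangent_bundle TT) (T.flip \<circ> (tangent_map (tangent_bundle N) TT A \<circ> flip))"
    by (rule smooth_map_compose[OF vmanifold_TT TTT TTT _ T.smooth_map_flip])
  then have "smooth_map TT (tangent_bundle TT)
      (tangent_map TT TT flip \<circ> (T.flip \<circ> (tangent_map (tangent_bundle N) TT A \<circ> flip)))"
    by (rule smooth_map_compose[OF vmanifold_TT TTT TTT _
          smooth_map_tangent_map[OF vmanifold_TT vmanifold_TT smooth_map_flip]])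
  then have "smooth_map TT (tangent_bundle TT) (lift A)"
    by (simp add: lift_def comp_assoc)
  moreover have "foot (lift A \<xi>) = \<xi>" if "\<xi> \<in> pts TT" for \<xi>
    using lift_steps(3)[OF A that] flip_flip[OF that] by (simp add: lift_def)
  ultimately show ?thesis
    by (simp add: vector_fields_def smooth_section_def)
qed

lemma tangent_tangent_foot_lift:
  assumes A: "A \<in> vector_fields (tangent_bundle N)" and \<xi>: "\<xi> \<in> pts TT"
  shows "tangent_map TT (tangent_bundle N) (tangent_map (tangent_bundle N) N foot) (lift A \<xi>) =
    A (tangent_map (tangent_bundle N) N foot \<xi>)"
proof -
  let ?D = "tangent_map (tangent_bundle N) N foot"
  let ?\<eta> = "tangent_map (tangent_bundle N) TT A (flip \<xi>)"
  note steps = lift_steps[OF A \<xi>]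
  have sD: "smooth_map TT (tangent_bundle N) ?D"
    by (rule smooth_map_tangent_map[OF vmanifold_T vmanifold_axioms smooth_map_foot[OF vmanifold_axioms]])
  have "tangent_map TT (tangent_bundle N) ?D (lift A \<xi>) =
      tangent_map TT (tangent_bundle N) (?D \<circ> flip) (T.flip ?\<eta>)"
    using tangent_map_compose[OF vmanifold_TT vmanifold_TT vmanifold_T smooth_map_flip sD steps(2)]
    by (simp add: lift_def)
  also have "\<dots> = tangent_map TT (tangent_bundle N) foot (T.flip ?\<eta>)"
    by (rule tangent_map_cong[OF vmanifold_TT vmanifold_T
          smooth_map_compose[OF vmanifold_TT vmanifold_TT vmanifold_T smooth_map_flip sD] _ steps(2)])
      (simp add: tangent_foot_flip)
  also have "\<dots> = foot ?\<eta>"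
    by (rule T.tangent_foot_flip[OF steps(1)])
  also have "\<dots> = A (?D \<xi>)"
    using foot_flip[OF \<xi>] by simp
  finally show ?thesis .
qed

end

section \<open>The base manifold and the tower of tangent bundles\<close>

lemma linear_emb: "linear (emb :: 'e::real_vector \<Rightarrow> nat \<Rightarrow> 'e)"
  by (auto simp: linear_iff emb_def fun_eq_iff scaleR_fun_def)

lemma continuous_on_emb: "continuous_on UNIV (emb :: 'e::real_normed_vector \<Rightarrow> nat \<Rightarrow> 'e)"
proof (rule continuous_on_coordinatewise_then_product)
  show "continuous_on UNIV (\<lambda>x :: 'e. emb x n)" for n
    by (cases "n = 0") (simp_all add: emb_def continuous_on_id)
qed

lemma emb_0 [simp]: "emb x 0 = x"
  by (simp add: emb_def)

lemma range_emb: "range (emb :: 'e::real_normed_vector \<Rightarrow> nat \<Rightarrow> 'e) = {z. \<forall>n. n \<noteq> 0 \<longrightarrow> z n = 0}"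
proof
  show "{z. \<forall>n. n \<noteq> 0 \<longrightarrow> z n = 0} \<subseteq> range (emb :: 'e \<Rightarrow> _)"
  proof
    fix z :: "nat \<Rightarrow> 'e" assume "z \<in> {z. \<forall>n. n \<noteq> 0 \<longrightarrow> z n = 0}"
    then have "z = emb (z 0)"
      by (auto simp: emb_def)
    then show "z \<in> range emb"
      by (rule range_eqI)
  qed
qed (auto simp: emb_def)

lemma closed_range_emb: "closed (range (emb :: 'e::real_normed_vector \<Rightarrow> nat \<Rightarrow> 'e))"
proof -
  have "closed {z :: nat \<Rightarrow> 'e. n \<noteq> 0 \<longrightarrow> z n = 0}" for n
    by (cases "n = 0") (simp_all add: closed_Collect_eq continuous_on_const)
  then show ?thesis
    unfolding range_emb by (rule closed_Collect_all)
qed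

text \<open>Evaluation at index 0 is a continuous linear left inverse of \<open>emb\<close>.
  Coordinate changes of \<open>M\<close> are carried over by composing with it before and with
  \<open>emb\<close> after.\<close>

lemma vmanifold_base:
  assumes "banach_manifold M"
  shows "vmanifold (base_manifold M)"
proof
  let ?B = "base_manifold M"
  have M: "is_atlas M" "model M = UNIV"
    using assms by (auto simp: banach_manifold_def)
  have simps: "pts ?B = Base ` pts M" "idx ?B = idx M" "model ?B = range emb"
    "\<And>\<alpha>. cdom ?B \<alpha> = Base ` cdom M \<alpha>" "\<And>\<alpha> m. chart ?B \<alpha> (Base m) = emb (chart M \<alpha> m)"
    by (simp_all add: base_manifold_def M(2))
  have inj_emb: "x = y" if "emb x = emb y" for x y :: 'c
    using fun_cong[OF that, of 0] by simp
  have injM: "inj_on (chart M \<alpha>) (cdom M \<alpha>)" if "\<alpha> \<in> idx M" for \<alpha>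
    using M(1) that by (simp add: is_atlas_def)
  show sub: "subspace (model ?B)"
    unfolding simps by (rule linear_subspace_image[OF linear_emb subspace_UNIV])
  show cl: "closed (model ?B)"
    unfolding simps by (rule closed_range_emb)
  have inj: "inj_on (chart ?B \<alpha>) (cdom ?B \<alpha>)" if "\<alpha> \<in> idx M" for \<alpha>
    using injM[OF that] by (auto simp: simps inj_on_def dest!: inj_emb)
  have image: "chart ?B \<alpha> ` (cdom ?B \<alpha> \<inter> cdom ?B \<beta>) = emb ` (chart M \<alpha> ` (cdom M \<alpha> \<inter> cdom M \<beta>))" for \<alpha> \<beta>
    by (force simp: simps)
  have op: "openin (top_of_set (model ?B)) (emb ` W)" if "open W" for W
  proof -
    have "emb ` W = model ?B \<inter> (\<lambda>z. z 0) -` W"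
      unfolding simps by auto
    moreover have "open ((\<lambda>z :: nat \<Rightarrow> 'c. z 0) -` W)"
      by (rule open_vimage[OF that continuous_on_product_coordinates])
    ultimately show ?thesis
      by (simp add: openin_open_Int)
  qed
  have ov: "openin (top_of_set (model ?B)) (chart ?B \<alpha> ` (cdom ?B \<alpha> \<inter> cdom ?B \<beta>))"
    if "\<alpha> \<in> idx M" "\<beta> \<in> idx M" for \<alpha> \<beta>
    unfolding image by (rule op) (use M that in \<open>simp add: is_atlas_def\<close>)
  have sm: "smooth_on (model ?B) (chart ?B \<alpha> ` (cdom ?B \<alpha> \<inter> cdom ?B \<beta>)) (chart ?B \<beta> \<circ> chart_inv ?B \<alpha>)"
    if ab: "\<alpha> \<in> idx M" "\<beta> \<in> idx M" for \<alpha> \<beta>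
  proof -
    let ?W = "chart M \<alpha> ` (cdom M \<alpha> \<inter> cdom M \<beta>)"
    have ro: "radially_open (model ?B) (emb ` ?W)"
      by (rule model_domain_radially_open)
        (use ov[OF ab] sub cl in \<open>simp add: model_domain_def image\<close>)
    have "smooth_on UNIV ?W (chart M \<beta> \<circ> chart_inv M \<alpha>)"
      using M ab by (simp add: is_atlas_def)
    then have "smooth_on (model ?B) (emb ` ?W) (\<lambda>z. (chart M \<beta> \<circ> chart_inv M \<alpha>) (z 0))"
      by (rule smooth_on_precompose_linear)
        (auto simp: linear_iff scaleR_fun_def continuous_on_product_coordinates)
    then have "smooth_on (model ?B) (emb ` ?W) (\<lambda>z. emb ((chart M \<beta> \<circ> chart_inv M \<alpha>) (z 0)))"
      by (rule smooth_on_postcompose_linear[OF _ linear_emb continuous_on_emb ro])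
    then show ?thesis
      unfolding image
    proof (rule smooth_on_cong[OF ro, rotated])
      fix z assume "z \<in> emb ` ?W"
      then obtain m where m: "z = emb (chart M \<alpha> m)" "m \<in> cdom M \<alpha>" "m \<in> cdom M \<beta>"
        by auto
      have "chart_inv M \<alpha> (z 0) = m"
        using inv_into_f_f[OF injM[OF ab(1)] m(2)] by (simp add: chart_inv_def m(1))
      moreover have "chart_inv ?B \<alpha> z = Base m"
        using inv_into_f_f[OF inj[OF ab(1)], of "Base m"] m by (simp add: chart_inv_def simps)
      ultimately show "emb ((chart M \<beta> \<circ> chart_inv M \<alpha>) (z 0)) = (chart ?B \<beta> \<circ> chart_inv ?B \<alpha>) z"
        by (simp add: simps)
    qed
  qed
  have "pts ?B = (\<Union>\<alpha>\<in>idx M. cdom ?B \<alpha>)"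
    using M(1) by (auto simp: simps is_atlas_def)
  then show "is_atlas ?B"
    unfolding is_atlas_def simps(2) using inj ov[of \<alpha> \<alpha> for \<alpha>] ov sm by simp
qed

lemma vmanifold_iter_tangent: "banach_manifold M \<Longrightarrow> vmanifold (iter_tangent M r)"
  by (induction r) (simp_all add: vmanifold_base vmanifold.vmanifold_T)

lemma kappa_eq_flip: "banach_manifold M \<Longrightarrow> kappa M (Suc (Suc r)) = vmanifold.flip (iter_tangent M r)"
  by (simp add: kappa_def vmanifold.canonical_flip_eq vmanifold_iter_tangent)

text \<open>For a field on \<open>T^(j+1) M\<close> the involutions in question are those of index j
  + 2 and j + 3, that is \<open>flip\<close> of \<open>T^j M\<close> and of its tangent bundle; the
  special case \<open>kappa M 1\<close> does not occur.\<close>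

lemma complete_lift_eq_lift:
  assumes "banach_manifold M"
  shows "complete_lift M (Suc j) A = vmanifold.lift (iter_tangent M j) A"
proof -
  have "kappa M (Suc (Suc (Suc j))) = vmanifold.flip (tangent_bundle (iter_tangent M j))"
    using kappa_eq_flip[OF assms, of "Suc j"] by simp
  then show ?thesis
    using kappa_eq_flip[OF assms, of j]
    by (simp add: complete_lift_def vmanifold.lift_def[OF vmanifold_iter_tangent[OF assms]])
qed

lemma iter_lift_vector_field:
  assumes M: "banach_manifold M" and X: "X \<in> vector_fields (iter_tangent M 1)"
  shows "iter_lift M X i \<in> vector_fields (iter_tangent M (Suc i))"
proof (induction i)
  case 0
  then show ?case
    using X by simp
next
  case (Suc i)
  then show ?case
    using vmanifold.lift_vector_field[OF vmanifold_iter_tangent[OF M, of i]]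
    by (simp add: complete_lift_eq_lift[OF M])
qed

lemma iter_lift_compatible:
  assumes M: "banach_manifold M" and X: "X \<in> vector_fields (iter_tangent M 1)"
    and \<xi>: "\<xi> \<in> pts (iter_tangent M (Suc (Suc i)))"
  shows "D2_proj M i (iter_lift M X (Suc i) \<xi>) = iter_lift M X i (D_proj M i \<xi>)"
  using vmanifold.tangent_tangent_foot_lift[OF vmanifold_iter_tangent[OF M, of i], of "iter_lift M X i" \<xi>]
    iter_lift_vector_field[OF M X, of i] \<xi>
  by (simp add: D2_proj_def D_proj_def complete_lift_eq_lift[OF M])

section \<open>The projective limit\<close>

text \<open>Difference quotients and the product topology are both componentwise, so every iterated
  derivative can be taken in each component i, with \<open>\<lambda>j. v j i\<close> as its list of
  directions. Radial openness of \<open>V\<close> is enough, so the lemma applies to the limit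
  model.\<close>

lemma smooth_on_componentwise:
  fixes f :: "nat \<Rightarrow> (nat \<Rightarrow> 'a::real_normed_vector) \<Rightarrow> nat \<Rightarrow> 'b::real_normed_vector"
  assumes ro: "radially_open S V" and f: "\<And>i. smooth_on (S' i) (V' i) (f i)"
    and S: "\<And>z i. z \<in> S \<Longrightarrow> z i \<in> S' i" and V: "\<And>z i. z \<in> V \<Longrightarrow> z i \<in> V' i"
  shows "smooth_on S V (\<lambda>z i. f i (z i))"
proof (rule smooth_onI(1)[where e = "\<lambda>k z v i. iter_deriv k (f i) (z i) (\<lambda>j. v j i)", OF ro])
  have rg: "range (\<lambda>j. v j i) \<subseteq> S' i" if "range v \<subseteq> S" for v :: "nat \<Rightarrow> nat \<Rightarrow> nat \<Rightarrow> 'a" and i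
    using S[of "v j" i for j] that by (auto simp: image_subset_iff)
  fix k
  let ?D = "V \<times> {v :: nat \<Rightarrow> nat \<Rightarrow> nat \<Rightarrow> 'a. range v \<subseteq> S}"
  show "continuous_on ?D (\<lambda>(z, v) i. iter_deriv k (f i) (z i) (\<lambda>j. v j i))"
    unfolding case_prod_beta
  proof (rule continuous_on_coordinatewise_then_product)
    fix i
    have "continuous_on ?D (\<lambda>p. (fst p i, \<lambda>j. snd p j i))"
      by (intro continuous_on_Pair continuous_on_coordinatewise_then_product[where f = "\<lambda>p j. snd p j i"]
          continuous_on_coord[OF continuous_on_coord[OF continuous_on_snd[OF continuous_on_id]]]
          continuous_on_coord[OF continuous_on_fst[OF continuous_on_id]])
    then have "continuous_on ?D (\<lambda>p. (\<lambda>(x, v). iter_deriv k (f i) x v) (fst p i, \<lambda>j. snd p j i))"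
    proof (rule continuous_on_compose2[OF smooth_on_continuous[OF f]])
      show "(\<lambda>p. (fst p i, \<lambda>j. snd p j i)) ` ?D \<subseteq> V' i \<times> {v. range v \<subseteq> S' i}"
      proof (rule image_subsetI)
        fix p assume "p \<in> ?D"
        then have "fst p \<in> V" "range (snd p) \<subseteq> S"
          by auto
        then show "(fst p i, \<lambda>j. snd p j i) \<in> V' i \<times> {v. range v \<subseteq> S' i}"
          using V rg[of "snd p" i] by blast
      qed
    qed
    then show "continuous_on ?D (\<lambda>p. iter_deriv k (f i) (fst p i) (\<lambda>j. snd p j i))"
      by simp
  qed
  fix z and v :: "nat \<Rightarrow> nat \<Rightarrow> nat \<Rightarrow> 'a" assume zv: "z \<in> V" "range v \<subseteq> S"
  show "has_dir_deriv (\<lambda>z i. iter_deriv k (f i) (z i) (\<lambda>j. v j i)) z (v k)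
      (\<lambda>i. iter_deriv (Suc k) (f i) (z i) (\<lambda>j. v j i))"
  proof (rule has_dir_deriv_fun_iff[THEN iffD2], rule allI)
    fix i
    show "has_dir_deriv (\<lambda>z. iter_deriv k (f i) (z i) (\<lambda>j. v j i)) z (v k)
        (iter_deriv (Suc k) (f i) (z i) (\<lambda>j. v j i))"
      using smooth_on_has_dir_deriv[OF f V[OF zv(1)] rg[OF zv(2)], of k i]
      by (simp add: has_dir_deriv_def scaleR_fun_def)
  qed
qed simp

lemma vec_tangent_vfst: "vec_tangent vfst z = vpair (vfst (vfst z)) (vfst (vsnd z))"
  by (simp add: vec_tangent_eq_tfun tfun_vfst)

lemma iter_tangent_idx: "banach_manifold M \<Longrightarrow> idx (iter_tangent M r) = idx M"
  by (induction r) (simp_all add: vmanifold.idx_T[OF vmanifold_iter_tangent] base_manifold_def)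

lemma lim_manifold_simps:
  "pts (lim_manifold N f g) = proj_lim (\<lambda>i. pts (N i)) f"
  "idx (lim_manifold N f g) = idx (N 0)"
  "model (lim_manifold N f g) = proj_lim (\<lambda>i. model (N i)) (\<lambda>_. g)"
  "cdom (lim_manifold N f g) \<alpha> = proj_lim (\<lambda>i. cdom (N i) \<alpha>) f"
  "chart (lim_manifold N f g) \<alpha> \<xi> = (\<lambda>i. chart (N i) \<alpha> (\<xi> i))"
  by (simp_all add: lim_manifold_def)

context
  fixes M :: "('m, 'i, 'e::banach) atlas"
  assumes M: "banach_manifold M"
begin

text \<open>Level i of the system for the tangent bundle of the limit is \<open>TT^i M\<close>,
  hence the shift by one.\<close>

abbreviation tower :: "nat \<Rightarrow> ('m, 'i, 'e) manifold" where
  "tower i \<equiv> iter_tangent M (Suc i)"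

lemma vmanifold_tower: "vmanifold (tower i)"
  by (rule vmanifold_iter_tangent[OF M])

lemma T_Tinf_simps:
  "pts (T_Tinf M) = proj_lim (\<lambda>i. pts (tower i)) (D_proj M)"
  "idx (T_Tinf M) = idx M"
  "model (T_Tinf M) = proj_lim (\<lambda>i. model (tower i)) (\<lambda>_. vec_tangent vfst)"
  "cdom (T_Tinf M) \<alpha> = proj_lim (\<lambda>i. cdom (tower i) \<alpha>) (D_proj M)"
  "chart (T_Tinf M) \<alpha> \<xi> = (\<lambda>i. chart (tower i) \<alpha> (\<xi> i))"
  using iter_tangent_idx[OF M, of 1] by (simp_all add: T_Tinf_def lim_manifold_simps)

lemma T2_Tinf_simps:
  "pts (T2_Tinf M) = proj_lim (\<lambda>i. pts (tower (Suc i))) (D2_proj M)"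
  "idx (T2_Tinf M) = idx M"
  "cdom (T2_Tinf M) \<alpha> = proj_lim (\<lambda>i. cdom (tower (Suc i)) \<alpha>) (D2_proj M)"
  "chart (T2_Tinf M) \<alpha> \<xi> = (\<lambda>i. chart (tower (Suc i)) \<alpha> (\<xi> i))"
  using iter_tangent_idx[OF M, of 2] by (simp_all add: T2_Tinf_def lim_manifold_simps numeral_2_eq_2)

lemma idx_tower: "idx (tower i) = idx M"
  by (rule iter_tangent_idx[OF M])

lemma D_proj_cdom:
  assumes "\<alpha> \<in> idx M" "\<xi> \<in> cdom (tower (Suc i)) \<alpha>"
  shows "D_proj M i \<xi> \<in> cdom (tower i) \<alpha>"
    and "chart (tower i) \<alpha> (D_proj M i \<xi>) = vec_tangent vfst (chart (tower (Suc i)) \<alpha> \<xi>)"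
proof -
  have \<alpha>: "\<alpha> \<in> idx (iter_tangent M i)"
    using assms(1) iter_tangent_idx[OF M] by simp
  show "D_proj M i \<xi> \<in> cdom (tower i) \<alpha>"
    using vmanifold.tangent_foot_cdom[OF vmanifold_iter_tangent[OF M] \<alpha>] assms(2) by (simp add: D_proj_def)
  show "chart (tower i) \<alpha> (D_proj M i \<xi>) = vec_tangent vfst (chart (tower (Suc i)) \<alpha> \<xi>)"
    using chart_tangent_foot[OF vmanifold_iter_tangent[OF M] \<alpha>] assms(2) by (simp add: D_proj_def vec_tangent_eq_tfun)
qed

abbreviation chart_overlap :: "nat \<Rightarrow> 'i \<Rightarrow> 'i \<Rightarrow> (nat \<Rightarrow> 'e) set" where
  "chart_overlap i \<alpha> \<beta> \<equiv> chart (tower i) \<alpha> ` (cdom (tower i) \<alpha> \<inter> cdom (tower i) \<beta>)"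

text \<open>An overlap condition constrains only the innermost base component
  \<open>vfst (vfst z)\<close>, which the connecting map retains; the other components are free in
  the model. So it passes upwards from level i.\<close>

lemma chart_overlap_Suc:
  assumes "\<alpha> \<in> idx M" "\<beta> \<in> idx M" "z \<in> model (tower (Suc i))" "vec_tangent vfst z \<in> chart_overlap i \<alpha> \<beta>"
  shows "z \<in> chart_overlap (Suc i) \<alpha> \<beta>"
proof -
  interpret N: vmanifold "iter_tangent M i"
    by (rule vmanifold_iter_tangent[OF M])
  have idx: "\<alpha> \<in> idx (iter_tangent M i)" "\<beta> \<in> idx (iter_tangent M i)"
    using assms(1,2) iter_tangent_idx[OF M] by simp_all
  have "z \<in> tdom (tdom (model (iter_tangent M i)) (model (iter_tangent M i)))
      (tdom (model (iter_tangent M i)) (model (iter_tangent M i)))"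
    using assms(3) vmanifold.model_T[OF N.vmanifold_T] by (simp add: N.model_T)
  moreover have "vec_tangent vfst z \<in> tdom (N.overlap \<alpha> \<beta>) (model (iter_tangent M i))"
    using assms(4) N.overlap_T[OF idx] by simp
  ultimately have "z \<in> tdom (tdom (N.overlap \<alpha> \<beta>) (model (iter_tangent M i)))
      (tdom (model (iter_tangent M i)) (model (iter_tangent M i)))"
    unfolding vec_tangent_vfst by (simp only: mem_tdom vfst_vpair)
  then show ?thesis
    using N.overlap_TT[OF idx] by simp
qed

text \<open>The overlap condition at level 0 forces it at all levels by
  \<open>chart_overlap_Suc\<close>. An intersection of infinitely many conditions thus becomes one
  condition on a single coordinate, which is what makes it open in the limit.\<close>

lemma lim_chart_image:
  assumes ab: "\<alpha> \<in> idx M" "\<beta> \<in> idx M"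
  shows "chart (T_Tinf M) \<alpha> ` {\<xi> \<in> cdom (T_Tinf M) \<alpha>. \<forall>i. \<xi> i \<in> cdom (tower i) \<beta>} =
    {z \<in> model (T_Tinf M). z 0 \<in> chart_overlap 0 \<alpha> \<beta>}" (is "?L = ?R")
proof
  show "?L \<subseteq> ?R"
  proof (rule image_subsetI)
    fix \<xi> assume "\<xi> \<in> {\<xi> \<in> cdom (T_Tinf M) \<alpha>. \<forall>i. \<xi> i \<in> cdom (tower i) \<beta>}"
    then have \<xi>: "\<xi> i \<in> cdom (tower i) \<alpha>" "D_proj M i (\<xi> (Suc i)) = \<xi> i" "\<xi> i \<in> cdom (tower i) \<beta>" for i
      by (auto simp: T_Tinf_simps proj_lim_def)
    have "chart (tower i) \<alpha> (\<xi> i) \<in> model (tower i)" for i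
      by (rule vmanifold.chart_in_model[OF vmanifold_tower _ \<xi>(1)]) (simp only: idx_tower ab)
    moreover have "vec_tangent vfst (chart (tower (Suc i)) \<alpha> (\<xi> (Suc i))) = chart (tower i) \<alpha> (\<xi> i)" for i
      using D_proj_cdom(2)[OF ab(1) \<xi>(1)] \<xi>(2) by metis
    moreover have "chart (tower 0) \<alpha> (\<xi> 0) \<in> chart_overlap 0 \<alpha> \<beta>"
      using \<xi>(1,3) by blast
    ultimately show "chart (T_Tinf M) \<alpha> \<xi> \<in> ?R"
      unfolding T_Tinf_simps proj_lim_def by blast
  qed
  show "?R \<subseteq> ?L"
  proof
    fix z assume "z \<in> ?R"
    then have z: "z i \<in> model (tower i)" "vec_tangent vfst (z (Suc i)) = z i" "z 0 \<in> chart_overlap 0 \<alpha> \<beta>" for i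
      unfolding T_Tinf_simps proj_lim_def by blast+
    have over: "z i \<in> chart_overlap i \<alpha> \<beta>" for i
    proof (induction i)
      case (Suc i)
      show ?case
        by (rule chart_overlap_Suc[OF ab z(1)]) (simp only: z(2) Suc)
    qed (rule z(3))
    then have "\<exists>\<xi>. z i = chart (tower i) \<alpha> \<xi> \<and> \<xi> \<in> cdom (tower i) \<alpha> \<and> \<xi> \<in> cdom (tower i) \<beta>" for i
      by blast
    then obtain \<xi> where \<xi>: "z i = chart (tower i) \<alpha> (\<xi> i)" "\<xi> i \<in> cdom (tower i) \<alpha>" "\<xi> i \<in> cdom (tower i) \<beta>" for i
      by metis
    \<comment> \<open>The points were chosen level by level. They form a thread because both sides
      lie in one chart domain and have the same coordinate.\<close>
    have "D_proj M i (\<xi> (Suc i)) = \<xi> i" for i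
    proof (rule inj_onD[OF vmanifold.inj_chart[OF vmanifold_tower]])
      show "\<alpha> \<in> idx (tower i)"
        by (simp only: idx_tower ab)
      show "chart (tower i) \<alpha> (D_proj M i (\<xi> (Suc i))) = chart (tower i) \<alpha> (\<xi> i)"
        unfolding D_proj_cdom(2)[OF ab(1) \<xi>(2)] using z(2)[of i] by (simp only: \<xi>(1))
    qed (rule D_proj_cdom(1)[OF ab(1) \<xi>(2)], rule \<xi>(2))
    then have "\<xi> \<in> {\<xi> \<in> cdom (T_Tinf M) \<alpha>. \<forall>i. \<xi> i \<in> cdom (tower i) \<beta>}"
      using \<xi>(2,3) unfolding T_Tinf_simps proj_lim_def by blast
    moreover have "z = chart (T_Tinf M) \<alpha> \<xi>"
      unfolding T_Tinf_simps using \<xi>(1) by (rule ext)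
    ultimately show "z \<in> ?L"
      by blast
  qed
qed

lemma lim_chart_inv:
  assumes "\<alpha> \<in> idx M" "z \<in> chart (T_Tinf M) \<alpha> ` cdom (T_Tinf M) \<alpha>"
  shows "chart_inv (T_Tinf M) \<alpha> z i = chart_inv (tower i) \<alpha> (z i)"
proof -
  let ?\<xi> = "chart_inv (T_Tinf M) \<alpha> z"
  have \<xi>: "?\<xi> \<in> cdom (T_Tinf M) \<alpha>" "chart (T_Tinf M) \<alpha> ?\<xi> = z"
    using inv_into_into[OF assms(2)] f_inv_into_f[OF assms(2)] by (simp_all add: chart_inv_def)
  have "?\<xi> i \<in> cdom (tower i) \<alpha>"
    using \<xi>(1) unfolding T_Tinf_simps proj_lim_def by blast
  then have "chart_inv (tower i) \<alpha> (chart (tower i) \<alpha> (?\<xi> i)) = ?\<xi> i"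
    by (intro vmanifold.chart_inv_chart[OF vmanifold_tower]) (simp_all only: idx_tower assms(1))
  moreover have "chart (tower i) \<alpha> (?\<xi> i) = z i"
    using fun_cong[OF \<xi>(2), of i] by (simp only: T_Tinf_simps)
  ultimately show ?thesis
    by (simp only:)
qed

text \<open>The connecting maps of the model are linear, so threads of vectors can be combined
  levelwise.\<close>

lemma model_affine:
  assumes "z \<in> model (T_Tinf M)" "w \<in> model (T_Tinf M)"
  shows "z + t *\<^sub>R w \<in> model (T_Tinf M)"
proof -
  have zw: "z i \<in> model (tower i)" "w i \<in> model (tower i)"
    "vec_tangent vfst (z (Suc i)) = z i" "vec_tangent vfst (w (Suc i)) = w i" for i
    using assms unfolding T_Tinf_simps proj_lim_def by blast+
  have "(z + t *\<^sub>R w) i = z i + t *\<^sub>R w i" for i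
    by (simp add: scaleR_fun_def)
  moreover have "z i + t *\<^sub>R w i \<in> model (tower i)" for i
    using vmanifold.subspace_model[OF vmanifold_tower] zw(1,2) by (intro subspace_add subspace_scale)
  moreover have "vec_tangent vfst (z (Suc i) + t *\<^sub>R w (Suc i)) = z i + t *\<^sub>R w i" for i
    unfolding zw(3,4)[of i, symmetric] vec_tangent_vfst by (simp add: vpair_add vpair_scaleR)
  ultimately show ?thesis
    unfolding T_Tinf_simps proj_lim_def by simp
qed

text \<open>Stated for any compatible family of vector fields on the tower; nothing specific to
  complete lifts enters.\<close>

lemma smooth_map_lim:
  assumes A: "\<And>i. A i \<in> vector_fields (tower i)"
    and compat: "\<And>i \<xi>. \<xi> \<in> pts (tower (Suc i)) \<Longrightarrow> D2_proj M i (A (Suc i) \<xi>) = A i (D_proj M i \<xi>)"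
  shows "smooth_map (T_Tinf M) (T2_Tinf M) (lim_map A)"
proof (rule smooth_mapI)
  have sA: "smooth_map (tower i) (tower (Suc i)) (A i)" for i
    using vmanifold.vector_field_smooth[OF vmanifold_tower A] by simp
  have lim: "D2_proj M i (A (Suc i) (\<xi> (Suc i))) = A i (\<xi> i)"
    if "\<And>i. \<xi> i \<in> pts (tower i)" "\<And>i. D_proj M i (\<xi> (Suc i)) = \<xi> i" for \<xi> i
    using compat[OF that(1)] that(2) by simp
  show "lim_map A \<xi> \<in> pts (T2_Tinf M)" if "\<xi> \<in> pts (T_Tinf M)" for \<xi>
  proof -
    have \<xi>: "\<xi> i \<in> pts (tower i)" "D_proj M i (\<xi> (Suc i)) = \<xi> i" for i
      using that unfolding T_Tinf_simps proj_lim_def by blast+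
    have "A i (\<xi> i) \<in> pts (tower (Suc i))" for i
      by (rule smooth_map_pts[OF sA \<xi>(1)])
    then show ?thesis
      using lim[of \<xi>, OF \<xi>] unfolding T2_Tinf_simps proj_lim_def lim_map_def by blast
  qed
  fix \<alpha> \<beta> assume "\<alpha> \<in> idx (T_Tinf M)" "\<beta> \<in> idx (T2_Tinf M)"
  then have ab: "\<alpha> \<in> idx M" "\<beta> \<in> idx M"
    by (simp_all only: T_Tinf_simps T2_Tinf_simps)
  then have idx: "\<alpha> \<in> idx (tower i)" "\<beta> \<in> idx (tower i)" for i
    by (simp_all only: idx_tower)
  \<comment> \<open>A section fixes base points, and lying over the chart \<beta> depends on the
    base point alone.\<close>
  have cdom_A: "A i p \<in> cdom (tower (Suc i)) \<beta> \<longleftrightarrow> p \<in> cdom (tower i) \<beta>" if p: "p \<in> pts (tower i)" for i p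
  proof -
    have "A i p \<in> cdom (tangent_bundle (tower i)) \<beta> \<longleftrightarrow>
        A i p \<in> pts (tangent_bundle (tower i)) \<and> foot (A i p) \<in> cdom (tower i) \<beta>"
      by (rule vmanifold.cdom_T_iff[OF vmanifold_tower idx(2)])
    then show ?thesis
      using smooth_map_pts[OF sA p] vmanifold.vector_field_foot[OF vmanifold_tower A p] by simp
  qed
  let ?V = "rep_dom (T_Tinf M) (T2_Tinf M) (lim_map A) \<alpha> \<beta>"
  let ?D = "{\<xi> \<in> cdom (T_Tinf M) \<alpha>. \<forall>i. \<xi> i \<in> cdom (tower i) \<beta>}"
  \<comment> \<open>The image of a thread is a thread by compatibility, so lying in the target chart
    amounts to chart membership at each level, which \<open>cdom_A\<close> transfers to the
    argument.\<close>
  have "cdom (T_Tinf M) \<alpha> \<inter> lim_map A -` cdom (T2_Tinf M) \<beta> = ?D"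
  proof (rule set_eqI)
    fix \<xi>
    have "lim_map A \<xi> \<in> cdom (T2_Tinf M) \<beta> \<longleftrightarrow> (\<forall>i. \<xi> i \<in> cdom (tower i) \<beta>)" if "\<xi> \<in> cdom (T_Tinf M) \<alpha>"
    proof -
      have \<xi>: "\<xi> i \<in> cdom (tower i) \<alpha>" "D_proj M i (\<xi> (Suc i)) = \<xi> i" for i
        using that unfolding T_Tinf_simps proj_lim_def by blast+
      have pts: "\<xi> i \<in> pts (tower i)" for i
        unfolding vmanifold.pts_eq[OF vmanifold_tower] by (rule UN_I[OF idx(1)], rule \<xi>(1))
      show ?thesis
        using lim[of \<xi>, OF pts \<xi>(2)] cdom_A[OF pts]
        unfolding T2_Tinf_simps proj_lim_def lim_map_def by blast
    qed
    then show "\<xi> \<in> cdom (T_Tinf M) \<alpha> \<inter> lim_map A -` cdom (T2_Tinf M) \<beta> \<longleftrightarrow> \<xi> \<in> ?D"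
      by blast
  qed
  then have V: "?V = {z \<in> model (T_Tinf M). z 0 \<in> chart_overlap 0 \<alpha> \<beta>}" and VD: "?V = chart (T_Tinf M) \<alpha> ` ?D"
    by (simp_all only: lim_chart_image[OF ab])
  have md: "model_domain (model (tower 0)) (chart_overlap 0 \<alpha> \<beta>)"
    by (rule vmanifold.model_domain_overlap[OF vmanifold_tower idx])
  obtain B where B: "open B" "chart_overlap 0 \<alpha> \<beta> = B \<inter> model (tower 0)"
    using md by (rule model_domain_open)
  have model0: "z 0 \<in> model (tower 0)" if "z \<in> model (T_Tinf M)" for z
    using that unfolding T_Tinf_simps proj_lim_def by blast
  have "?V = model (T_Tinf M) \<inter> (\<lambda>z. z 0) -` B"
    unfolding V B(2) using model0 by blast
  moreover have "open ((\<lambda>z :: nat \<Rightarrow> nat \<Rightarrow> 'e. z 0) -` B)"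
    by (rule open_vimage[OF B(1) continuous_on_product_coordinates])
  ultimately show "openin (top_of_set (model (T_Tinf M))) ?V"
    by (simp only: openin_open_Int)
  \<comment> \<open>Only component 0 has to be controlled along the line; the line itself stays in
    the limit model by \<open>model_affine\<close>.\<close>
  have ro: "radially_open (model (T_Tinf M)) ?V"
    unfolding radially_open_def
  proof (intro ballI)
    fix z w assume z: "z \<in> ?V" and w: "w \<in> model (T_Tinf M)"
    have z0: "z \<in> model (T_Tinf M)" "z 0 \<in> chart_overlap 0 \<alpha> \<beta>"
      using z unfolding V by blast+
    have "\<forall>\<^sub>F t in at 0. z 0 + t *\<^sub>R w 0 \<in> chart_overlap 0 \<alpha> \<beta>"
      using model_domain_radially_open[OF md] z0(2) model0[OF w] unfolding radially_open_def by blast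
    then show "\<forall>\<^sub>F t in at 0. z + t *\<^sub>R w \<in> ?V"
    proof (rule eventually_mono)
      fix t assume "z 0 + t *\<^sub>R w 0 \<in> chart_overlap 0 \<alpha> \<beta>"
      moreover have "(z + t *\<^sub>R w) 0 = z 0 + t *\<^sub>R w 0"
        by (simp add: scaleR_fun_def)
      ultimately show "z + t *\<^sub>R w \<in> ?V"
        unfolding V using model_affine[OF z0(1) w] by simp
    qed
  qed
  let ?f = "\<lambda>i. local_rep (tower i) (tower (Suc i)) (A i) \<alpha> \<beta>"
  have "smooth_on (model (T_Tinf M)) ?V (\<lambda>z i. ?f i (z i))"
  proof (rule smooth_on_componentwise[OF ro])
    show "smooth_on (model (tower i)) (rep_dom (tower i) (tower (Suc i)) (A i) \<alpha> \<beta>) (?f i)" for i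
      by (rule smooth_map_rep(2)[OF vmanifold_tower sA idx])
    show "z i \<in> model (tower i)" if "z \<in> model (T_Tinf M)" for z i
      using that unfolding T_Tinf_simps proj_lim_def by blast
    show "z i \<in> rep_dom (tower i) (tower (Suc i)) (A i) \<alpha> \<beta>" if z: "z \<in> ?V" for z i
    proof -
      obtain \<xi> where "z = chart (T_Tinf M) \<alpha> \<xi>" "\<xi> \<in> ?D"
        using z unfolding VD by blast
      then have \<xi>: "z i = chart (tower i) \<alpha> (\<xi> i)" "\<xi> i \<in> cdom (tower i) \<alpha>" "\<xi> i \<in> cdom (tower i) \<beta>"
        unfolding T_Tinf_simps proj_lim_def by blast+
      have "\<xi> i \<in> pts (tower i)"
        unfolding vmanifold.pts_eq[OF vmanifold_tower] by (rule UN_I[OF idx(1)], rule \<xi>(2))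
      then show ?thesis
        unfolding \<xi>(1) using \<xi>(2,3) cdom_A by blast
    qed
  qed
  then show "smooth_on (model (T_Tinf M)) ?V (local_rep (T_Tinf M) (T2_Tinf M) (lim_map A) \<alpha> \<beta>)"
  proof (rule smooth_on_cong[OF ro, rotated])
    fix z assume "z \<in> ?V"
    then have "z \<in> chart (T_Tinf M) \<alpha> ` cdom (T_Tinf M) \<alpha>"
      unfolding VD by blast
    then show "(\<lambda>i. ?f i (z i)) = local_rep (T_Tinf M) (T2_Tinf M) (lim_map A) \<alpha> \<beta> z"
      unfolding local_rep_def comp_apply T2_Tinf_simps lim_map_def
      by (simp only: lim_chart_inv[OF ab(1)])
  qed
qed

end

theorem theorem3p5:
  fixes M :: "('m, 'i, 'e::banach) atlas"
    and X :: "('m, 'i, 'e) point \<Rightarrow> ('m, 'i, 'e) point"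
  assumes "banach_manifold M"
    and "partitionable M"
    and "X \<in> vector_fields (iter_tangent M 1)"
  shows "(\<forall>i. iter_lift M X i \<in> vector_fields (iter_tangent M (i + 1))) \<and>
         (\<forall>i. \<forall>\<xi>\<in>pts (iter_tangent M (i + 2)).
            D2_proj M i (iter_lift M X (i + 1) \<xi>) = iter_lift M X i (D_proj M i \<xi>)) \<and>
         lim_map (iter_lift M X) \<in> vector_fields_T_Tinf M"
proof (intro conjI allI ballI)
  note lift = iter_lift_vector_field[OF assms(1,3)] and compat = iter_lift_compatible[OF assms(1,3)]
  show "iter_lift M X i \<in> vector_fields (iter_tangent M (i + 1))" for i
    using lift[of i] by simp
  show "D2_proj M i (iter_lift M X (i + 1) \<xi>) = iter_lift M X i (D_proj M i \<xi>)"
    if "\<xi> \<in> pts (iter_tangent M (i + 2))" for i \<xi>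
    using compat[of \<xi> i] that by (simp only: add_2_eq_Suc' Suc_eq_plus1[symmetric])
  have "smooth_map (T_Tinf M) (T2_Tinf M) (lim_map (iter_lift M X))"
    by (rule smooth_map_lim[OF assms(1) lift compat])
  moreover have "lim_map (\<lambda>_. foot) (lim_map (iter_lift M X) \<xi>) = \<xi>" if "\<xi> \<in> pts (T_Tinf M)" for \<xi>
  proof
    fix i
    have "\<xi> i \<in> pts (iter_tangent M (Suc i))"
      using that unfolding T_Tinf_simps[OF assms(1)] proj_lim_def by blast
    then show "lim_map (\<lambda>_. foot) (lim_map (iter_lift M X) \<xi>) i = \<xi> i"
      using vmanifold.vector_field_foot[OF vmanifold_iter_tangent[OF assms(1)] lift] by (simp add: lim_map_def)
  qed
  ultimately show "lim_map (iter_lift M X) \<in> vector_fields_T_Tinf M"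
    by (simp add: vector_fields_T_Tinf_def smooth_section_def)
qed

end
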